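(* Let $n\geq 2$, let $K_1,\dots,K_n$ be non-empty compact sets in $\mathbb{C}$ and let $\widetilde\Omega\Subset\mathbb{C}^n$ be a bounded domain with $H^{0,1}_{L^2}(\widetilde\Omega)=0$. Set $K=K_1\times\dots\times K_n$ and assume that $K\subset\widetilde\Omega$ and that $\Omega=\widetilde\Omega\setminus K$ is not empty and connected. Then $H^{0,1}_{L^2}(\Omega)$ is Hausdorff, and $H^{0,1}_{L^2}(\Omega)=0$ if $n\geq 3$.
   Context: For an open set $U\subset\mathbb{C}^n$, $L^2_{p,q}(U)$ is the space of $(p,q)$-forms on $U$ with $L^2$ coefficients and $\overline\partial$ acts in the sense of distributions. The $L^2$-Dolbeault cohomology is $$H^{p,q}_{L^2}(U)=\frac{\{f\in L^2_{p,q}(U):\overline\partial f=0\}}{\{\overline\partial g: g\in L^2_{p,q-1}(U),\ \overline\partial g\in L^2_{p,q}(U)\}},$$ with the quotient topology; it is Hausdorff if and only if $\overline\partial$ from $L^2_{p,q-1}(U)$ to $L^2_{p,q}(U)$ (with its maximal domain) has closed range. *)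

theory Defs
  imports "HOL-Analysis.Analysis"
begin

section \<open>Test functions and the operators d/d(zbar_j)\<close>

fun C_k :: "nat \<Rightarrow> ('a::real_normed_vector \<Rightarrow> 'b::real_normed_vector) \<Rightarrow> bool" where
  "C_k 0 f \<longleftrightarrow> continuous_on UNIV f"
| "C_k (Suc k) f \<longleftrightarrow>
     (\<forall>x. f differentiable (at x)) \<and> (\<forall>v. C_k k (\<lambda>x. frechet_derivative f (at x) v))"

definition smooth :: "('a::real_normed_vector \<Rightarrow> 'b::real_normed_vector) \<Rightarrow> bool" where
  "smooth f \<longleftrightarrow> (\<forall>k. C_k k f)"

definition test_functions :: "(complex ^ 'n) set \<Rightarrow> (complex ^ 'n \<Rightarrow> complex) set" where
  "test_functions U =
     {\<phi>. smooth \<phi> \<and> compact (closure {z. \<phi> z \<noteq> 0}) \<and> closure {z. \<phi> z \<noteq> 0} \<subseteq> U}"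

text \<open>With \<open>z\<^sub>j = x\<^sub>j + i y\<^sub>j\<close>, this is \<open>(1/2) (d/dx\<^sub>j + i d/dy\<^sub>j)\<close>; the Frechet derivative is
  taken over the reals.\<close>

definition dzbar :: "'n \<Rightarrow> (complex ^ 'n \<Rightarrow> complex) \<Rightarrow> complex ^ 'n \<Rightarrow> complex" where
  "dzbar j \<phi> z = (frechet_derivative \<phi> (at z) (axis j 1)
                   + \<i> * frechet_derivative \<phi> (at z) (axis j \<i>)) / 2"

definition distr_of ::
  "(complex ^ 'n) set \<Rightarrow> (complex ^ 'n \<Rightarrow> complex) \<Rightarrow> (complex ^ 'n \<Rightarrow> complex) \<Rightarrow> complex" where
  "distr_of U f \<phi> = (LINT z:U|lborel. f z * \<phi> z)"

definition distr_dzbar ::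
  "'n \<Rightarrow> ((complex ^ 'n \<Rightarrow> complex) \<Rightarrow> complex) \<Rightarrow> (complex ^ 'n \<Rightarrow> complex) \<Rightarrow> complex" where
  "distr_dzbar j T \<phi> = - T (dzbar j \<phi>)"


section \<open>Square-integrable forms and the operator dbar\<close>

text \<open>A function stands for its restriction to \<open>U\<close>. A \<open>(0,1)\<close>-form is given by its coefficient
  vector: \<open>f\<close> stands for the sum of the \<open>f\<^sub>j d(zbar\<^sub>j)\<close>, and \<open>norm (f z)\<close> is the Euclidean norm of
  the coefficients. Elements of \<open>L2_space U\<close> are (Borel) representatives, not classes modulo null
  sets.\<close>

definition L2_space :: "(complex ^ 'n) set \<Rightarrow> (complex ^ 'n \<Rightarrow> 'b::euclidean_space) set" where
  "L2_space U = {f. set_borel_measurable lborel U f \<and>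
                    set_integrable lborel U (\<lambda>z. (norm (f z))\<^sup>2)}"

definition L2_seminorm :: "(complex ^ 'n) set \<Rightarrow> (complex ^ 'n \<Rightarrow> 'b::euclidean_space) \<Rightarrow> real" where
  "L2_seminorm U f = sqrt (LINT z:U|lborel. (norm (f z))\<^sup>2)"

text \<open>\<open>dbar g = f\<close> on \<open>U\<close> for a function \<open>g\<close> and a \<open>(0,1)\<close>-form \<open>f\<close>.\<close>

definition is_dbar ::
  "(complex ^ 'n) set \<Rightarrow> (complex ^ 'n \<Rightarrow> complex) \<Rightarrow> (complex ^ 'n \<Rightarrow> complex ^ 'n) \<Rightarrow> bool" where
  "is_dbar U g f \<longleftrightarrow>
     (\<forall>j. \<forall>\<phi>\<in>test_functions U.
        distr_dzbar j (distr_of U g) \<phi> = distr_of U (\<lambda>z. f z $ j) \<phi>)"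

text \<open>The coefficient of \<open>dbar f\<close> at \<open>d(zbar\<^sub>j) \<and> d(zbar\<^sub>k)\<close> is
  \<open>d(f\<^sub>k)/d(zbar\<^sub>j) - d(f\<^sub>j)/d(zbar\<^sub>k)\<close>.\<close>

definition dbar_closed :: "(complex ^ 'n) set \<Rightarrow> (complex ^ 'n \<Rightarrow> complex ^ 'n) \<Rightarrow> bool" where
  "dbar_closed U f \<longleftrightarrow>
     (\<forall>j k. \<forall>\<phi>\<in>test_functions U.
        distr_dzbar j (distr_of U (\<lambda>z. f z $ k)) \<phi>
        - distr_dzbar k (distr_of U (\<lambda>z. f z $ j)) \<phi> = 0)"


section \<open>The cohomology in bidegree (0,1)\<close>

definition cocycles01 :: "(complex ^ 'n) set \<Rightarrow> (complex ^ 'n \<Rightarrow> complex ^ 'n) set" where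
  "cocycles01 U = {f \<in> L2_space U. dbar_closed U f}"

definition coboundaries01 :: "(complex ^ 'n) set \<Rightarrow> (complex ^ 'n \<Rightarrow> complex ^ 'n) set" where
  "coboundaries01 U = {f \<in> L2_space U. \<exists>g \<in> L2_space U. is_dbar U g f}"

definition cohomology_class ::
  "(complex ^ 'n) set \<Rightarrow> (complex ^ 'n \<Rightarrow> complex ^ 'n) \<Rightarrow> (complex ^ 'n \<Rightarrow> complex ^ 'n) set" where
  "cohomology_class U f = {h \<in> cocycles01 U. (\<lambda>z. h z - f z) \<in> coboundaries01 U}"

definition H01 :: "(complex ^ 'n) set \<Rightarrow> (complex ^ 'n \<Rightarrow> complex ^ 'n) set set" where
  "H01 U = cohomology_class U ` cocycles01 U"

definition H01_zero :: "(complex ^ 'n) set \<Rightarrow> bool" where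
  "H01_zero U \<longleftrightarrow> H01 U = {cohomology_class U (\<lambda>_. 0)}"

text \<open>Since forms vanishing almost everywhere on \<open>U\<close> are coboundaries (\<open>dbar 0 = 0\<close>), the quotient
  of the space of representatives with its seminorm topology is the same topological space as the
  quotient of the space of classes modulo null sets with its norm topology.\<close>

definition cocycle_topology :: "(complex ^ 'n) set \<Rightarrow> (complex ^ 'n \<Rightarrow> complex ^ 'n) topology" where
  "cocycle_topology U = topology (\<lambda>W. W \<subseteq> cocycles01 U \<and>
     (\<forall>f\<in>W. \<exists>e>0. \<forall>h\<in>cocycles01 U. L2_seminorm U (\<lambda>z. h z - f z) < e \<longrightarrow> h \<in> W))"

definition H01_topology ::
  "(complex ^ 'n) set \<Rightarrow> (complex ^ 'n \<Rightarrow> complex ^ 'n) set topology" where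
  "H01_topology U = topology (\<lambda>V. V \<subseteq> H01 U \<and>
     openin (cocycle_topology U) {f \<in> cocycles01 U. cohomology_class U f \<in> V})"

lemma openin_cocycle_topology:
  "openin (cocycle_topology U) W \<longleftrightarrow> W \<subseteq> cocycles01 U \<and>
     (\<forall>f\<in>W. \<exists>e>0. \<forall>h\<in>cocycles01 U. L2_seminorm U (\<lambda>z. h z - f z) < e \<longrightarrow> h \<in> W)"
proof -
  let ?L = "\<lambda>W. W \<subseteq> cocycles01 U \<and>
     (\<forall>f\<in>W. \<exists>e>0. \<forall>h\<in>cocycles01 U. L2_seminorm U (\<lambda>z. h z - f z) < e \<longrightarrow> h \<in> W)"
  have "?L (S \<inter> T)" if S: "?L S" and T: "?L T" for S T
  proof (intro conjI ballI)
    show "S \<inter> T \<subseteq> cocycles01 U" using S by blast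
    fix f assume f: "f \<in> S \<inter> T"
    obtain d where d: "d > 0"
      "\<forall>h\<in>cocycles01 U. L2_seminorm U (\<lambda>z. h z - f z) < d \<longrightarrow> h \<in> S"
      using S f by blast
    obtain e where e: "e > 0"
      "\<forall>h\<in>cocycles01 U. L2_seminorm U (\<lambda>z. h z - f z) < e \<longrightarrow> h \<in> T"
      using T f by blast
    show "\<exists>e>0. \<forall>h\<in>cocycles01 U. L2_seminorm U (\<lambda>z. h z - f z) < e \<longrightarrow> h \<in> S \<inter> T"
      using d e by (intro exI[of _ "min d e"]) auto
  qed
  moreover have "?L (\<Union>\<K>)" if "\<forall>S\<in>\<K>. ?L S" for \<K>
    using that by (intro conjI ballI; (elim UnionE)?) (blast, meson UnionI)
  ultimately have "istopology ?L"
    unfolding istopology_def by blast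
  then show ?thesis
    unfolding cocycle_topology_def by (simp add: topology_inverse')
qed

lemma topspace_cocycle_topology: "topspace (cocycle_topology U) = cocycles01 U"
proof
  show "topspace (cocycle_topology U) \<subseteq> cocycles01 U"
    using openin_topspace openin_cocycle_topology by blast
  have "openin (cocycle_topology U) (cocycles01 U)"
    unfolding openin_cocycle_topology by (auto intro: exI[of _ 1])
  then show "cocycles01 U \<subseteq> topspace (cocycle_topology U)"
    by (rule openin_subset)
qed

lemma openin_H01_topology:
  "openin (H01_topology U) V \<longleftrightarrow> V \<subseteq> H01 U \<and>
     openin (cocycle_topology U) {f \<in> cocycles01 U. cohomology_class U f \<in> V}"
proof -
  let ?P = "\<lambda>V. {f \<in> cocycles01 U. cohomology_class U f \<in> V}"
  have 1: "?P (S \<inter> T) = ?P S \<inter> ?P T" for S T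
    by blast
  have 2: "?P (\<Union>\<K>) = \<Union> (?P ` \<K>)" for \<K>
    by blast
  have "istopology (\<lambda>V. V \<subseteq> H01 U \<and> openin (cocycle_topology U) (?P V))"
    unfolding istopology_def 1 2 by (auto intro!: openin_Int openin_Union)
  then show ?thesis
    unfolding H01_topology_def by (simp add: topology_inverse')
qed

lemma topspace_H01_topology: "topspace (H01_topology U) = H01 U"
proof
  show "topspace (H01_topology U) \<subseteq> H01 U"
    using openin_topspace openin_H01_topology by blast
  have "{f \<in> cocycles01 U. cohomology_class U f \<in> H01 U} = topspace (cocycle_topology U)"
    by (auto simp: H01_def topspace_cocycle_topology)
  then have "openin (H01_topology U) (H01 U)"
    unfolding openin_H01_topology by simp
  then show "H01 U \<subseteq> topspace (H01_topology U)"
    by (rule openin_subset)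
qed

lemma quotient_map_cohomology_class:
  "quotient_map (cocycle_topology U) (H01_topology U) (cohomology_class U)"
  unfolding quotient_map_def topspace_cocycle_topology topspace_H01_topology
    openin_H01_topology by (auto simp: H01_def)

end

theory Submission
  imports Defs
begin

text \<open>Write \<open>\<Omega> = \<Omega>' - K\<close>, and let \<open>f\<close> be a closed form on \<open>\<Omega>\<close>, extended by zero. Choose a cutoff
  function \<open>\<chi>\<close>, equal to 1 near \<open>K\<close> and compactly supported in \<open>\<Omega>'\<close>, and two coordinates
  \<open>a \<noteq> b\<close>. The complement of \<open>K\<close> is the union of \<open>V\<^sub>a\<close>, the points having some coordinate
  \<open>z\<^sub>j \<notin> K\<^sub>j\<close> with \<open>j \<noteq> a\<close>, and of the analogous \<open>V\<^sub>b\<close>. Because \<open>K\<close> is a product, \<open>V\<^sub>a\<close> is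
  filled by complex lines in direction \<open>a\<close> that miss \<open>K\<close>; so there the Cauchy transform \<open>C\<^sub>a\<close> in
  the variable \<open>z\<^sub>a\<close> may be applied to data on \<open>\<Omega>\<close>, whatever \<open>K\<^sub>a\<close> looks like.

  With \<open>G\<^sub>k = C\<^sub>a (f\<^sub>k d\<chi>/dzbar\<^sub>a - f\<^sub>a d\<chi>/dzbar\<^sub>k)\<close>, a form defined on the whole space, the functions
  \<open>u\<^sub>a = C\<^sub>a (\<chi> f\<^sub>a)\<close> and \<open>u\<^sub>b = C\<^sub>b (\<chi> f\<^sub>b - G\<^sub>b)\<close> both satisfy \<open>dbar u = \<chi> f - G\<close>, the first
  on \<open>V\<^sub>a\<close> (\<open>dbar_u_a\<close>) and the second on \<open>V\<^sub>b\<close> (\<open>dbar_u_b\<close>). If \<open>u\<^sub>a = u\<^sub>b\<close> on \<open>V\<^sub>a \<inter> V\<^sub>b\<close>, they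
  glue to a solution \<open>u\<close> off \<open>K\<close>, and \<open>f - dbar u = (1 - \<chi>) f + G\<close> extends across \<open>K\<close> to a
  closed form on \<open>\<Omega>'\<close> (\<open>H_closed\<close>). That form is exact by the hypothesis on \<open>\<Omega>'\<close>, hence so is
  \<open>f\<close> (\<open>coboundary_if_pairing_zero\<close>).

  The only obstruction is thus the holomorphic function \<open>w = u\<^sub>a - u\<^sub>b\<close> on \<open>V\<^sub>a \<inter> V\<^sub>b\<close>. Its pairing
  with a test function equals the integral of \<open>f\<^sub>b \<tau> - f\<^sub>a \<tau>'\<close> for two test functions on \<open>\<Omega>\<close>
  with \<open>d\<tau>/dzbar\<^sub>b = d\<tau>'/dzbar\<^sub>a\<close> (\<open>u_diff_pairing\<close>). For a coboundary \<open>f\<close> this vanishes by the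
  definition of the weak derivative, and since it depends continuously on \<open>f\<close> it vanishes for limits
  of coboundaries. So the coboundaries are closed, which is the Hausdorff property.

  With a third coordinate \<open>c\<close>, \<open>w\<close> always vanishes (\<open>pairing_zero_three_variables\<close>): the data are
  supported in a bounded range of \<open>z\<^sub>c\<close>, so \<open>w = 0\<close> for large \<open>z\<^sub>c\<close>, and analytic continuation along
  complex lines inside \<open>V\<^sub>a \<inter> V\<^sub>b\<close> reaches every other point.

  Everything is done in weak form. The Cauchy transform is truncated to a kernel of compact support and
  acts on test functions by \<open>dir_avg\<close> and on square-integrable functions by its transpose
  \<open>dir_conv\<close>; analytic continuation becomes the statement that a test function is a derivative plus a
  test function supported far away (\<open>cauchy_decomposition\<close>).\<close>

section \<open>Calculus of smooth functions\<close>

lemma C_k_SucI: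
  assumes "\<And>x. (f has_derivative D x) (at x)" and "\<And>v. C_k k (\<lambda>x. D x v)"
  shows "C_k (Suc k) f"
proof -
  have "frechet_derivative f (at x) = D x" for x
    using frechet_derivative_at[OF assms(1)] by simp
  then show ?thesis
    using assms by (auto simp: differentiable_def)
qed

lemma C_k_Suc_has_derivative:
  "C_k (Suc k) f \<Longrightarrow> (f has_derivative frechet_derivative f (at x)) (at x)"
  by (simp add: frechet_derivative_works)

lemma C_k_continuous: "C_k k f \<Longrightarrow> continuous_on UNIV f"
  by (cases k) (auto intro!: continuous_at_imp_continuous_on differentiable_imp_continuous_within)

lemma C_k_SucD: "C_k (Suc k) f \<Longrightarrow> C_k k f"
proof (induction k arbitrary: f)
  case 0
  then show ?case by (simp del: C_k.simps(2) add: C_k_continuous)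
next
  case (Suc k)
  then show ?case by (metis C_k.simps(2))
qed

lemma C_k_const: "C_k k (\<lambda>x. c)"
  by (induction k arbitrary: c)
    (auto intro!: C_k_SucI[where D = "\<lambda>x v. 0"] simp del: C_k.simps(2))

lemma C_k_bounded_linear_left:
  assumes "bounded_linear L" "C_k k f"
  shows "C_k k (\<lambda>x. L (f x))"
  using assms(2)
proof (induction k arbitrary: f)
  case 0
  then show ?case using assms(1)
    by (simp add: bounded_linear.continuous_on)
next
  case (Suc k)
  show ?case
    by (rule C_k_SucI[OF bounded_linear.has_derivative[OF assms(1)
            C_k_Suc_has_derivative[OF Suc.prems]]]) (use Suc in auto)
qed

lemma C_k_affine:
  assumes "bounded_linear L" "C_k k f"
  shows "C_k k (\<lambda>x. f (c + L x))"
  using assms(2)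
proof (induction k arbitrary: f)
  case 0
  then have "continuous_on UNIV f" "continuous_on UNIV (\<lambda>x. c + L x)"
    using assms(1) by (simp, intro continuous_on_add continuous_on_const linear_continuous_on)
  then have "continuous_on UNIV (\<lambda>x. f (c + L x))"
    by (rule continuous_on_compose2) simp
  then show ?case by simp
next
  case (Suc k)
  have "((\<lambda>x. c + L x) has_derivative L) (at x)" for x
    by (auto intro!: derivative_eq_intros bounded_linear_imp_has_derivative assms)
  then have "((\<lambda>x. f (c + L x)) has_derivative (\<lambda>v. frechet_derivative f (at (c + L x)) (L v))) (at x)" for x
    using has_derivative_compose C_k_Suc_has_derivative[OF Suc.prems] by blast
  then show ?case
    by (rule C_k_SucI) (use Suc in auto)
qed

lemma C_k_add: "C_k k f \<Longrightarrow> C_k k g \<Longrightarrow> C_k k (\<lambda>x. f x + g x)"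
proof (induction k arbitrary: f g)
  case 0
  then show ?case by (auto intro!: continuous_intros)
next
  case (Suc k)
  show ?case
    by (rule C_k_SucI[OF has_derivative_add[OF C_k_Suc_has_derivative[OF Suc.prems(1)]
            C_k_Suc_has_derivative[OF Suc.prems(2)]]]) (use Suc in auto)
qed

lemma (in bounded_bilinear) C_k:
  "C_k k f \<Longrightarrow> C_k k g \<Longrightarrow> C_k k (\<lambda>x. prod (f x) (g x))"
proof (induction k arbitrary: f g)
  case 0
  then show ?case by (auto intro!: continuous_on)
next
  case (Suc k)
  show ?case
    by (rule C_k_SucI[OF FDERIV[OF C_k_Suc_has_derivative[OF Suc.prems(1)]
            C_k_Suc_has_derivative[OF Suc.prems(2)]]], intro C_k_add Suc.IH C_k_SucD[OF Suc.prems(1)]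
          C_k_SucD[OF Suc.prems(2)]) (use Suc.prems in auto)
qed

lemma C_k_inverse:
  fixes f :: "'a::real_normed_vector \<Rightarrow> 'b::real_normed_field"
  assumes "\<And>x. f x \<noteq> 0"
  shows "C_k k f \<Longrightarrow> C_k k (\<lambda>x. inverse (f x))"
proof (induction k)
  case 0
  then show ?case using assms by (auto intro!: continuous_intros)
next
  case (Suc k)
  have "C_k k (\<lambda>x. inverse (f x))" using Suc C_k_SucD by blast
  moreover have "C_k k (\<lambda>x. frechet_derivative f (at x) v)" for v using Suc.prems by simp
  ultimately have "C_k k (\<lambda>x. - (inverse (f x) * frechet_derivative f (at x) v * inverse (f x)))" for v
    by (intro C_k_bounded_linear_left[OF bounded_linear_minus[OF bounded_linear_ident]]
        bounded_bilinear.C_k[OF bounded_bilinear_mult])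
  then show ?case
    by (rule C_k_SucI[OF Deriv.has_derivative_inverse[OF assms C_k_Suc_has_derivative[OF Suc.prems]]])
qed

lemma C_k_compose_real:
  fixes s :: "real \<Rightarrow> 'b::real_normed_vector"
  shows "C_k k s \<Longrightarrow> C_k k q \<Longrightarrow> C_k k (\<lambda>x. s (q x))"
proof (induction k arbitrary: s)
  case 0
  then have "continuous_on UNIV s" "continuous_on UNIV q" by simp_all
  then have "continuous_on UNIV (\<lambda>x. s (q x))"
    by (rule continuous_on_compose2) simp
  then show ?case by simp
next
  case (Suc k)
  let ?D = "\<lambda>x v. frechet_derivative q (at x) v *\<^sub>R frechet_derivative s (at (q x)) 1"
  have "((\<lambda>x. s (q x)) has_derivative ?D x) (at x)" for x
  proof -
    interpret bounded_linear "frechet_derivative s (at (q x))"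
      using C_k_Suc_has_derivative[OF Suc.prems(1)] has_derivative_bounded_linear by blast
    have "frechet_derivative s (at (q x)) = (\<lambda>t. t *\<^sub>R frechet_derivative s (at (q x)) 1)"
    proof
      fix t
      show "frechet_derivative s (at (q x)) t = t *\<^sub>R frechet_derivative s (at (q x)) 1"
        using scaleR[of t 1] by (simp only: real_scaleR_def mult_1_right)
    qed
    then have s: "(s has_derivative (\<lambda>t. t *\<^sub>R frechet_derivative s (at (q x)) 1)) (at (q x))"
      by (rule has_derivative_eq_rhs[OF C_k_Suc_has_derivative[OF Suc.prems(1)]])
    show ?thesis
      by (rule has_derivative_compose[OF C_k_Suc_has_derivative[OF Suc.prems(2)] s])
  qed
  moreover have "C_k k (\<lambda>x. ?D x v)" for v
  proof (rule bounded_bilinear.C_k[OF bounded_bilinear_scaleR])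
    show "C_k k (\<lambda>x. frechet_derivative q (at x) v)" using Suc.prems(2) by simp
    show "C_k k (\<lambda>x. frechet_derivative s (at (q x)) 1)"
      by (rule Suc.IH[of "\<lambda>t. frechet_derivative s (at t) 1", OF _ C_k_SucD[OF Suc.prems(2)]])
        (use Suc.prems(1) in simp)
  qed
  ultimately show ?case by (rule C_k_SucI)
qed

lemma smooth_const: "smooth (\<lambda>x. c)"
  by (simp add: smooth_def C_k_const)

lemma smooth_bounded_linear_left: "bounded_linear L \<Longrightarrow> smooth f \<Longrightarrow> smooth (\<lambda>x. L (f x))"
  by (simp add: smooth_def C_k_bounded_linear_left)

lemma smooth_affine: "bounded_linear L \<Longrightarrow> smooth f \<Longrightarrow> smooth (\<lambda>x. f (c + L x))"
  by (simp add: smooth_def C_k_affine)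

lemma smooth_bounded_linear: "bounded_linear L \<Longrightarrow> smooth L"
  unfolding smooth_def
proof
  fix k assume "bounded_linear L"
  then show "C_k k L"
    by (cases k) (auto intro!: C_k_SucI[where D = "\<lambda>x. L"] bounded_linear_imp_has_derivative C_k_const
        linear_continuous_on simp del: C_k.simps(2))
qed

lemma smooth_add: "smooth f \<Longrightarrow> smooth g \<Longrightarrow> smooth (\<lambda>x. f x + g x)"
  by (simp add: smooth_def C_k_add)

lemma smooth_minus: "smooth f \<Longrightarrow> smooth (\<lambda>x. - f x)"
  using smooth_bounded_linear_left[OF bounded_linear_minus[OF bounded_linear_ident]] .

lemma smooth_diff: "smooth f \<Longrightarrow> smooth g \<Longrightarrow> smooth (\<lambda>x. f x - g x)"
  using smooth_add[OF _ smooth_minus[of g], of f] by simp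

lemma smooth_mult:
  fixes f g :: "'a::real_normed_vector \<Rightarrow> 'b::real_normed_algebra"
  shows "smooth f \<Longrightarrow> smooth g \<Longrightarrow> smooth (\<lambda>x. f x * g x)"
  by (simp add: smooth_def bounded_bilinear.C_k[OF bounded_bilinear_mult])

lemma smooth_inner: "smooth f \<Longrightarrow> smooth g \<Longrightarrow> smooth (\<lambda>x. f x \<bullet> g x)"
  by (simp add: smooth_def bounded_bilinear.C_k[OF bounded_bilinear_inner])

lemma smooth_inverse:
  fixes f :: "'a::real_normed_vector \<Rightarrow> 'b::real_normed_field"
  shows "smooth f \<Longrightarrow> (\<And>x. f x \<noteq> 0) \<Longrightarrow> smooth (\<lambda>x. inverse (f x))"
  by (simp add: smooth_def C_k_inverse)

lemma smooth_compose_real: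
  fixes s :: "real \<Rightarrow> 'b::real_normed_vector"
  shows "smooth s \<Longrightarrow> smooth q \<Longrightarrow> smooth (\<lambda>x. s (q x))"
  by (simp add: smooth_def C_k_compose_real)

lemma smooth_of_real: "smooth f \<Longrightarrow> smooth (\<lambda>x. of_real (f x) :: 'b::real_normed_field)"
  by (rule smooth_bounded_linear_left[OF bounded_linear_of_real])

lemma smooth_prod:
  fixes f :: "'i \<Rightarrow> 'a::real_normed_vector \<Rightarrow> 'b::real_normed_field"
  shows "finite I \<Longrightarrow> (\<And>i. i \<in> I \<Longrightarrow> smooth (f i)) \<Longrightarrow> smooth (\<lambda>x. \<Prod>i\<in>I. f i x)"
  by (induction rule: finite_induct) (auto intro!: smooth_const smooth_mult)

lemma smooth_continuous: "smooth f \<Longrightarrow> continuous_on UNIV f"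
  using C_k_continuous[of 0 f] by (simp add: smooth_def)

lemma smooth_has_derivative: "smooth f \<Longrightarrow> (f has_derivative frechet_derivative f (at x)) (at x)"
  unfolding smooth_def using C_k_Suc_has_derivative by blast

lemma smooth_directional: "smooth f \<Longrightarrow> smooth (\<lambda>x. frechet_derivative f (at x) v)"
  unfolding smooth_def using C_k.simps(2) by blast

section \<open>Cutoff functions\<close>

text \<open>The negative powers are included because the derivative of a member of the family is a linear
  combination of two others; smoothness of all of them then follows by one induction.\<close>

definition flat_exp :: "nat \<Rightarrow> real \<Rightarrow> real" where
  "flat_exp n t = (if t > 0 then inverse t ^ n * exp (- inverse t) else 0)"

lemma flat_exp_tendsto_0: "(flat_exp n \<longlongrightarrow> 0) (at 0)"
proof -
  have "((\<lambda>t. inverse t ^ n / exp (inverse t)) \<longlongrightarrow> (0::real)) (at_right 0)"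
    by (rule filterlim_compose[OF tendsto_power_div_exp_0 filterlim_inverse_at_top_right])
  then have "(flat_exp n \<longlongrightarrow> 0) (at_right 0)"
    by (rule Lim_transform_eventually)
      (auto simp: flat_exp_def eventually_at_filter exp_minus divide_inverse)
  moreover have "(flat_exp n \<longlongrightarrow> 0) (at_left 0)"
    by (rule Lim_transform_eventually[OF tendsto_const])
      (auto simp: flat_exp_def eventually_at_filter)
  ultimately show ?thesis
    by (simp add: filterlim_split_at)
qed

lemma flat_exp_has_derivative:
  "(flat_exp n has_real_derivative flat_exp (n + 2) t - of_nat n * flat_exp (n + 1) t) (at t)"
proof -
  consider "t > 0" | "t < 0" | "t = 0" by linarith
  then show ?thesis
  proof cases
    case 1
    have inv: "(inverse has_real_derivative - (inverse t)\<^sup>2) (at t)"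
      using DERIV_inverse[of t] 1 by (simp add: numeral_2_eq_2)
    have "((\<lambda>t. inverse t ^ n) has_real_derivative - of_nat n * inverse t ^ (n + 1)) (at t)"
      by (rule DERIV_cong[OF DERIV_power[OF inv]]) (cases n; simp add: power2_eq_square algebra_simps)
    moreover have "((\<lambda>t. exp (- inverse t)) has_real_derivative exp (- inverse t) * (inverse t)\<^sup>2) (at t)"
      using DERIV_fun_exp[OF DERIV_minus[OF inv]] by simp
    ultimately have "((\<lambda>t. inverse t ^ n * exp (- inverse t)) has_real_derivative
        flat_exp (n + 2) t - of_nat n * flat_exp (n + 1) t) (at t)"
      by (rule DERIV_cong[OF DERIV_mult]) (use 1 in \<open>simp add: flat_exp_def algebra_simps power2_eq_square\<close>)
    then show ?thesis
      by (rule has_field_derivative_transform_within_open[of _ _ _ "{0<..}"])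
        (use 1 in \<open>auto simp: flat_exp_def\<close>)
  next
    case 2
    have "((\<lambda>t. 0) has_real_derivative flat_exp (n + 2) t - of_nat n * flat_exp (n + 1) t) (at t)"
      using 2 by (auto simp: flat_exp_def)
    then show ?thesis
      by (rule has_field_derivative_transform_within_open[of _ _ _ "{..<0}"])
        (use 2 in \<open>auto simp: flat_exp_def\<close>)
  next
    case 3
    have "((\<lambda>h. flat_exp n (0 + h) / h) \<longlongrightarrow> 0) (at 0)"
      by (rule Lim_transform_eventually[OF flat_exp_tendsto_0[of "n + 1"]])
        (auto simp: flat_exp_def eventually_at_filter divide_inverse)
    then show ?thesis
      using 3 by (simp add: has_field_derivative_iff flat_exp_def)
  qed
qed

lemma smooth_flat_exp: "smooth (flat_exp n)"
  unfolding smooth_def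
proof
  fix k show "C_k k (flat_exp n)"
  proof (induction k arbitrary: n)
    case 0
    show ?case
      by (auto intro!: continuous_at_imp_continuous_on DERIV_isCont flat_exp_has_derivative)
  next
    case (Suc k)
    have *: "C_k k (\<lambda>x. - (real n * v) * flat_exp (n + 1) x)" 
            "C_k k (\<lambda>x. v * flat_exp (n + 2) x)" for v
      by (rule bounded_bilinear.C_k[OF bounded_bilinear_mult C_k_const Suc])+
    have "C_k k (\<lambda>x. (flat_exp (n + 2) x - real n * flat_exp (n + 1) x) * v)" for v
      using C_k_add[OF * ] by (simp add: algebra_simps)
    then show ?case
      by (rule C_k_SucI[OF flat_exp_has_derivative[unfolded has_field_derivative_def]])
  qed
qed

text \<open>The profile \<open>e(4r\<^sup>2 - t) / (e(4r\<^sup>2 - t) + e(t - r\<^sup>2))\<close> at \<open>t = |x - c|\<^sup>2\<close>, where \<open>e(t)\<close> vanishes exactly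
  for \<open>t \<le> 0\<close>, is a smooth step from 1 to 0.\<close>

lemma smooth_radial_cutoff:
  fixes c :: "'a::euclidean_space"
  assumes "r > 0"
  obtains \<beta> :: "'a \<Rightarrow> real" where "smooth \<beta>" "\<And>x. 0 \<le> \<beta> x" "\<And>x. \<beta> x \<le> 1"
    "\<And>x. x \<in> cball c r \<Longrightarrow> \<beta> x = 1" "\<And>x. \<beta> x \<noteq> 0 \<Longrightarrow> x \<in> ball c (2 * r)"
proof -
  let ?e = "flat_exp 0"
  define s where "s t = ?e (4 * r\<^sup>2 - t) * inverse (?e (4 * r\<^sup>2 - t) + ?e (t - r\<^sup>2))" for t
  have pos: "?e t > 0 \<longleftrightarrow> t > 0" "?e t \<ge> 0" for t by (auto simp: flat_exp_def)
  have "?e (4 * r\<^sup>2 - t) > 0 \<or> ?e (t - r\<^sup>2) > 0" for t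
    using assms unfolding pos by (smt (verit) zero_less_power)
  then have den: "?e (4 * r\<^sup>2 - t) + ?e (t - r\<^sup>2) > 0" for t
    using pos(2) by (smt (verit))
  have lin: "smooth (\<lambda>x::real. x)" "smooth (\<lambda>x::'a. x)"
    by (auto intro!: smooth_bounded_linear bounded_linear_ident)
  have s: "smooth s"
    unfolding s_def
    by (intro smooth_mult smooth_inverse smooth_add smooth_compose_real[OF smooth_flat_exp]
        smooth_diff smooth_const lin less_imp_neq[OF den, symmetric])
  show thesis
  proof
    show "smooth (\<lambda>x. s ((x - c) \<bullet> (x - c)))"
      by (intro smooth_compose_real[OF s] smooth_inner smooth_diff lin smooth_const)
    fix x :: 'a
    show "0 \<le> s ((x - c) \<bullet> (x - c))" "s ((x - c) \<bullet> (x - c)) \<le> 1"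
      unfolding s_def using den pos(2)
      by (auto simp: divide_inverse[symmetric] less_imp_le)
    show "s ((x - c) \<bullet> (x - c)) = 1" if "x \<in> cball c r"
    proof -
      have "(x - c) \<bullet> (x - c) \<le> r\<^sup>2"
        using that by (auto simp: dist_norm norm_minus_commute power2_norm_eq_inner[symmetric]
            intro!: power_mono)
      then have "?e ((x - c) \<bullet> (x - c) - r\<^sup>2) = 0" by (simp add: flat_exp_def)
      then show ?thesis using den[of "(x - c) \<bullet> (x - c)"] by (simp add: s_def)
    qed
    show "x \<in> ball c (2 * r)" if "s ((x - c) \<bullet> (x - c)) \<noteq> 0"
    proof -
      have "?e (4 * r\<^sup>2 - (x - c) \<bullet> (x - c)) \<noteq> 0" using that by (auto simp: s_def)
      then have "(norm (x - c))\<^sup>2 < (2 * r)\<^sup>2"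
        by (simp add: flat_exp_def power2_norm_eq_inner split: if_splits)
      then have "norm (x - c) < 2 * r"
        by (rule power_less_imp_less_base) (use assms in simp)
      then show ?thesis
        by (simp add: dist_norm norm_minus_commute)
    qed
  qed
qed

text \<open>If \<open>\<beta>\<^sub>i\<close> are radial cutoffs whose plateaus cover \<open>C\<close>, then \<open>1 - \<Prod> (1 - \<beta>\<^sub>i)\<close> is 1
  wherever some \<open>\<beta>\<^sub>i\<close> is, and 0 where all of them are.\<close>

lemma smooth_cutoff:
  fixes C U :: "'a::euclidean_space set"
  assumes C: "compact C" and U: "open U" "C \<subseteq> U"
  obtains h :: "'a \<Rightarrow> real" and W where "smooth h" "\<And>x. 0 \<le> h x" "\<And>x. h x \<le> 1"
    "open W" "C \<subseteq> W" "\<And>x. x \<in> W \<Longrightarrow> h x = 1"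
    "compact (closure {x. h x \<noteq> 0})" "closure {x. h x \<noteq> 0} \<subseteq> U"
proof -
  have "\<exists>r>0. cball x (2 * r) \<subseteq> U" if "x \<in> C" for x
  proof -
    have "x \<in> U" using U(2) that by (rule subsetD)
    then have "\<exists>e>0. cball x e \<subseteq> U"
      using U(1) by (simp add: open_contains_cball)
    then obtain e where "e > 0" "cball x e \<subseteq> U" by (elim exE conjE)
    then show ?thesis by (intro exI[of _ "e / 2"]) simp
  qed
  then have "\<exists>r. \<forall>x\<in>C. r x > 0 \<and> cball x (2 * r x) \<subseteq> U"
    by (intro bchoice) blast
  then obtain r where r: "\<And>x. x \<in> C \<Longrightarrow> r x > 0" "\<And>x. x \<in> C \<Longrightarrow> cball x (2 * r x) \<subseteq> U"
    by blast
  have "\<exists>\<beta> :: 'a \<Rightarrow> real. smooth \<beta> \<and> (\<forall>y. 0 \<le> \<beta> y \<and> \<beta> y \<le> 1)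
      \<and> (\<forall>y\<in>cball x (r x). \<beta> y = 1) \<and> (\<forall>y. \<beta> y \<noteq> 0 \<longrightarrow> y \<in> ball x (2 * r x))" if "x \<in> C" for x
    by (rule smooth_radial_cutoff[OF r(1)[OF that], of x]) blast
  then have "\<exists>\<beta> :: 'a \<Rightarrow> 'a \<Rightarrow> real. \<forall>x\<in>C. smooth (\<beta> x) \<and> (\<forall>y. 0 \<le> \<beta> x y \<and> \<beta> x y \<le> 1)
      \<and> (\<forall>y\<in>cball x (r x). \<beta> x y = 1) \<and> (\<forall>y. \<beta> x y \<noteq> 0 \<longrightarrow> y \<in> ball x (2 * r x))"
    by (intro bchoice) blast
  then obtain \<beta> :: "'a \<Rightarrow> 'a \<Rightarrow> real" where \<beta>: "\<And>x. x \<in> C \<Longrightarrow> smooth (\<beta> x)"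
    "\<And>x y. x \<in> C \<Longrightarrow> 0 \<le> \<beta> x y \<and> \<beta> x y \<le> 1"
    "\<And>x y. x \<in> C \<Longrightarrow> y \<in> cball x (r x) \<Longrightarrow> \<beta> x y = 1"
    "\<And>x y. x \<in> C \<Longrightarrow> \<beta> x y \<noteq> 0 \<Longrightarrow> y \<in> ball x (2 * r x)"
    by blast
  obtain F where F: "F \<subseteq> C" "finite F" "C \<subseteq> (\<Union>x\<in>F. ball x (r x))"
    using compactE_image[OF C, of C "\<lambda>x. ball x (r x)"] r(1) by force
  let ?h = "\<lambda>y. 1 - (\<Prod>x\<in>F. 1 - \<beta> x y)"
  let ?B = "\<Union>x\<in>F. cball x (2 * r x)"
  have B: "compact ?B" using F by (intro compact_UN) auto
  have "?h y \<noteq> 0 \<Longrightarrow> y \<in> ?B" for y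
  proof (rule ccontr)
    assume *: "?h y \<noteq> 0" "y \<notin> ?B"
    then have "\<beta> x y = 0" if "x \<in> F" for x
      using \<beta>(4)[of x y] F(1) that by force
    with * show False by simp
  qed
  then have sub: "{y. ?h y \<noteq> 0} \<subseteq> ?B" by blast
  then have clo: "closure {y. ?h y \<noteq> 0} \<subseteq> ?B"
    using B by (intro closure_minimal) (auto intro: compact_imp_closed)
  show thesis
  proof
    show "smooth ?h"
      using \<beta> F by (intro smooth_diff smooth_const smooth_prod) auto
    show "0 \<le> ?h y" for y
      using \<beta>(2) F(1) prod_le_1[of F "\<lambda>x. 1 - \<beta> x y"] by auto
    show "?h y \<le> 1" for y
      using \<beta>(2) F(1) prod_nonneg[of F "\<lambda>x. 1 - \<beta> x y"] by auto
    show "open (\<Union>x\<in>F. ball x (r x))" "C \<subseteq> (\<Union>x\<in>F. ball x (r x))" using F by auto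
    show "?h y = 1" if y: "y \<in> (\<Union>x\<in>F. ball x (r x))" for y
    proof -
      obtain x where "x \<in> F" "y \<in> ball x (r x)" using y by blast
      then have "\<exists>x\<in>F. 1 - \<beta> x y = 0" using \<beta>(3)[of x y] F(1) by (intro bexI[of _ x]) auto
      then show ?thesis using F(2) by simp
    qed
    show "compact (closure {y. ?h y \<noteq> 0})"
      using bounded_subset[OF compact_imp_bounded[OF B] sub] by simp
    show "closure {y. ?h y \<noteq> 0} \<subseteq> U" using clo r(2) F(1) by blast
  qed
qed

section \<open>Test functions\<close>

text \<open>The membership predicate of \<open>test_functions\<close>, on an arbitrary domain space: the Cauchy kernel is
  truncated by a test function of one complex variable.\<close>

definition test_on :: "'a::real_normed_vector set \<Rightarrow> ('a \<Rightarrow> complex) \<Rightarrow> bool" where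
  "test_on U \<phi> \<longleftrightarrow>
     smooth \<phi> \<and> compact (closure {x. \<phi> x \<noteq> 0}) \<and> closure {x. \<phi> x \<noteq> 0} \<subseteq> U"

lemma test_functions_iff: "\<phi> \<in> test_functions U \<longleftrightarrow> test_on U \<phi>"
  by (simp add: test_functions_def test_on_def)

lemma test_onI:
  fixes \<phi> :: "'a::euclidean_space \<Rightarrow> complex"
  assumes "smooth \<phi>" "compact S" "S \<subseteq> U" "\<And>x. \<phi> x \<noteq> 0 \<Longrightarrow> x \<in> S"
  shows "test_on U \<phi>"
proof -
  have "closure {x. \<phi> x \<noteq> 0} \<subseteq> S"
    by (rule closure_minimal) (use assms compact_imp_closed in auto)
  moreover have "bounded {x. \<phi> x \<noteq> 0}"
    by (rule bounded_subset[OF compact_imp_bounded[OF assms(2)]]) (use assms(4) in auto)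
  ultimately show ?thesis
    unfolding test_on_def using assms by auto
qed

lemma test_on_smooth: "test_on U \<phi> \<Longrightarrow> smooth \<phi>"
  by (simp add: test_on_def)

lemma test_on_support:
  assumes "test_on U \<phi>"
  obtains S where "compact S" "S \<subseteq> U" "\<And>x. \<phi> x \<noteq> 0 \<Longrightarrow> x \<in> S"
proof (rule that[of "closure {x. \<phi> x \<noteq> 0}"])
  show "x \<in> closure {x. \<phi> x \<noteq> 0}" if "\<phi> x \<noteq> 0" for x
    by (rule subsetD[OF closure_subset]) (simp add: that)
qed (use assms in \<open>simp_all add: test_on_def\<close>)

lemma test_on_zero_outside: "test_on U \<phi> \<Longrightarrow> x \<notin> U \<Longrightarrow> \<phi> x = 0"
  by (rule ccontr, erule test_on_support) auto

lemma test_on_mono: "test_on U \<phi> \<Longrightarrow> U \<subseteq> V \<Longrightarrow> test_on V \<phi>"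
  by (auto simp: test_on_def)

lemma test_on_UNIV: "test_on U \<phi> \<Longrightarrow> test_on UNIV \<phi>"
  by (erule test_on_mono) simp

lemma test_on_mult_subset:
  fixes \<phi> :: "'a::euclidean_space \<Rightarrow> complex"
  assumes "test_on UNIV \<phi>" "smooth g" "\<And>x. x \<in> closure {x. \<phi> x \<noteq> 0} \<Longrightarrow> x \<notin> U \<Longrightarrow> \<exists>W. open W \<and> x \<in> W \<and> (\<forall>y\<in>W. g y = 0)"
  shows "test_on U (\<lambda>x. g x * \<phi> x)"
proof -
  have sub: "{x. g x * \<phi> x \<noteq> 0} \<subseteq> {x. \<phi> x \<noteq> 0}" by auto
  have "closure {x. g x * \<phi> x \<noteq> 0} \<subseteq> U"
  proof
    fix x assume x: "x \<in> closure {x. g x * \<phi> x \<noteq> 0}"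
    show "x \<in> U"
    proof (rule ccontr)
      assume "x \<notin> U"
      moreover have "x \<in> closure {x. \<phi> x \<noteq> 0}"
        using closure_mono[OF sub] x by (rule subsetD)
      ultimately obtain W where W: "open W" "x \<in> W" "\<forall>y\<in>W. g y = 0"
        using assms(3) by blast
      then have "W \<inter> {x. g x * \<phi> x \<noteq> 0} = {}" by auto
      then have "W \<inter> closure {x. g x * \<phi> x \<noteq> 0} = {}"
        using open_Int_closure_eq_empty[OF W(1)] by simp
      with x W(2) show False by blast
    qed
  qed
  moreover have "bounded {x. g x * \<phi> x \<noteq> 0}"
    using bounded_subset[OF _ sub] assms(1) by (simp add: test_on_def)
  ultimately show ?thesis
    using assms(1,2) by (simp add: test_on_def smooth_mult)
qed

lemma test_on_mult:
  fixes \<phi> :: "'a::euclidean_space \<Rightarrow> complex"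
  assumes "test_on U \<phi>" "smooth g"
  shows "test_on U (\<lambda>x. g x * \<phi> x)"
  by (rule test_on_mult_subset) (use assms in \<open>auto simp: test_on_def\<close>)

lemma test_on_add:
  fixes \<phi> \<psi> :: "'a::euclidean_space \<Rightarrow> complex"
  assumes "test_on U \<phi>" "test_on U \<psi>"
  shows "test_on U (\<lambda>x. \<phi> x + \<psi> x)"
proof -
  obtain S where S: "compact S" "S \<subseteq> U" "\<And>x. \<phi> x \<noteq> 0 \<Longrightarrow> x \<in> S"
    using assms(1) by (rule test_on_support) (rule that)
  obtain R where R: "compact R" "R \<subseteq> U" "\<And>x. \<psi> x \<noteq> 0 \<Longrightarrow> x \<in> R"
    using assms(2) by (rule test_on_support) (rule that)
  show ?thesis
  proof (rule test_onI[of _ "S \<union> R"])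
    show "smooth (\<lambda>x. \<phi> x + \<psi> x)"
      using assms by (simp add: smooth_add test_on_smooth)
    show "x \<in> S \<union> R" if "\<phi> x + \<psi> x \<noteq> 0" for x
      using S(3)[of x] R(3)[of x] that by (cases "\<phi> x = 0") auto
  qed (use S R in auto)
qed

lemma test_on_cmult:
  fixes \<phi> :: "'a::euclidean_space \<Rightarrow> complex"
  shows "test_on U \<phi> \<Longrightarrow> test_on U (\<lambda>x. c * \<phi> x)"
  using test_on_mult[OF _ smooth_const] .

lemma test_on_diff:
  fixes \<phi> \<psi> :: "'a::euclidean_space \<Rightarrow> complex"
  assumes "test_on U \<phi>" "test_on U \<psi>"
  shows "test_on U (\<lambda>x. \<phi> x - \<psi> x)"
  using test_on_add[OF assms(1) test_on_cmult[OF assms(2), of "-1"]] by simp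

lemma frechet_derivative_cong_open:
  assumes "open S" "x \<in> S" "\<And>y. y \<in> S \<Longrightarrow> f y = g y"
  shows "frechet_derivative f (at x) = frechet_derivative g (at x)"
proof -
  have "(f has_derivative D) (at x) \<longleftrightarrow> (g has_derivative D) (at x)" for D
  proof
    assume "(f has_derivative D) (at x)"
    then show "(g has_derivative D) (at x)"
      by (rule has_derivative_transform_within_open[OF _ assms])
  next
    assume "(g has_derivative D) (at x)"
    then show "(f has_derivative D) (at x)"
      by (rule has_derivative_transform_within_open[OF _ assms(1,2)]) (simp add: assms(3))
  qed
  then show ?thesis by (simp add: frechet_derivative_def)
qed

lemma frechet_derivative_zero_open:
  assumes "open S" "x \<in> S" "\<And>y. y \<in> S \<Longrightarrow> f y = 0"
  shows "frechet_derivative f (at x) v = 0"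
  using frechet_derivative_cong_open[OF assms(1,2), of f "\<lambda>_. 0"] assms(3)
  by (simp add: frechet_derivative_const)

lemma test_on_directional:
  fixes \<phi> :: "'a::euclidean_space \<Rightarrow> complex"
  assumes "test_on U \<phi>"
  shows "test_on U (\<lambda>x. frechet_derivative \<phi> (at x) v)"
proof -
  obtain S where S: "compact S" "S \<subseteq> U" "\<And>x. \<phi> x \<noteq> 0 \<Longrightarrow> x \<in> S"
    using assms(1) by (rule test_on_support) (rule that)
  show ?thesis
  proof (rule test_onI[OF _ S(1,2)])
    show "smooth (\<lambda>x. frechet_derivative \<phi> (at x) v)"
      using assms by (intro smooth_directional test_on_smooth)
    fix x assume *: "frechet_derivative \<phi> (at x) v \<noteq> 0"
    show "x \<in> S"
    proof (rule ccontr)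
      assume "x \<notin> S"
      then have "frechet_derivative \<phi> (at x) v = 0"
        using S by (intro frechet_derivative_zero_open[of "- S"])
          (auto simp: open_Compl compact_imp_closed)
      with * show False ..
    qed
  qed
qed

lemma test_on_bounded:
  fixes \<phi> :: "'a::euclidean_space \<Rightarrow> complex"
  assumes "test_on U \<phi>"
  obtains B where "B > 0" "\<And>x. norm (\<phi> x) \<le> B"
proof -
  obtain S where S: "compact S" "S \<subseteq> U" "\<And>x. \<phi> x \<noteq> 0 \<Longrightarrow> x \<in> S"
    using assms(1) by (rule test_on_support) (rule that)
  have "continuous_on S \<phi>"
    by (rule continuous_on_subset[OF smooth_continuous[OF test_on_smooth[OF assms]]]) simp
  then have "bounded (\<phi> ` S)" by (rule compact_imp_bounded[OF compact_continuous_image[OF _ S(1)]])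
  then obtain B where B: "B > 0" "\<And>y. y \<in> \<phi> ` S \<Longrightarrow> norm y \<le> B"
    by (auto simp: bounded_pos)
  show thesis
  proof (rule that[OF B(1)])
    show "norm (\<phi> x) \<le> B" for x
      using S(3)[of x] B by (cases "\<phi> x = 0") auto
  qed
qed

lemma smooth_measurable:
  fixes \<phi> :: "'a::euclidean_space \<Rightarrow> complex"
  shows "smooth \<phi> \<Longrightarrow> \<phi> \<in> borel_measurable borel"
  by (rule borel_measurable_continuous_onI[OF smooth_continuous])

lemma integrable_mult_test:
  fixes \<phi> p :: "'a::euclidean_space \<Rightarrow> complex"
  assumes "test_on U \<phi>" "integrable lborel p"
  shows "integrable lborel (\<lambda>x. p x * \<phi> x)"
proof -
  obtain B where B: "B > 0" "\<And>x. norm (\<phi> x) \<le> B"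
    using assms(1) by (rule test_on_bounded) (rule that)
  have [measurable]: "\<phi> \<in> borel_measurable borel" 
    by (rule smooth_measurable[OF test_on_smooth[OF assms(1)]])
  show ?thesis
  proof (rule Bochner_Integration.integrable_bound)
    show "integrable lborel (\<lambda>x. B * norm (p x))" using assms(2) by simp
    show "(\<lambda>x. p x * \<phi> x) \<in> borel_measurable lborel"
      using assms(2) by measurable
    show "AE x in lborel. norm (p x * \<phi> x) \<le> norm (B * norm (p x))"
      using B by (auto simp: norm_mult mult.commute mult_right_mono)
  qed
qed

lemma integrable_test:
  fixes \<phi> :: "'a::euclidean_space \<Rightarrow> complex"
  assumes "test_on U \<phi>"
  shows "integrable lborel \<phi>"
proof -
  obtain S where S: "compact S" "S \<subseteq> U" "\<And>x. \<phi> x \<noteq> 0 \<Longrightarrow> x \<in> S"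
    using assms(1) by (rule test_on_support) (rule that)
  have "integrable lborel (\<lambda>x. complex_of_real (indicator S x))"
    using emeasure_compact_finite[OF S(1)] borel_compact[OF S(1)]
    by (intro integrable_of_real integrable_real_indicator) auto
  from integrable_mult_test[OF assms this] show ?thesis
    by (rule Bochner_Integration.integrable_cong[THEN iffD1, rotated 2])
      (use S(3) in \<open>auto simp: indicator_def\<close>)
qed

text \<open>The single bound on derivative and difference quotient is the dominating constant whenever a
  derivative is exchanged with an integral.\<close>

lemma test_on_Lipschitz:
  fixes \<phi> :: "'a::euclidean_space \<Rightarrow> complex"
  assumes "test_on U \<phi>"
  obtains B where "B > 0" "\<And>x v. norm (frechet_derivative \<phi> (at x) v) \<le> B * norm v"
    "\<And>x y. norm (\<phi> y - \<phi> x) \<le> B * norm (y - x)"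
proof -
  have "\<exists>B>0. \<forall>x. norm (frechet_derivative \<phi> (at x) b) \<le> B" for b
    by (rule test_on_bounded[OF test_on_directional[OF assms, of b]]) blast
  then obtain C where C: "\<And>b. C b > 0" "\<And>b x. norm (frechet_derivative \<phi> (at x) b) \<le> C b"
    by metis
  let ?B = "1 + (\<Sum>b\<in>Basis. C b)"
  have B: "?B > 0" using C(1) by (simp add: add_pos_nonneg less_imp_le sum_nonneg)
  have D: "norm (frechet_derivative \<phi> (at x) v) \<le> ?B * norm v" for x v
  proof -
    interpret D: bounded_linear "frechet_derivative \<phi> (at x)"
      by (rule has_derivative_bounded_linear[OF smooth_has_derivative[OF test_on_smooth[OF assms]]])
    have "frechet_derivative \<phi> (at x) v = (\<Sum>b\<in>Basis. (v \<bullet> b) *\<^sub>R frechet_derivative \<phi> (at x) b)"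
      by (subst euclidean_representation[of v, symmetric]) (simp only: D.sum D.scaleR)
    also have "norm \<dots> \<le> (\<Sum>b\<in>Basis. norm v * C b)"
      by (rule sum_norm_le) (auto intro!: mult_mono C Basis_le_norm simp del: norm_scaleR simp add: norm_scaleR)
    also have "\<dots> \<le> ?B * norm v" by (simp flip: sum_distrib_left add: distrib_right)
    finally show ?thesis .
  qed
  show thesis
  proof (rule that[OF B D])
    fix x y
    have "norm (\<phi> y - \<phi> x) \<le> ?B * norm (y - x)"
      by (rule differentiable_bound[of UNIV \<phi> "\<lambda>x. frechet_derivative \<phi> (at x)"])
        (auto intro!: smooth_has_derivative[OF test_on_smooth[OF assms]] onorm_le D)
    then show "norm (\<phi> y - \<phi> x) \<le> ?B * norm (y - x)" .
  qed
qed

section \<open>Symmetry of second derivatives\<close>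

lemma smooth_line_derivative:
  fixes f :: "'a::real_normed_vector \<Rightarrow> complex"
  assumes "smooth f"
  shows "((\<lambda>t. f (x + t *\<^sub>R v)) has_vector_derivative frechet_derivative f (at (x + t *\<^sub>R v)) v) (at t within S)"
proof -
  interpret D: bounded_linear "frechet_derivative f (at (x + t *\<^sub>R v))"
    by (rule has_derivative_bounded_linear[OF smooth_has_derivative[OF assms]])
  have "((\<lambda>t. x + t *\<^sub>R v) has_derivative (\<lambda>s. s *\<^sub>R v)) (at t within S)"
    by (auto intro!: derivative_eq_intros)
  from has_derivative_compose[OF this smooth_has_derivative[OF assms]]
  show ?thesis unfolding has_vector_derivative_def by (simp only: D.scaleR)
qed

text \<open>Differentiating \<open>f(x + tv) - f(x) = \<integral>\<^sub>0\<^sup>t (\<partial>\<^sub>v f)(x + sv) ds\<close> in direction \<open>w\<close> under the integral, and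
  then in \<open>t\<close> at \<open>t = 0\<close>, gives \<open>\<partial>\<^sub>v \<partial>\<^sub>w f = \<partial>\<^sub>w \<partial>\<^sub>v f\<close>.\<close>

lemma smooth_second_derivative_symmetric:
  fixes f :: "'a::real_normed_vector \<Rightarrow> complex"
  assumes f: "smooth f"
  shows "frechet_derivative (\<lambda>y. frechet_derivative f (at y) v) (at x) w
       = frechet_derivative (\<lambda>y. frechet_derivative f (at y) w) (at x) v"
proof -
  let ?Dv = "\<lambda>y. frechet_derivative f (at y) v"
  let ?Dw = "\<lambda>y. frechet_derivative f (at y) w"
  let ?Dvw = "\<lambda>y. frechet_derivative ?Dv (at y) w"
  have Dv: "smooth ?Dv" and Dw: "smooth ?Dw" and Dvw: "smooth ?Dvw"
    by (intro smooth_directional f)+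
  have cont: "continuous_on S (\<lambda>z. g (h z))" if "smooth g" "continuous_on S h"
    for g :: "'a \<Rightarrow> complex" and h :: "'z::topological_space \<Rightarrow> 'a" and S
    by (rule continuous_on_compose2[OF smooth_continuous[OF that(1)] that(2)]) simp
  have eq: "?Dw (x + t *\<^sub>R v) - ?Dw x = integral {0..t} (\<lambda>s. ?Dvw (x + s *\<^sub>R v))" if t: "0 \<le> t" for t
  proof -
    have 1: "integral {0..t} (\<lambda>s. ?Dv ((x + r *\<^sub>R w) + s *\<^sub>R v))
        = f ((x + t *\<^sub>R v) + r *\<^sub>R w) - f (x + r *\<^sub>R w)" for r
      using integral_unique[OF fundamental_theorem_of_calculus[OF t smooth_line_derivative[OF f, of "x + r *\<^sub>R w" v]]]
      by (simp add: algebra_simps)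
    have "((\<lambda>r. integral (cbox 0 t) (\<lambda>s. ?Dv ((x + s *\<^sub>R v) + r *\<^sub>R w))) has_vector_derivative
        integral (cbox 0 t) (\<lambda>s. ?Dvw ((x + s *\<^sub>R v) + 0 *\<^sub>R w))) (at 0 within UNIV)"
      by (rule leibniz_rule_vector_derivative[of UNIV 0 t _ "\<lambda>r s. ?Dvw ((x + s *\<^sub>R v) + r *\<^sub>R w)"])
        (auto intro!: smooth_line_derivative[OF Dv] integrable_continuous_interval cont[OF Dv] cont[OF Dvw]
          continuous_intros simp: split_beta)
    moreover have "(\<lambda>r. integral (cbox 0 t) (\<lambda>s. ?Dv ((x + s *\<^sub>R v) + r *\<^sub>R w)))
        = (\<lambda>r. f ((x + t *\<^sub>R v) + r *\<^sub>R w) - f (x + r *\<^sub>R w))"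
      unfolding 1[symmetric] by (simp add: add_ac)
    ultimately have "((\<lambda>r. f ((x + t *\<^sub>R v) + r *\<^sub>R w) - f (x + r *\<^sub>R w)) has_vector_derivative
        integral {0..t} (\<lambda>s. ?Dvw (x + s *\<^sub>R v))) (at 0)" by simp
    moreover have "((\<lambda>r. f ((x + t *\<^sub>R v) + r *\<^sub>R w) - f (x + r *\<^sub>R w)) has_vector_derivative
        ?Dw ((x + t *\<^sub>R v) + 0 *\<^sub>R w) - ?Dw (x + 0 *\<^sub>R w)) (at 0)"
      by (intro has_vector_derivative_diff smooth_line_derivative f)
    ultimately show ?thesis
      by (simp add: vector_derivative_unique_at)
  qed
  have "((\<lambda>t. ?Dw x + integral {0..t} (\<lambda>s. ?Dvw (x + s *\<^sub>R v))) has_vector_derivative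
      0 + ?Dvw (x + 0 *\<^sub>R v)) (at 0 within {0..1})"
    by (intro has_vector_derivative_add has_vector_derivative_const integral_has_vector_derivative
        cont[OF Dvw] continuous_intros) auto
  then have "((\<lambda>t. ?Dw (x + t *\<^sub>R v)) has_vector_derivative ?Dvw x) (at 0 within {0..1})"
    by (rule has_vector_derivative_transform[rotated 2, THEN has_vector_derivative_eq_rhs]) (simp_all add: eq[symmetric])
  moreover have "((\<lambda>t. ?Dw (x + t *\<^sub>R v)) has_vector_derivative
      frechet_derivative ?Dw (at (x + 0 *\<^sub>R v)) v) (at 0 within {0..1})"
    by (rule smooth_line_derivative[OF Dw])
  ultimately show ?thesis
    using vector_derivative_unique_within[of 0 "{0..1::real}"] by (simp add: trivial_limit_within)
qed

section \<open>The operators d/d(zbar)\<close>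

lemma smooth_dzbar: "smooth \<phi> \<Longrightarrow> smooth (dzbar j \<phi>)"
proof -
  assume "smooth \<phi>"
  then have "smooth (\<lambda>z. (1/2) * (frechet_derivative \<phi> (at z) (axis j 1)
                   + \<i> * frechet_derivative \<phi> (at z) (axis j \<i>)))"
    by (intro smooth_mult smooth_const smooth_add smooth_directional)
  then show ?thesis by (simp add: dzbar_def[abs_def])
qed

lemma test_on_dzbar: "test_on U \<phi> \<Longrightarrow> test_on U (dzbar j \<phi>)"
proof -
  assume "test_on U \<phi>"
  then have "test_on U (\<lambda>z. (1/2) * (frechet_derivative \<phi> (at z) (axis j 1)
                   + \<i> * frechet_derivative \<phi> (at z) (axis j \<i>)))"
    by (intro test_on_cmult test_on_add test_on_directional)
  then show ?thesis by (simp add: dzbar_def[abs_def])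
qed

lemma frechet_derivative_smooth_add:
  assumes "smooth f" "smooth g"
  shows "frechet_derivative (\<lambda>x. f x + g x) (at x) v
    = frechet_derivative f (at x) v + frechet_derivative g (at x) v"
  by (rule fun_cong[OF frechet_derivative_at[OF has_derivative_add[OF smooth_has_derivative
            smooth_has_derivative], OF assms, symmetric]])

lemma frechet_derivative_smooth_mult:
  fixes f g :: "'a::real_normed_vector \<Rightarrow> complex"
  assumes "smooth f" "smooth g"
  shows "frechet_derivative (\<lambda>x. f x * g x) (at x) v
    = f x * frechet_derivative g (at x) v + frechet_derivative f (at x) v * g x"
  by (rule fun_cong[OF frechet_derivative_at[OF has_derivative_mult[OF smooth_has_derivative
            smooth_has_derivative], OF assms, symmetric]])

lemma dzbar_add:
  "smooth f \<Longrightarrow> smooth g \<Longrightarrow> dzbar j (\<lambda>z. f z + g z) z = dzbar j f z + dzbar j g z"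
  by (simp add: dzbar_def frechet_derivative_smooth_add algebra_simps add_divide_distrib)

lemma dzbar_mult:
  "smooth f \<Longrightarrow> smooth g \<Longrightarrow> dzbar j (\<lambda>z. f z * g z) z = dzbar j f z * g z + f z * dzbar j g z"
  by (simp add: dzbar_def frechet_derivative_smooth_mult algebra_simps add_divide_distrib)

lemma dzbar_const: "dzbar j (\<lambda>z. c) z = 0"
  by (simp add: dzbar_def frechet_derivative_const)

lemma dzbar_diff:
  "smooth f \<Longrightarrow> smooth g \<Longrightarrow> dzbar j (\<lambda>z. f z - g z) z = dzbar j f z - dzbar j g z"
  using dzbar_add[of f "\<lambda>z. - 1 * g z" j z] dzbar_mult[of "\<lambda>_. -1" g j z]
  by (simp add: smooth_minus smooth_const dzbar_const)

lemma dzbar_cong_open: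
  "open S \<Longrightarrow> z \<in> S \<Longrightarrow> (\<And>y. y \<in> S \<Longrightarrow> f y = g y) \<Longrightarrow> dzbar j f z = dzbar j g z"
  using frechet_derivative_cong_open[of S z f g] by (simp add: dzbar_def)

lemma dzbar_commute:
  assumes "smooth f"
  shows "dzbar j (dzbar k f) z = dzbar k (dzbar j f) z"
proof -
  let ?D = "\<lambda>v z. frechet_derivative f (at z) v"
  have D: "smooth (?D v)" for v using assms by (rule smooth_directional)
  have e: "dzbar k f = (\<lambda>z. (1/2) * (?D (axis k 1) z + \<i> * ?D (axis k \<i>) z))" for k
    by (simp add: dzbar_def[abs_def])
  have "dzbar j (dzbar k f) z = (1/4) * (
      frechet_derivative (?D (axis k 1)) (at z) (axis j 1) + \<i> * frechet_derivative (?D (axis k 1)) (at z) (axis j \<i>)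
      + \<i> * frechet_derivative (?D (axis k \<i>)) (at z) (axis j 1) - frechet_derivative (?D (axis k \<i>)) (at z) (axis j \<i>))" for j k
  proof -
    have dz: "dzbar j (?D v) z = (frechet_derivative (?D v) (at z) (axis j 1)
        + \<i> * frechet_derivative (?D v) (at z) (axis j \<i>)) / 2" for v
      by (simp add: dzbar_def)
    have h: "dzbar j (dzbar k f) z = (1/2) * (dzbar j (?D (axis k 1)) z + \<i> * dzbar j (?D (axis k \<i>)) z)"
      unfolding e[of k]
      by (simp only: dzbar_mult dzbar_add dzbar_const D smooth_const smooth_add smooth_mult
          mult_zero_left add_0_left)
    show ?thesis unfolding h dz by (simp add: field_simps)
  qed
  from this[of j k] this[of k j] show ?thesis
    by (simp only: smooth_second_derivative_symmetric[OF assms, of "axis k 1" z "axis j 1"]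
        smooth_second_derivative_symmetric[OF assms, of "axis k 1" z "axis j \<i>"]
        smooth_second_derivative_symmetric[OF assms, of "axis k \<i>" z "axis j 1"]
        smooth_second_derivative_symmetric[OF assms, of "axis k \<i>" z "axis j \<i>"]) (simp add: algebra_simps)
qed

section \<open>Lebesgue measure: translations, dilations, integration by parts\<close>

lemma lborel_integral_translate:
  fixes f :: "'a::euclidean_space \<Rightarrow> 'b::{banach, second_countable_topology}"
  assumes "f \<in> borel_measurable borel"
  shows "(LINT x|lborel. f (a + x)) = (LINT x|lborel. f x)"
proof -
  have "(LINT x|lborel. f x) = (LINT x|distr lborel borel ((+) a). f x)"
    by (simp add: lborel_distr_plus)
  also have "\<dots> = (LINT x|lborel. f (a + x))"
    using assms by (subst integral_distr) auto
  finally show ?thesis by simp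
qed

lemma lborel_integrable_translate:
  fixes f :: "'a::euclidean_space \<Rightarrow> 'b::{banach, second_countable_topology}"
  assumes "integrable lborel f"
  shows "integrable lborel (\<lambda>x. f (a + x))"
proof -
  have "integrable (distr lborel borel ((+) a)) f"
    using assms by (simp add: lborel_distr_plus)
  then show ?thesis
    using assms by (subst (asm) integrable_distr_eq) auto
qed

lemma lborel_integral_dilate:
  fixes f :: "'a::euclidean_space \<Rightarrow> 'b::{banach, second_countable_topology}"
  assumes "f \<in> borel_measurable borel" "c > 0"
  shows "(LINT x|lborel. f x) = (LINT x|lborel. c ^ DIM('a) *\<^sub>R f (c *\<^sub>R x))"
proof -
  have "(LINT x|lborel. f x) = (LINT x|density (distr lborel borel (\<lambda>x. 0 + c *\<^sub>R x)) (\<lambda>_. \<bar>c\<bar>^DIM('a)). f x)"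
    using lborel_affine[of c "0::'a"] assms(2) by simp
  also have "\<dots> = (LINT x|distr lborel borel (\<lambda>x. 0 + c *\<^sub>R x). c ^ DIM('a) *\<^sub>R f x)"
    using assms by (subst integral_density) auto
  also have "\<dots> = (LINT x|lborel. c ^ DIM('a) *\<^sub>R f (c *\<^sub>R x))"
    using assms by (subst integral_distr) auto
  finally show ?thesis .
qed

text \<open>By translation invariance every difference quotient of \<open>\<phi>\<close> has integral zero; dominated
  convergence passes this to the derivative.\<close>

lemma integral_directional_derivative_zero:
  fixes \<phi> :: "'a::euclidean_space \<Rightarrow> complex"
  assumes \<phi>: "test_on U \<phi>"
  shows "(LINT x|lborel. frechet_derivative \<phi> (at x) v) = 0"
proof -
  obtain S where S: "compact S" "S \<subseteq> U" "\<And>x. \<phi> x \<noteq> 0 \<Longrightarrow> x \<in> S"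
    using assms by (rule test_on_support) (rule that)
  obtain B where B: "B > 0" "\<And>x v. norm (frechet_derivative \<phi> (at x) v) \<le> B * norm v"
    "\<And>x y. norm (\<phi> y - \<phi> x) \<le> B * norm (y - x)"
    using assms by (rule test_on_Lipschitz) (rule that)
  obtain r where r: "\<And>x. x \<in> S \<Longrightarrow> norm x \<le> r"
    using compact_imp_bounded[OF S(1)] unfolding bounded_iff by blast
  define t where "t n = inverse (real (Suc n))" for n
  have t: "0 < t n" "t n \<le> 1" "t \<longlonglongrightarrow> 0" for n
    unfolding t_def using LIMSEQ_inverse_real_of_nat by (auto simp: field_simps)
  define q where "q n x = (\<phi> (t n *\<^sub>R v + x) - \<phi> x) / t n" for n x
  have smooth: "smooth \<phi>" by (rule test_on_smooth[OF \<phi>])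
  have [measurable]: "\<phi> \<in> borel_measurable borel" by (rule smooth_measurable[OF smooth])
  have [measurable]: "(\<lambda>x. frechet_derivative \<phi> (at x) v) \<in> borel_measurable borel"
    by (rule smooth_measurable[OF smooth_directional[OF smooth]])
  have int: "integrable lborel \<phi>" by (rule integrable_test[OF \<phi>])
  have zero: "(LINT x|lborel. q n x) = 0" for n
    using lborel_integral_translate[of \<phi> "t n *\<^sub>R v"] lborel_integrable_translate[OF int, of "t n *\<^sub>R v"] int
    by (simp add: q_def)
  have "(\<lambda>n. LINT x|lborel. q n x) \<longlonglongrightarrow> (LINT x|lborel. frechet_derivative \<phi> (at x) v)"
  proof (rule integral_dominated_convergence)
    show "(\<lambda>x. frechet_derivative \<phi> (at x) v) \<in> borel_measurable lborel" by simp
    show "q n \<in> borel_measurable lborel" for n unfolding q_def by simp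
    show "integrable lborel (\<lambda>x. B * norm v * indicator (cball 0 (r + norm v) :: 'a set) x)"
      by (intro integrable_mult_right integrable_real_indicator) (use emeasure_bounded_finite[OF bounded_cball] in \<open>auto simp: less_top\<close>)
    show "AE x in lborel. (\<lambda>n. q n x) \<longlonglongrightarrow> frechet_derivative \<phi> (at x) v"
    proof (rule AE_I2)
      fix x
      have "((\<lambda>s. (\<phi> (x + s *\<^sub>R v) - \<phi> x) /\<^sub>R s) \<longlongrightarrow> frechet_derivative \<phi> (at x) v) (at 0)"
      proof -
        let ?D = "frechet_derivative \<phi> (at x) v"
        have "((\<lambda>s. norm (\<phi> (x + s *\<^sub>R v) - \<phi> x - s *\<^sub>R ?D) / \<bar>s\<bar>) \<longlongrightarrow> 0) (at 0)"
          using smooth_line_derivative[OF smooth, of x v 0 UNIV]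
          by (simp add: has_vector_derivative_def has_derivative_iff_norm)
        then have "((\<lambda>s. norm ((\<phi> (x + s *\<^sub>R v) - \<phi> x) /\<^sub>R s - ?D)) \<longlongrightarrow> 0) (at 0)"
        proof (rule Lim_transform_eventually)
          have "norm (\<phi> (x + s *\<^sub>R v) - \<phi> x - s *\<^sub>R ?D) / \<bar>s\<bar>
              = norm ((\<phi> (x + s *\<^sub>R v) - \<phi> x) /\<^sub>R s - ?D)" if "s \<noteq> 0" for s
          proof -
            have "(\<phi> (x + s *\<^sub>R v) - \<phi> x) /\<^sub>R s - ?D = (\<phi> (x + s *\<^sub>R v) - \<phi> x - s *\<^sub>R ?D) /\<^sub>R s"
              using that by (simp add: scaleR_right_diff_distrib)
            then show ?thesis by (simp add: divide_inverse mult.commute)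
          qed
          then show "\<forall>\<^sub>F s in at 0. norm (\<phi> (x + s *\<^sub>R v) - \<phi> x - s *\<^sub>R ?D) / \<bar>s\<bar>
              = norm ((\<phi> (x + s *\<^sub>R v) - \<phi> x) /\<^sub>R s - ?D)"
            by (simp add: eventually_at_filter)
        qed
        then show ?thesis by (subst Lim_null) (rule tendsto_norm_zero_cancel)
      qed
      then have "((\<lambda>n. (\<phi> (x + t n *\<^sub>R v) - \<phi> x) /\<^sub>R t n) \<longlonglongrightarrow> frechet_derivative \<phi> (at x) v)"
        by (rule filterlim_compose) (use t in \<open>auto simp: filterlim_at less_imp_neq[symmetric]\<close>)
      then show "(\<lambda>n. q n x) \<longlonglongrightarrow> frechet_derivative \<phi> (at x) v"
        by (simp add: q_def add.commute scaleR_conv_of_real divide_inverse mult.commute)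
    qed
    show "AE x in lborel. norm (q n x) \<le> B * norm v * indicator (cball 0 (r + norm v)) x" for n
    proof (rule AE_I2)
      fix x
      show "norm (q n x) \<le> B * norm v * indicator (cball 0 (r + norm v)) x"
      proof (cases "x \<in> cball 0 (r + norm v)")
        case True
        have "norm (\<phi> (t n *\<^sub>R v + x) - \<phi> x) \<le> B * norm v * t n"
          using B(3)[of "t n *\<^sub>R v + x" x] t(1)[of n] by (simp add: ac_simps)
        then show ?thesis using True t(1)[of n]
          by (simp add: q_def norm_divide divide_le_eq)
      next
        case False
        then have "x \<notin> S" using r[of x] norm_ge_zero[of v] by auto
        moreover have "t n *\<^sub>R v + x \<notin> S"
        proof
          assume "t n *\<^sub>R v + x \<in> S"
          then have "norm (t n *\<^sub>R v + x) \<le> r" by (rule r)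
          moreover have "norm (t n *\<^sub>R v) \<le> norm v"
            using t(1,2)[of n] by (simp add: mult_left_le_one_le)
          ultimately have "norm x \<le> r + norm v"
            using norm_triangle_ineq4[of "t n *\<^sub>R v + x" "t n *\<^sub>R v"] by simp
          then show False using False by simp
        qed
        ultimately have "q n x = 0" using S(3) unfolding q_def by (metis diff_self div_0)
        then show ?thesis using False by simp
      qed
    qed
  qed
  then show ?thesis
    by (simp add: zero LIMSEQ_const_iff)
qed

section \<open>Integrability on the complex plane\<close>

lemma borel_measurable_Complex: "(\<lambda>(x, y). Complex x y) \<in> borel_measurable (lborel \<Otimes>\<^sub>M lborel)"
proof -
  have "(\<lambda>p::real \<times> real. complex_of_real (fst p) + \<i> * complex_of_real (snd p)) \<in> borel_measurable borel"
    by (intro borel_measurable_continuous_onI continuous_intros)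
  then show ?thesis by (simp add: lborel_prod Complex_eq split_beta')
qed

lemma lborel_complex: "(lborel :: complex measure) = distr (lborel \<Otimes>\<^sub>M lborel) borel (\<lambda>(x, y). Complex x y)"
proof (rule lborel_eqI)
  fix l u :: complex
  assume le: "\<And>b. b \<in> Basis \<Longrightarrow> l \<bullet> b \<le> u \<bullet> b"
  note [measurable] = borel_measurable_Complex
  have "(\<lambda>(x, y). Complex x y) -` box l u \<inter> space (lborel \<Otimes>\<^sub>M lborel) = {Re l<..<Re u} \<times> {Im l<..<Im u}"
    by (auto simp: box_def Basis_complex_def space_pair_measure)
  then show "emeasure (distr (lborel \<Otimes>\<^sub>M lborel) borel (\<lambda>(x, y). Complex x y)) (box l u)
      = ennreal (\<Prod>b\<in>Basis. (u - l) \<bullet> b)"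
    using le[of 1] le[of \<i>]
    by (simp add: emeasure_distr lborel.emeasure_pair_measure_Times Basis_complex_def ennreal_mult'')
qed simp

lemma AE_complex_off_axes: "AE z in (lborel :: complex measure). Re z \<noteq> 0 \<and> Im z \<noteq> 0"
proof -
  have "{z::complex. z \<bullet> b = 0} \<in> null_sets lborel" if "b \<in> Basis" for b
  proof -
    have "{z::complex. z \<bullet> b = 0} \<in> null_sets lebesgue"
      using negligible_standard_hyperplane[OF that] by (simp add: negligible_iff_null_sets)
    moreover have "{z::complex. z \<bullet> b = 0} \<in> sets lborel" by measurable
    ultimately show ?thesis by (simp add: null_sets_completion_iff)
  qed
  from this[of 1, THEN AE_not_in] this[of \<i>, THEN AE_not_in] show ?thesis
    by (simp add: Basis_complex_def AE_conj_iff)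
qed

text \<open>A majorant of product form reduces integrability over the plane to one real variable. The bound is
  asked for off the coordinate axes, a null set, since factors like \<open>|x|\<^sup>-\<^sup>1\<^sup>/\<^sup>2\<close> blow up there.\<close>

lemma integrable_complex_product_bound:
  fixes f :: "complex \<Rightarrow> complex" and g :: "real \<Rightarrow> real"
  assumes [measurable]: "f \<in> borel_measurable borel" and g: "integrable lborel g" "\<And>x. g x \<ge> 0"
    and le: "\<And>z. Re z \<noteq> 0 \<Longrightarrow> Im z \<noteq> 0 \<Longrightarrow> norm (f z) \<le> g (Re z) * g (Im z)"
  shows "integrable lborel f"
proof (rule Bochner_Integration.integrable_bound)
  have [measurable]: "g \<in> borel_measurable borel" using g(1) by simp
  note [measurable] = borel_measurable_Complex
  have "integrable (lborel \<Otimes>\<^sub>M lborel) (\<lambda>(x, y). g x * g y)"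
    by (rule lborel_pair.Fubini_integrable) (use g in \<open>auto simp: abs_mult\<close>)
  then show "integrable lborel (\<lambda>z. g (Re z) * g (Im z))"
    unfolding lborel_complex by (subst integrable_distr_eq) (auto simp: split_beta')
  show "f \<in> borel_measurable lborel" by simp
  show "AE z in lborel. norm (f z) \<le> norm (g (Re z) * g (Im z))"
    using AE_complex_off_axes by eventually_elim (use le g(2) in \<open>auto intro: order_trans[OF _ abs_ge_self]\<close>)
qed

lemma integrable_lborel_reflect_sum:
  fixes h :: "real \<Rightarrow> real"
  assumes "integrable lborel h"
  shows "integrable lborel (\<lambda>x. h x + h (- x))"
  using lborel_integrable_real_affine[OF assms, of "-1" 0] assms by simp

text \<open>Since \<open>|z|\<^sup>2 \<ge> |Re z| |Im z|\<close>, the singularity \<open>1/|z|\<close> is dominated by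
  \<open>|Re z|\<^sup>-\<^sup>1\<^sup>/\<^sup>2 |Im z|\<^sup>-\<^sup>1\<^sup>/\<^sup>2\<close>, a product of integrable functions.\<close>

lemma integrable_bounded_over_id:
  fixes \<psi> :: "complex \<Rightarrow> complex"
  assumes [measurable]: "\<psi> \<in> borel_measurable borel"
    and \<psi>: "\<And>z. norm (\<psi> z) \<le> B" "\<And>z. norm z > r \<Longrightarrow> \<psi> z = 0" and r: "r > 0"
  shows "integrable lborel (\<lambda>z. \<psi> z / z)"
proof -
  define h where "h x = indicator {0..r} x * (sqrt B * x powr (- 1/2))" for x :: real
  have B: "B \<ge> 0" using \<psi>(1)[of 0] norm_ge_zero order_trans by blast
  have hnn: "h x \<ge> 0" for x using B by (simp add: h_def)
  have "(\<lambda>x. x powr (-1/2)) absolutely_integrable_on {0..r}"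
    by (rule nonnegative_absolutely_integrable_1) (use integrable_on_powr_from_0[of "-1/2" r] r in auto)
  then have "integrable lebesgue (\<lambda>x. indicator {0..r} x *\<^sub>R x powr (-1/2))"
    by (simp add: set_integrable_def)
  then have "integrable lborel (\<lambda>x. indicator {0..r} x *\<^sub>R x powr (-1/2))"
    by (subst (asm) integrable_completion) auto
  from integrable_mult_right[OF this, of "sqrt B"] have h: "integrable lborel h"
    by (simp add: h_def[abs_def] mult.left_commute del: integrable_mult_right_iff)
  define g where "g x = h x + h (- x)" for x
  have g: "g x = sqrt B * \<bar>x\<bar> powr (-1/2)" if "x \<noteq> 0" "\<bar>x\<bar> \<le> r" for x
    using that by (auto simp: g_def h_def indicator_def)
  show ?thesis
  proof (rule integrable_complex_product_bound)
    show "integrable lborel g" unfolding g_def by (rule integrable_lborel_reflect_sum[OF h])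
    show gnn: "g x \<ge> 0" for x using hnn by (simp add: g_def)
    fix z assume z: "Re z \<noteq> 0" "Im z \<noteq> 0"
    show "norm (\<psi> z / z) \<le> g (Re z) * g (Im z)"
    proof (cases "norm z > r")
      case True
      then show ?thesis using \<psi>(2) gnn by simp
    next
      case False
      then have "\<bar>Re z\<bar> \<le> r" "\<bar>Im z\<bar> \<le> r"
        using abs_Re_le_cmod[of z] abs_Im_le_cmod[of z] by linarith+
      then have "g (Re z) * g (Im z) = B * (\<bar>Re z\<bar> * \<bar>Im z\<bar>) powr (-1/2)"
        using z B by (simp add: g powr_mult)
      also have "\<dots> \<ge> B * ((norm z)\<^sup>2) powr (-1/2)"
      proof -
        have "0 < \<bar>Re z\<bar> * \<bar>Im z\<bar>" using z by simp
        moreover have "\<bar>Re z\<bar> * \<bar>Im z\<bar> \<le> (norm z)\<^sup>2"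
        proof -
          have "0 \<le> (\<bar>Re z\<bar> - \<bar>Im z\<bar>)\<^sup>2" by simp
          then have "2 * (\<bar>Re z\<bar> * \<bar>Im z\<bar>) \<le> (norm z)\<^sup>2"
            by (simp add: power2_diff cmod_power2)
          then show ?thesis using \<open>0 < \<bar>Re z\<bar> * \<bar>Im z\<bar>\<close> by linarith
        qed
        ultimately show ?thesis using B by (intro mult_left_mono powr_mono2') auto
      qed
      also have "((norm z)\<^sup>2) powr (-1/2) = 1 / norm z"
        using z by (auto simp: powr_powr powr_minus_divide simp flip: powr_numeral)
      finally have "B / norm z \<le> g (Re z) * g (Im z)" by simp
      then show ?thesis using \<psi>(1)[of z] by (simp add: norm_divide divide_right_mono order_trans[rotated])
    qed
  qed simp
qed

text \<open>Dominated by the product of \<open>1/(1 + (Re z)\<^sup>2)\<close> and \<open>1/(1 + (Im z)\<^sup>2)\<close>.\<close>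

lemma integrable_pompeiu_weight:
  "integrable lborel (\<lambda>z::complex. complex_of_real (1 / (1 + (norm z)\<^sup>2)\<^sup>2))"
proof -
  define h where "h x = inverse (1 + x\<^sup>2) * indicator {0..} x" for x :: real
  have "(\<integral>\<^sup>+x. ennreal (inverse (1 + x\<^sup>2)) * indicator {0..} x \<partial>lborel) = ennreal (pi / 2 - arctan 0)"
    by (rule nn_integral_FTC_atLeast) (auto intro!: DERIV_arctan tendsto_arctan_at_top)
  moreover have "ennreal (inverse (1 + x\<^sup>2)) * indicator {0..} x = ennreal (norm (h x))" for x :: real
    by (auto simp: h_def indicator_def)
  ultimately have h: "integrable lborel h"
    by (intro integrableI_bounded) (simp_all add: h_def[abs_def])
  show ?thesis
  proof (rule integrable_complex_product_bound)
    show "integrable lborel (\<lambda>x. h x + h (- x))" by (rule integrable_lborel_reflect_sum[OF h])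
    show "h x + h (- x) \<ge> 0" for x by (simp add: h_def)
    fix z :: complex assume z: "Re z \<noteq> 0" "Im z \<noteq> 0"
    have h': "h x + h (- x) = inverse (1 + x\<^sup>2)" if "x \<noteq> 0" for x
      using that by (auto simp: h_def indicator_def)
    have "(1 + (Re z)\<^sup>2) * (1 + (Im z)\<^sup>2) \<le> (1 + (norm z)\<^sup>2)\<^sup>2"
    proof -
      have "(1 + (norm z)\<^sup>2)\<^sup>2 = (1 + (Re z)\<^sup>2) * (1 + (Im z)\<^sup>2) + (Re z)\<^sup>2 + (Im z)\<^sup>2 + (Re z)\<^sup>2 * (Im z)\<^sup>2 + ((Re z)\<^sup>2)\<^sup>2 + ((Im z)\<^sup>2)\<^sup>2"
        unfolding cmod_power2 by algebra
      then show ?thesis by simp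
    qed
    moreover have "0 < (1 + (Re z)\<^sup>2) * (1 + (Im z)\<^sup>2)" by (simp add: add_pos_nonneg)
    ultimately have "inverse ((1 + (norm z)\<^sup>2)\<^sup>2) \<le> inverse ((1 + (Re z)\<^sup>2) * (1 + (Im z)\<^sup>2))"
      by (rule le_imp_inverse_le)
    then show "norm (complex_of_real (1 / (1 + (norm z)\<^sup>2)\<^sup>2))
        \<le> (h (Re z) + h (- Re z)) * (h (Im z) + h (- Im z))"
      unfolding h'[OF z(1)] h'[OF z(2)] norm_of_real by (simp add: divide_inverse)
  qed simp
qed

section \<open>The Pompeiu formula at the origin\<close>

text \<open>The operator \<open>d/d(zbar)\<close> of one complex variable.\<close>

definition dbar1 :: "(complex \<Rightarrow> complex) \<Rightarrow> complex \<Rightarrow> complex" where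
  "dbar1 \<phi> \<zeta> = (frechet_derivative \<phi> (at \<zeta>) 1 + \<i> * frechet_derivative \<phi> (at \<zeta>) \<i>) / 2"

text \<open>The number \<open>\<pi>\<close>, in the form in which it arises from the regularised kernel below.\<close>

definition pompeiu_const :: complex where
  "pompeiu_const = (LINT z|lborel. complex_of_real (1 / (1 + (norm (z::complex))\<^sup>2)\<^sup>2))"

lemma pompeiu_const_nonzero: "pompeiu_const \<noteq> 0"
proof
  let ?w = "\<lambda>z::complex. 1 / (1 + (norm z)\<^sup>2)\<^sup>2"
  assume "pompeiu_const = 0"
  then have 0: "(LINT z|lborel. ?w z) = 0"
    by (simp only: pompeiu_const_def integral_complex_of_real of_real_eq_0_iff)
  have "integrable lborel ?w" using integrable_pompeiu_weight by (rule complex_of_real_integrable_eq[THEN iffD1])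
  from integral_nonneg_eq_0_iff_AE[OF this] 0
  have "AE z in lborel. ?w z = 0" by simp
  moreover have "?w z \<noteq> 0" for z
    using add_pos_nonneg[of 1 "(norm z)\<^sup>2"] by simp
  ultimately have "AE z in (lborel :: complex measure). False" by simp
  then show False by (simp add: eventually_False ae_filter_eq_bot_iff)
qed

lemma dbar1_mult:
  "smooth f \<Longrightarrow> smooth g \<Longrightarrow> dbar1 (\<lambda>z. f z * g z) z = dbar1 f z * g z + f z * dbar1 g z"
  by (simp add: dbar1_def frechet_derivative_smooth_mult algebra_simps add_divide_distrib)

lemma test_on_dbar1: "test_on U \<phi> \<Longrightarrow> test_on U (dbar1 \<phi>)"
proof -
  assume "test_on U \<phi>"
  then have "test_on U (\<lambda>z. (1/2) * (frechet_derivative \<phi> (at z) 1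
                   + \<i> * frechet_derivative \<phi> (at z) \<i>))"
    by (intro test_on_cmult test_on_add test_on_directional)
  then show ?thesis by (simp add: dbar1_def[abs_def])
qed

lemma integral_dbar1_zero:
  assumes "test_on U \<phi>"
  shows "(LINT z|lborel. dbar1 \<phi> z) = 0"
proof -
  have "integrable lborel (\<lambda>z. frechet_derivative \<phi> (at z) v)" for v
    using assms by (intro integrable_test test_on_directional)
  then show ?thesis
    by (simp add: dbar1_def integral_directional_derivative_zero[OF assms])
qed

lemma dbar1_has_derivative:
  assumes "(f has_derivative D) (at z)"
  shows "dbar1 f z = (D 1 + \<i> * D \<i>) / 2"
  using frechet_derivative_at[OF assms] by (simp add: dbar1_def)

text \<open>A smooth approximation of \<open>1/z\<close>; its \<open>zbar\<close>-derivative is an approximate identity of total mass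
  \<open>pompeiu_const\<close>.\<close>

lemma regularised_kernel:
  fixes e :: real
  assumes "e > 0"
  defines "m \<equiv> \<lambda>z. cnj z * inverse (complex_of_real ((norm z)\<^sup>2 + e\<^sup>2))"
  shows "smooth m" "dbar1 m z = complex_of_real (e\<^sup>2 / ((norm z)\<^sup>2 + e\<^sup>2)\<^sup>2)"
proof -
  have pos: "(norm z)\<^sup>2 + e\<^sup>2 > 0" for z :: complex using assms by (simp add: add_nonneg_pos)
  then have nz: "complex_of_real ((norm z)\<^sup>2 + e\<^sup>2) \<noteq> 0" for z :: complex
    using less_imp_neq[OF pos, of z] by (simp only: of_real_eq_0_iff not_sym simp_thms)
  have lin: "smooth (\<lambda>z::complex. z)" by (rule smooth_bounded_linear[OF bounded_linear_ident])
  have "smooth (\<lambda>z::complex. complex_of_real (z \<bullet> z + e\<^sup>2))"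
    by (intro smooth_of_real smooth_add smooth_inner smooth_const lin)
  then have den: "smooth (\<lambda>z::complex. complex_of_real ((norm z)\<^sup>2 + e\<^sup>2))"
    by (simp only: power2_norm_eq_inner)
  show "smooth m" unfolding m_def
    by (intro smooth_mult smooth_inverse den smooth_bounded_linear bounded_linear_cnj nz)
  have "((\<lambda>z. complex_of_real (z \<bullet> z + e\<^sup>2)) has_derivative (\<lambda>v. complex_of_real (2 * (z \<bullet> v)))) (at z)"
    by (auto intro!: derivative_eq_intros simp: inner_commute)
  then have "((\<lambda>z. complex_of_real ((norm z)\<^sup>2 + e\<^sup>2)) has_derivative (\<lambda>v. complex_of_real (2 * (z \<bullet> v)))) (at z)"
    by (simp add: power2_norm_eq_inner)
  from Deriv.has_derivative_inverse[OF nz this]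
  have inv: "((\<lambda>z. inverse (complex_of_real ((norm z)\<^sup>2 + e\<^sup>2))) has_derivative
     (\<lambda>v. - (inverse (complex_of_real ((norm z)\<^sup>2 + e\<^sup>2)) * complex_of_real (2 * (z \<bullet> v)) * inverse (complex_of_real ((norm z)\<^sup>2 + e\<^sup>2))))) (at z)" .
  have "(cnj has_derivative cnj) (at z)"
    by (rule bounded_linear_imp_has_derivative[OF bounded_linear_cnj])
  note D = dbar1_has_derivative[OF has_derivative_mult[OF this inv]]
  have alg: "(c * - (inverse q * complex_of_real (2 * s) * inverse q) + cnj 1 * inverse q
      + \<i> * (c * - (inverse q * complex_of_real (2 * t) * inverse q) + cnj \<i> * inverse q)) / 2
    = (inverse q)\<^sup>2 * (q - c * (complex_of_real s + \<i> * complex_of_real t))" if "q \<noteq> 0" for c q s t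
    using that by (simp add: divide_simps power2_eq_square) (simp add: algebra_simps)
  have "dbar1 m z = (inverse (complex_of_real ((norm z)\<^sup>2 + e\<^sup>2)))\<^sup>2 * (complex_of_real ((norm z)\<^sup>2 + e\<^sup>2)
      - cnj z * (complex_of_real (z \<bullet> 1) + \<i> * complex_of_real (z \<bullet> \<i>)))"
    unfolding m_def D by (rule alg[OF nz])
  also have "complex_of_real (z \<bullet> 1) + \<i> * complex_of_real (z \<bullet> \<i>) = z"
    by (simp add: complex_eq_iff inner_complex_def)
  also have "cnj z * z = complex_of_real ((norm z)\<^sup>2)"
    using complex_norm_square[of z] by (simp add: mult.commute)
  finally show "dbar1 m z = complex_of_real (e\<^sup>2 / ((norm z)\<^sup>2 + e\<^sup>2)\<^sup>2)"
    by (simp add: divide_inverse power_inverse mult.commute)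
qed

text \<open>Integrate \<open>dbar1 \<phi>\<close> by parts against the regularised kernel \<open>m\<^sub>\<epsilon>\<close>. As \<open>\<epsilon>\<close> tends to 0 the kernels
  converge to \<open>1/z\<close>, dominated by \<open>1/|z|\<close>; on the other side the substitution \<open>z = \<epsilon> y\<close> turns the
  derivatives of \<open>m\<^sub>\<epsilon>\<close> into a fixed weight against which \<open>\<phi>(\<epsilon> y)\<close> converges to \<open>\<phi>(0)\<close>.\<close>

lemma pompeiu:
  assumes \<phi>: "test_on U \<phi>"
  shows "integrable lborel (\<lambda>z. dbar1 \<phi> z / z)"
    and "(LINT z|lborel. dbar1 \<phi> z / z) = - pompeiu_const * \<phi> 0"
proof -
  have d: "test_on U (dbar1 \<phi>)" by (rule test_on_dbar1[OF \<phi>])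
  have sm: "smooth \<phi>" "smooth (dbar1 \<phi>)" using \<phi> d by (auto intro: test_on_smooth)
  note [measurable] = sm[THEN smooth_measurable]
  obtain S where S: "compact S" "S \<subseteq> U" "\<And>x. dbar1 \<phi> x \<noteq> 0 \<Longrightarrow> x \<in> S"
    using d by (rule test_on_support) (rule that)
  obtain r where r: "r > 0" "\<And>x. x \<in> S \<Longrightarrow> norm x \<le> r"
    using compact_imp_bounded[OF S(1)] unfolding bounded_pos by blast
  obtain B where B: "B > 0" "\<And>x. norm (dbar1 \<phi> x) \<le> B"
    using d by (rule test_on_bounded) (rule that)
  obtain C where C: "C > 0" "\<And>x. norm (\<phi> x) \<le> C"
    using \<phi> by (rule test_on_bounded) (rule that)
  show int: "integrable lborel (\<lambda>z. dbar1 \<phi> z / z)"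
    by (rule integrable_bounded_over_id[OF _ B(2) _ r(1)]) (use S(3) r(2) in force)+
  define e where "e n = inverse (real (Suc n))" for n
  have e: "e n > 0" "e \<longlonglongrightarrow> 0" for n
    unfolding e_def using LIMSEQ_inverse_real_of_nat by auto
  define m where "m n z = cnj z * inverse (complex_of_real ((norm z)\<^sup>2 + (e n)\<^sup>2))" for n z
  have m: "smooth (m n)" "dbar1 (m n) z = complex_of_real ((e n)\<^sup>2 / ((norm z)\<^sup>2 + (e n)\<^sup>2)\<^sup>2)" for n z
    using regularised_kernel[OF e(1), of n] by (simp_all add: m_def[abs_def])
  have [measurable]: "m n \<in> borel_measurable borel" for n by (rule smooth_measurable[OF m(1)])
  have mb: "norm (m n z) \<le> 1 / norm z" if "z \<noteq> 0" for n z
  proof -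
    have "norm (m n z) = norm z / ((norm z)\<^sup>2 + (e n)\<^sup>2)"
      by (simp add: m_def norm_mult norm_inverse divide_inverse flip: of_real_power of_real_add)
    also have "\<dots> \<le> norm z / (norm z)\<^sup>2"
      using that by (intro divide_left_mono) (auto simp: add_pos_nonneg)
    finally show ?thesis using that by (simp add: power2_eq_square)
  qed
  have parts: "(LINT z|lborel. m n z * dbar1 \<phi> z) = - (LINT z|lborel. dbar1 (m n) z * \<phi> z)" for n
  proof -
    have "integrable lborel (\<lambda>z. m n z * dbar1 \<phi> z)"
      by (rule integrable_test[OF test_on_mult[OF d m(1)]])
    moreover have "smooth (dbar1 (m n))"
    proof -
      have "smooth (\<lambda>z. (1/2) * (frechet_derivative (m n) (at z) 1 + \<i> * frechet_derivative (m n) (at z) \<i>))"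
        by (intro smooth_mult smooth_const smooth_add smooth_directional m)
      then show ?thesis by (simp add: dbar1_def[abs_def])
    qed
    then have "integrable lborel (\<lambda>z. dbar1 (m n) z * \<phi> z)"
      by (intro integrable_test[OF test_on_mult[OF \<phi>]])
    moreover have "(LINT z|lborel. dbar1 (m n) z * \<phi> z + m n z * dbar1 \<phi> z) = 0"
      using integral_dbar1_zero[OF test_on_mult[OF \<phi> m(1)[of n]]]
      by (simp only: dbar1_mult[OF m(1) sm(1)])
    ultimately show ?thesis by (simp add: add_eq_0_iff)
  qed
  have lim1: "(\<lambda>n. LINT z|lborel. m n z * dbar1 \<phi> z) \<longlonglongrightarrow> (LINT z|lborel. dbar1 \<phi> z / z)"
  proof (rule integral_dominated_convergence)
    show "integrable lborel (\<lambda>z. norm (dbar1 \<phi> z / z))" using int by (rule integrable_norm)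
    show "AE z in lborel. (\<lambda>n. m n z * dbar1 \<phi> z) \<longlonglongrightarrow> dbar1 \<phi> z / z"
      using AE_complex_off_axes
    proof eventually_elim
      case (elim z)
      then have z: "z \<noteq> 0" by auto
      have "(\<lambda>n. m n z) \<longlonglongrightarrow> cnj z * inverse (complex_of_real ((norm z)\<^sup>2 + 0\<^sup>2))"
        unfolding m_def using z by (intro tendsto_intros e) auto
      also have "cnj z * inverse (complex_of_real ((norm z)\<^sup>2 + 0\<^sup>2)) = 1 / z"
        using z complex_norm_square[of z] by (simp add: field_simps)
      finally show ?case by (auto intro!: tendsto_eq_intros)
    qed
    show "AE z in lborel. norm (m n z * dbar1 \<phi> z) \<le> norm (dbar1 \<phi> z / z)" for n
      using AE_complex_off_axes
    proof eventually_elim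
      case (elim z)
      then have z: "z \<noteq> 0" by auto
      show ?case using mult_right_mono[OF mb[OF z, of n] norm_ge_zero[of "dbar1 \<phi> z"]]
        by (simp add: norm_mult norm_divide)
    qed
  qed simp_all
  have scaled: "(LINT z|lborel. dbar1 (m n) z * \<phi> z)
      = (LINT z|lborel. complex_of_real (1 / (1 + (norm z)\<^sup>2)\<^sup>2) * \<phi> (e n *\<^sub>R z))" for n
  proof -
    have "e n ^ DIM(complex) *\<^sub>R (dbar1 (m n) (e n *\<^sub>R z) * \<phi> (e n *\<^sub>R z))
        = complex_of_real (1 / (1 + (norm z)\<^sup>2)\<^sup>2) * \<phi> (e n *\<^sub>R z)" for z
    proof -
      have pos: "1 + (norm z)\<^sup>2 > 0" by (simp add: add_pos_nonneg)
      have "(norm (e n *\<^sub>R z))\<^sup>2 + (e n)\<^sup>2 = (e n)\<^sup>2 * (1 + (norm z)\<^sup>2)"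
        using e(1)[of n] by (simp add: power_mult_distrib algebra_simps)
      then have "(e n)\<^sup>2 * ((e n)\<^sup>2 / ((norm (e n *\<^sub>R z))\<^sup>2 + (e n)\<^sup>2)\<^sup>2) = 1 / (1 + (norm z)\<^sup>2)\<^sup>2"
        using e(1)[of n] pos by (simp add: power_mult_distrib power2_eq_square)
      from this[symmetric] show ?thesis
        unfolding m(2) by (simp only: scaleR_conv_of_real of_real_mult mult.assoc[symmetric] DIM_complex of_real_power)
    qed
    moreover have "(\<lambda>z. dbar1 (m n) z * \<phi> z) \<in> borel_measurable borel"
      unfolding m(2) by measurable
    ultimately show ?thesis
      using lborel_integral_dilate[of "\<lambda>z. dbar1 (m n) z * \<phi> z", OF _ e(1)[of n]] by (simp only:)
  qed
  have "(\<lambda>n. LINT z|lborel. complex_of_real (1 / (1 + (norm z)\<^sup>2)\<^sup>2) * \<phi> (e n *\<^sub>R z))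
      \<longlonglongrightarrow> (LINT z|lborel. complex_of_real (1 / (1 + (norm (z::complex))\<^sup>2)\<^sup>2) * \<phi> 0)"
  proof (rule integral_dominated_convergence)
    show "integrable lborel (\<lambda>z::complex. norm (complex_of_real (1 / (1 + (norm z)\<^sup>2)\<^sup>2)) * C)"
      by (intro integrable_mult_left integrable_norm integrable_pompeiu_weight)
    show "AE z in lborel. (\<lambda>n. complex_of_real (1 / (1 + (norm z)\<^sup>2)\<^sup>2) * \<phi> (e n *\<^sub>R z))
        \<longlonglongrightarrow> complex_of_real (1 / (1 + (norm z)\<^sup>2)\<^sup>2) * \<phi> 0"
    proof (rule AE_I2)
      fix z :: complex
      have "isCont \<phi> 0"
        using smooth_continuous[OF sm(1)] by (simp add: continuous_on_eq_continuous_at)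
      moreover have "(\<lambda>n. e n *\<^sub>R z) \<longlonglongrightarrow> 0" using tendsto_scaleR[OF e(2) tendsto_const[of z]] by simp
      ultimately have "(\<lambda>n. \<phi> (e n *\<^sub>R z)) \<longlonglongrightarrow> \<phi> 0"
        by (rule isCont_tendsto_compose)
      then show "(\<lambda>n. complex_of_real (1 / (1 + (norm z)\<^sup>2)\<^sup>2) * \<phi> (e n *\<^sub>R z))
        \<longlonglongrightarrow> complex_of_real (1 / (1 + (norm z)\<^sup>2)\<^sup>2) * \<phi> 0"
        by (rule tendsto_mult[OF tendsto_const])
    qed
    show "AE z in lborel. norm (complex_of_real (1 / (1 + (norm z)\<^sup>2)\<^sup>2) * \<phi> (e n *\<^sub>R z))
        \<le> norm (complex_of_real (1 / (1 + (norm z)\<^sup>2)\<^sup>2)) * C" for n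
      by (rule AE_I2) (simp only: norm_mult mult_left_mono[OF C(2) norm_ge_zero])
  qed simp_all
  also have "(LINT z|lborel. complex_of_real (1 / (1 + (norm (z::complex))\<^sup>2)\<^sup>2) * \<phi> 0) = pompeiu_const * \<phi> 0"
    unfolding pompeiu_const_def by (rule integral_mult_left_zero)
  finally have "(\<lambda>n. LINT z|lborel. m n z * dbar1 \<phi> z) \<longlonglongrightarrow> - (pompeiu_const * \<phi> 0)"
    unfolding parts scaled by (rule tendsto_minus)
  from LIMSEQ_unique[OF lim1 this]
  show "(LINT z|lborel. dbar1 \<phi> z / z) = - pompeiu_const * \<phi> 0" by simp
qed

section \<open>Convolution in one coordinate direction\<close>

lemma bounded_linear_axis: "bounded_linear (axis a :: complex \<Rightarrow> complex ^ 'n::finite)"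
proof -
  have "linear (axis a :: complex \<Rightarrow> complex ^ 'n)"
    by (rule linearI) (auto simp: vec_eq_iff axis_def)
  then show ?thesis by (simp add: linear_conv_bounded_linear)
qed

lemma borel_measurable_axis [measurable]: "(axis a :: complex \<Rightarrow> complex ^ 'n::finite) \<in> borel_measurable borel"
  by (intro borel_measurable_continuous_onI linear_continuous_on bounded_linear_axis)

text \<open>Two mutually transposed operators. Averages with respect to a kernel in one coordinate direction act
  on test functions, convolutions on integrable functions.\<close>

definition dir_avg :: "(complex \<Rightarrow> complex) \<Rightarrow> 'n \<Rightarrow> (complex ^ 'n::finite \<Rightarrow> complex) \<Rightarrow> complex ^ 'n \<Rightarrow> complex" where
  "dir_avg \<kappa> a \<phi> z = (LINT \<zeta>|lborel. \<kappa> \<zeta> * \<phi> (z + axis a \<zeta>))"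

definition dir_conv :: "(complex \<Rightarrow> complex) \<Rightarrow> 'n \<Rightarrow> (complex ^ 'n::finite \<Rightarrow> complex) \<Rightarrow> complex ^ 'n \<Rightarrow> complex" where
  "dir_conv \<kappa> a p z = (LINT \<zeta>|lborel. \<kappa> \<zeta> * p (z - axis a \<zeta>))"

lemma dir_avg_integrable:
  fixes \<phi> :: "complex ^ 'n::finite \<Rightarrow> complex"
  assumes \<phi>: "test_on U \<phi>" and \<kappa>: "integrable lborel \<kappa>"
  shows "integrable lborel (\<lambda>\<zeta>. \<kappa> \<zeta> * \<phi> (z + axis a \<zeta>))"
proof -
  obtain B where B: "B > 0" "\<And>x. norm (\<phi> x) \<le> B"
    using \<phi> by (rule test_on_bounded) (rule that)
  have [measurable]: "\<phi> \<in> borel_measurable borel"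
    by (rule smooth_measurable[OF test_on_smooth[OF \<phi>]])
  show ?thesis
  proof (rule Bochner_Integration.integrable_bound)
    show "integrable lborel (\<lambda>\<zeta>. norm (\<kappa> \<zeta>) * B)" using \<kappa> by simp
    show "(\<lambda>\<zeta>. \<kappa> \<zeta> * \<phi> (z + axis a \<zeta>)) \<in> borel_measurable lborel"
      using \<kappa> by measurable
    show "AE \<zeta> in lborel. norm (\<kappa> \<zeta> * \<phi> (z + axis a \<zeta>)) \<le> norm (norm (\<kappa> \<zeta>) * B)"
      using B by (auto simp: norm_mult mult_left_mono)
  qed
qed

text \<open>The kernel is merely integrable, so the difference quotients are moved to \<open>\<phi>\<close>, where they are
  bounded by a Lipschitz constant.\<close>

lemma dir_avg_has_derivative:
  fixes \<phi> :: "complex ^ 'n::finite \<Rightarrow> complex"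
  assumes \<phi>: "test_on U \<phi>" and \<kappa>: "integrable lborel \<kappa>"
  shows "(dir_avg \<kappa> a \<phi> has_derivative (\<lambda>v. dir_avg \<kappa> a (\<lambda>x. frechet_derivative \<phi> (at x) v) z)) (at z)"
proof -
  let ?D = "\<lambda>v. dir_avg \<kappa> a (\<lambda>x. frechet_derivative \<phi> (at x) v) z"
  obtain B where B: "B > 0" "\<And>x v. norm (frechet_derivative \<phi> (at x) v) \<le> B * norm v"
    "\<And>x y. norm (\<phi> y - \<phi> x) \<le> B * norm (y - x)"
    using \<phi> by (rule test_on_Lipschitz) (rule that)
  have sm: "smooth \<phi>" by (rule test_on_smooth[OF \<phi>])
  have [measurable]: "\<phi> \<in> borel_measurable borel" "(\<lambda>x. frechet_derivative \<phi> (at x) v) \<in> borel_measurable borel" 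
     "\<kappa> \<in> borel_measurable borel" for v
    using sm smooth_directional[OF sm] smooth_measurable \<kappa> by auto
  have lin: "bounded_linear (frechet_derivative \<phi> (at x))" for x
    by (rule has_derivative_bounded_linear[OF smooth_has_derivative[OF sm]])
  have intD: "integrable lborel (\<lambda>\<zeta>. \<kappa> \<zeta> * frechet_derivative \<phi> (at (z + axis a \<zeta>)) v)" for v
    by (rule dir_avg_integrable[OF test_on_directional[OF \<phi>] \<kappa>])
  have int: "integrable lborel (\<lambda>\<zeta>. \<kappa> \<zeta> * \<phi> (w + axis a \<zeta>))" for w
    by (rule dir_avg_integrable[OF \<phi> \<kappa>])
  have bl: "bounded_linear ?D"
  proof (rule bounded_linear_intro[where K = "(LINT \<zeta>|lborel. norm (\<kappa> \<zeta>)) * B"])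
    show "?D (x + y) = ?D x + ?D y" for x y
      using intD by (simp add: dir_avg_def bounded_linear.linear[OF lin, THEN linear_add] algebra_simps)
    show "?D (r *\<^sub>R x) = r *\<^sub>R ?D x" for r x
      by (simp add: dir_avg_def bounded_linear.linear[OF lin, THEN linear_cmul])
    show "norm (?D x) \<le> norm x * ((LINT \<zeta>|lborel. norm (\<kappa> \<zeta>)) * B)" for x
    proof -
      have "norm (?D x) \<le> (LINT \<zeta>|lborel. norm (\<kappa> \<zeta>) * (B * norm x))"
        unfolding dir_avg_def
        by (rule Bochner_Integration.integral_norm_bound_integral)
          (use intD \<kappa> B in \<open>auto simp: norm_mult mult_left_mono\<close>)
      then show ?thesis by (simp add: ac_simps)
    qed
  qed
  show ?thesis
    unfolding has_derivative_within
  proof (intro conjI bl)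
    let ?q = "\<lambda>y \<zeta>. (1 / norm (y - z)) *\<^sub>R (\<kappa> \<zeta> * (\<phi> (y + axis a \<zeta>)
        - (\<phi> (z + axis a \<zeta>) + frechet_derivative \<phi> (at (z + axis a \<zeta>)) (y - z))))"
    have eq: "(1 / norm (y - z)) *\<^sub>R (dir_avg \<kappa> a \<phi> y - (dir_avg \<kappa> a \<phi> z + ?D (y - z))) = (LINT \<zeta>|lborel. ?q y \<zeta>)" for y
      using int intD by (simp add: dir_avg_def right_diff_distrib distrib_left)
    show "((\<lambda>y. (1 / norm (y - z)) *\<^sub>R (dir_avg \<kappa> a \<phi> y - (dir_avg \<kappa> a \<phi> z + ?D (y - z)))) \<longlongrightarrow> 0) (at z)"
      unfolding eq tendsto_at_iff_sequentially o_def
    proof (intro allI impI)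
      fix X assume X: "\<forall>i. X i \<in> UNIV - {z}" "X \<longlonglongrightarrow> z"
      have Xf: "filterlim X (at z) sequentially"
        using X by (simp add: filterlim_at)
      have "(\<lambda>n. LINT \<zeta>|lborel. ?q (X n) \<zeta>) \<longlonglongrightarrow> (LINT (\<zeta>::complex)|lborel. (0::complex))"
      proof (rule integral_dominated_convergence)
        show "integrable lborel (\<lambda>\<zeta>. norm (\<kappa> \<zeta>) * (2 * B))" using \<kappa> by simp
        show "AE \<zeta> in lborel. (\<lambda>n. ?q (X n) \<zeta>) \<longlonglongrightarrow> 0"
        proof (rule AE_I2)
          fix \<zeta>
          let ?g = "\<lambda>w. \<phi> (w + axis a \<zeta>)"
          have "((\<lambda>w. w + axis a \<zeta>) has_derivative (\<lambda>v. v)) (at z)"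
            by (auto intro!: derivative_eq_intros)
          from has_derivative_compose[OF this smooth_has_derivative[OF sm]]
          have "((\<lambda>y. (1 / norm (y - z)) *\<^sub>R (?g y - (?g z + frechet_derivative \<phi> (at (z + axis a \<zeta>)) (y - z)))) \<longlongrightarrow> 0) (at z)"
            by (simp add: has_derivative_within)
          from tendsto_mult_left[OF filterlim_compose[OF this Xf], of "\<kappa> \<zeta>"]
          show "(\<lambda>n. ?q (X n) \<zeta>) \<longlonglongrightarrow> 0" by (simp add: mult_scaleR_right)
        qed
        show "AE \<zeta> in lborel. norm (?q (X n) \<zeta>) \<le> norm (\<kappa> \<zeta>) * (2 * B)" for n
        proof (rule AE_I2)
          fix \<zeta>
          let ?y = "X n" and ?x = "z + axis a \<zeta>"
          have yz: "norm (?y - z) > 0" using X(1) by simp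
          have "norm (\<phi> (?y + axis a \<zeta>) - (\<phi> ?x + frechet_derivative \<phi> (at ?x) (?y - z)))
              \<le> norm (\<phi> (?y + axis a \<zeta>) - \<phi> ?x) + norm (frechet_derivative \<phi> (at ?x) (?y - z))"
            by (metis diff_diff_eq norm_triangle_ineq4)
          also have "\<dots> \<le> B * norm (?y - z) + B * norm (?y - z)"
            using B(3)[of "?y + axis a \<zeta>" ?x] by (intro add_mono B(2)) simp
          finally have "norm (\<phi> (?y + axis a \<zeta>) - (\<phi> ?x + frechet_derivative \<phi> (at ?x) (?y - z))) / norm (?y - z) \<le> 2 * B"
            using yz by (simp add: divide_le_eq)
          from mult_left_mono[OF this norm_ge_zero[of "\<kappa> \<zeta>"]]
          show "norm (?q ?y \<zeta>) \<le> norm (\<kappa> \<zeta>) * (2 * B)" by (simp add: norm_mult)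
        qed
      qed simp_all
      then show "(\<lambda>n. LINT \<zeta>|lborel. ?q (X n) \<zeta>) \<longlonglongrightarrow> 0" by simp
    qed
  qed
qed

lemma dir_avg_smooth:
  fixes \<phi> :: "complex ^ 'n::finite \<Rightarrow> complex"
  assumes \<phi>: "test_on U \<phi>" and \<kappa>: "integrable lborel \<kappa>"
  shows "smooth (dir_avg \<kappa> a \<phi>)"
  unfolding smooth_def
proof
  fix k
  show "C_k k (dir_avg \<kappa> a \<phi>)" using \<phi>
  proof (induction k arbitrary: \<phi>)
    case 0
    show ?case
      using has_derivative_continuous[OF dir_avg_has_derivative[OF 0 \<kappa>]]
      by (simp add: continuous_at_imp_continuous_on)
  next
    case (Suc k)
    show ?case
      by (rule C_k_SucI[OF dir_avg_has_derivative[OF Suc.prems \<kappa>]])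
        (rule Suc.IH[OF test_on_directional[OF Suc.prems]])
  qed
qed

lemma dir_avg_test:
  fixes \<phi> :: "complex ^ 'n::finite \<Rightarrow> complex"
  assumes \<phi>: "test_on U \<phi>" and \<kappa>: "integrable lborel \<kappa>"
    and Q: "compact Q" "\<And>\<zeta>. \<kappa> \<zeta> \<noteq> 0 \<Longrightarrow> \<zeta> \<in> Q"
    and UV: "\<And>x \<zeta>. x \<in> U \<Longrightarrow> \<zeta> \<in> Q \<Longrightarrow> x - axis a \<zeta> \<in> V"
  shows "test_on V (dir_avg \<kappa> a \<phi>)"
proof -
  obtain S where S: "compact S" "S \<subseteq> U" "\<And>x. \<phi> x \<noteq> 0 \<Longrightarrow> x \<in> S"
    using \<phi> by (rule test_on_support) (rule that)
  let ?R = "(\<lambda>(x, \<zeta>). x - axis a \<zeta>) ` (S \<times> Q)"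
  show ?thesis
  proof (rule test_onI)
    show "smooth (dir_avg \<kappa> a \<phi>)" by (rule dir_avg_smooth[OF \<phi> \<kappa>])
    show "compact ?R"
    proof (rule compact_continuous_image)
      have "continuous_on (S \<times> Q) (\<lambda>p. fst p - axis a (snd p))"
        by (intro continuous_on_diff continuous_on_fst continuous_on_id
            bounded_linear.continuous_on[OF bounded_linear_axis] continuous_on_snd)
      then show "continuous_on (S \<times> Q) (\<lambda>(x, \<zeta>). x - axis a \<zeta>)" by (simp add: split_beta')
    qed (use S(1) Q(1) in \<open>rule compact_Times\<close>)
    show "?R \<subseteq> V" using S(2) UV by auto
    fix z assume nz: "dir_avg \<kappa> a \<phi> z \<noteq> 0"
    have "\<exists>\<zeta>. \<kappa> \<zeta> * \<phi> (z + axis a \<zeta>) \<noteq> 0"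
    proof (rule ccontr)
      assume "\<nexists>\<zeta>. \<kappa> \<zeta> * \<phi> (z + axis a \<zeta>) \<noteq> 0"
      then have "(\<lambda>\<zeta>. \<kappa> \<zeta> * \<phi> (z + axis a \<zeta>)) = (\<lambda>\<zeta>. 0)" by blast
      then have "dir_avg \<kappa> a \<phi> z = 0" unfolding dir_avg_def by (simp only: Bochner_Integration.integral_zero)
      with nz show False by simp
    qed
    then obtain \<zeta> where "\<zeta> \<in> Q" "z + axis a \<zeta> \<in> S" using Q(2) S(3) by auto
    then show "z \<in> ?R" by (intro image_eqI[where x = "(z + axis a \<zeta>, \<zeta>)"]) auto
  qed
qed

lemma dir_avg_dzbar:
  fixes \<phi> :: "complex ^ 'n::finite \<Rightarrow> complex"
  assumes \<phi>: "test_on U \<phi>" and \<kappa>: "integrable lborel \<kappa>"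
  shows "dzbar k (dir_avg \<kappa> a \<phi>) z = dir_avg \<kappa> a (dzbar k \<phi>) z"
proof -
  have int: "integrable lborel (\<lambda>\<zeta>. \<kappa> \<zeta> * frechet_derivative \<phi> (at (z + axis a \<zeta>)) v)" for v
    by (rule dir_avg_integrable[OF test_on_directional[OF \<phi>] \<kappa>])
  have D: "frechet_derivative (dir_avg \<kappa> a \<phi>) (at z) v
      = (LINT \<zeta>|lborel. \<kappa> \<zeta> * frechet_derivative \<phi> (at (z + axis a \<zeta>)) v)" for v
    using fun_cong[OF frechet_derivative_at[OF dir_avg_has_derivative[OF \<phi> \<kappa>, where a = a and z = z]], of v]
    by (simp add: dir_avg_def)
  have "dir_avg \<kappa> a (dzbar k \<phi>) z = (LINT \<zeta>|lborel. (1/2) * (\<kappa> \<zeta> * frechet_derivative \<phi> (at (z + axis a \<zeta>)) (axis k 1)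
      + \<i> * (\<kappa> \<zeta> * frechet_derivative \<phi> (at (z + axis a \<zeta>)) (axis k \<i>))))"
    unfolding dir_avg_def by (rule Bochner_Integration.integral_cong) (simp_all add: dzbar_def algebra_simps)
  also have "\<dots> = (1/2) * ((LINT \<zeta>|lborel. \<kappa> \<zeta> * frechet_derivative \<phi> (at (z + axis a \<zeta>)) (axis k 1))
      + \<i> * (LINT \<zeta>|lborel. \<kappa> \<zeta> * frechet_derivative \<phi> (at (z + axis a \<zeta>)) (axis k \<i>)))"
    using int[of "axis k 1"] int[of "axis k \<i>"] by simp
  finally show ?thesis by (simp add: dzbar_def D)
qed

section \<open>The truncated Cauchy kernel\<close>

text \<open>With \<open>\<rho>\<close> a cutoff equal to 1 near the origin, this is the Cauchy kernel truncated to the support of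
  \<open>\<rho>\<close>. The sign is the one that makes averaging (rather than convolution) a right inverse of the
  derivative.\<close>

definition cauchy_kernel :: "(complex \<Rightarrow> complex) \<Rightarrow> complex \<Rightarrow> complex" where
  "cauchy_kernel \<rho> \<zeta> = - (\<rho> \<zeta> / \<zeta>) / pompeiu_const"

lemma cauchy_kernel_integrable:
  assumes "test_on U \<rho>"
  shows "integrable lborel (cauchy_kernel \<rho>)"
proof -
  obtain S where S: "compact S" "S \<subseteq> U" "\<And>x. \<rho> x \<noteq> 0 \<Longrightarrow> x \<in> S"
    using assms by (rule test_on_support) (rule that)
  obtain r where r: "r > 0" "\<And>x. x \<in> S \<Longrightarrow> norm x \<le> r"
    using compact_imp_bounded[OF S(1)] unfolding bounded_pos by blast
  obtain B where B: "B > 0" "\<And>x. norm (\<rho> x) \<le> B"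
    using assms by (rule test_on_bounded) (rule that)
  have "integrable lborel (\<lambda>z. \<rho> z / z)"
    by (rule integrable_bounded_over_id[OF _ B(2) _ r(1)])
      (use S(3) r(2) smooth_measurable[OF test_on_smooth[OF assms]] in force)+
  then show ?thesis unfolding cauchy_kernel_def[abs_def]
    by (intro integrable_divide_zero impI integrable_minus) 
qed

lemma dbar1_axis:
  fixes \<phi> :: "complex ^ 'n::finite \<Rightarrow> complex"
  assumes "smooth \<phi>"
  shows "dbar1 (\<lambda>\<zeta>. \<phi> (z + axis a \<zeta>)) \<zeta> = dzbar a \<phi> (z + axis a \<zeta>)"
proof -
  have "((\<lambda>\<zeta>. z + axis a \<zeta>) has_derivative axis a) (at \<zeta>)"
    using has_derivative_add[OF has_derivative_const bounded_linear_imp_has_derivative[OF bounded_linear_axis]]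
    by simp
  from dbar1_has_derivative[OF has_derivative_compose[OF this smooth_has_derivative[OF assms]]]
  show ?thesis by (simp add: dzbar_def)
qed

text \<open>The Pompeiu formula for \<open>\<rho>(\<zeta>) \<phi>(z + \<zeta> e\<^sub>a)\<close>. Truncation produces an error term containing the
  derivative of \<open>\<rho>\<close>, which lives on \<open>|\<zeta>| \<ge> R\<close>; it vanishes if \<open>\<phi>\<close> does on that part of the line
  through \<open>z\<close>.\<close>

lemma dir_avg_cauchy_kernel:
  fixes \<phi> :: "complex ^ 'n::finite \<Rightarrow> complex"
  assumes \<phi>: "test_on U \<phi>" and \<rho>: "test_on Q \<rho>" "\<And>\<zeta>. norm \<zeta> < R \<Longrightarrow> \<rho> \<zeta> = 1" "R > 0"
    and z: "\<And>\<zeta>. norm \<zeta> \<ge> R \<Longrightarrow> \<phi> (z + axis a \<zeta>) = 0"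
  shows "dzbar a (dir_avg (cauchy_kernel \<rho>) a \<phi>) z = \<phi> z"
proof -
  have sm: "smooth \<phi>" "smooth \<rho>" "smooth (\<lambda>\<zeta>. \<phi> (z + axis a \<zeta>))"
    using \<phi> \<rho> by (auto intro: test_on_smooth smooth_affine bounded_linear_axis)
  have \<Phi>: "test_on UNIV (\<lambda>\<zeta>. \<rho> \<zeta> * \<phi> (z + axis a \<zeta>))"
    using test_on_mult[OF test_on_UNIV[OF \<rho>(1)] sm(3)] by (simp add: mult.commute)
  have 0: "dbar1 \<rho> \<zeta> * \<phi> (z + axis a \<zeta>) = 0" for \<zeta>
  proof (cases "norm \<zeta> < R")
    case True
    have "frechet_derivative \<rho> (at \<zeta>) = frechet_derivative (\<lambda>_. 1) (at \<zeta>)"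
      by (rule frechet_derivative_cong_open[of "ball 0 R"]) (use True \<rho>(2) in auto)
    then show ?thesis by (simp add: dbar1_def frechet_derivative_const)
  next
    case False
    then show ?thesis using z by simp
  qed
  have "dzbar a (dir_avg (cauchy_kernel \<rho>) a \<phi>) z = dir_avg (cauchy_kernel \<rho>) a (dzbar a \<phi>) z"
    by (rule dir_avg_dzbar[OF \<phi> cauchy_kernel_integrable[OF \<rho>(1)]])
  also have "\<dots> = (LINT \<zeta>|lborel. - (dbar1 (\<lambda>\<zeta>. \<rho> \<zeta> * \<phi> (z + axis a \<zeta>)) \<zeta> / \<zeta>) / pompeiu_const)"
    unfolding dir_avg_def dbar1_mult[OF sm(2,3)] dbar1_axis[OF sm(1)] 0
    by (simp add: cauchy_kernel_def)
  also have "\<dots> = - (LINT \<zeta>|lborel. dbar1 (\<lambda>\<zeta>. \<rho> \<zeta> * \<phi> (z + axis a \<zeta>)) \<zeta> / \<zeta>) / pompeiu_const"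
    by (simp only: integral_divide_zero Bochner_Integration.integral_minus)
  also have "\<dots> = \<rho> 0 * \<phi> (z + axis a 0)"
    unfolding pompeiu(2)[OF \<Phi>] using pompeiu_const_nonzero by simp
  also have "\<dots> = \<phi> z" using \<rho>(2)[of 0] \<rho>(3) bounded_linear.linear[OF bounded_linear_axis, of a]
    by (simp add: linear_0)
  finally show ?thesis .
qed

lemma truncation_function:
  assumes "R > 0"
  obtains \<rho> :: "complex \<Rightarrow> complex" where "test_on (ball 0 (2 * R)) \<rho>" "\<And>\<zeta>. norm \<zeta> < R \<Longrightarrow> \<rho> \<zeta> = 1"
proof (rule smooth_cutoff[of "cball (0::complex) R" "ball 0 (2 * R)"])
  show "cball (0::complex) R \<subseteq> ball 0 (2 * R)" using assms by auto
  fix h :: "complex \<Rightarrow> real" and W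
  assume h: "smooth h" "cball 0 R \<subseteq> W" "\<And>x. x \<in> W \<Longrightarrow> h x = 1"
    "compact (closure {x. h x \<noteq> 0})" "closure {x. h x \<noteq> 0} \<subseteq> ball 0 (2 * R)"
  show thesis
  proof (rule that[of "\<lambda>x. of_real (h x)"])
    show "test_on (ball 0 (2 * R)) (\<lambda>x. complex_of_real (h x))"
      using h by (simp add: test_on_def smooth_of_real)
    show "complex_of_real (h \<zeta>) = 1" if "norm \<zeta> < R" for \<zeta>
      using h(3)[of \<zeta>] subsetD[OF h(2), of \<zeta>] that by simp
  qed
qed simp_all

section \<open>Convolution of square-integrable functions\<close>

lemma nn_integral_lborel_translate:
  fixes f :: "'a::euclidean_space \<Rightarrow> ennreal"
  assumes "f \<in> borel_measurable borel"
  shows "(\<integral>\<^sup>+x. f (x - a) \<partial>lborel) = (\<integral>\<^sup>+x. f x \<partial>lborel)"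
proof -
  have "(\<integral>\<^sup>+x. f x \<partial>lborel) = (\<integral>\<^sup>+x. f x \<partial>distr lborel borel ((+) (- a)))"
    by (simp only: lborel_distr_plus)
  also have "\<dots> = (\<integral>\<^sup>+x. f (x - a) \<partial>lborel)"
    using assms by (subst nn_integral_distr) auto
  finally show ?thesis by simp
qed

lemma dir_conv_integrable_pair:
  fixes p :: "complex ^ 'n::finite \<Rightarrow> complex"
  assumes p: "integrable lborel p" and \<kappa>: "integrable lborel \<kappa>"
  shows "integrable (lborel \<Otimes>\<^sub>M lborel) (\<lambda>(\<zeta>, z). \<kappa> \<zeta> * p (z - axis a \<zeta>))"
proof (rule lborel_pair.Fubini_integrable)
  have [measurable]: "p \<in> borel_measurable borel" "\<kappa> \<in> borel_measurable borel" using p \<kappa> by auto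
  show "(\<lambda>(\<zeta>, z). \<kappa> \<zeta> * p (z - axis a \<zeta>)) \<in> borel_measurable (lborel \<Otimes>\<^sub>M lborel)"
    by measurable
  have eq: "(LINT z|lborel. norm (p (z - axis a \<zeta>))) = (LINT z|lborel. norm (p z))" for \<zeta>
    using lborel_integral_translate[of "\<lambda>z. norm (p z)" "- axis a \<zeta>"] by (simp add: add.commute)
  have "integrable lborel (\<lambda>\<zeta>. norm (\<kappa> \<zeta>) * (LINT z|lborel. norm (p z)))"
    using \<kappa> by simp
  then show "integrable lborel (\<lambda>\<zeta>. LINT z|lborel. norm (case (\<zeta>, z) of (\<zeta>, z) \<Rightarrow> \<kappa> \<zeta> * p (z - axis a \<zeta>)))"
    by (simp add: norm_mult eq)
  show "AE \<zeta> in lborel. integrable lborel (\<lambda>z. case (\<zeta>, z) of (\<zeta>, z) \<Rightarrow> \<kappa> \<zeta> * p (z - axis a \<zeta>))"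
  proof (rule AE_I2)
    fix \<zeta>
    have "integrable lborel (\<lambda>z. p (z - axis a \<zeta>))"
      using lborel_integrable_translate[OF p, of "- axis a \<zeta>"] by (simp add: add.commute)
    then show "integrable lborel (\<lambda>z. case (\<zeta>, z) of (\<zeta>, z) \<Rightarrow> \<kappa> \<zeta> * p (z - axis a \<zeta>))" by simp
  qed
qed

lemma dir_conv_integrable:
  fixes p :: "complex ^ 'n::finite \<Rightarrow> complex"
  assumes p: "integrable lborel p" and \<kappa>: "integrable lborel \<kappa>"
  shows "integrable lborel (dir_conv \<kappa> a p)"
  using lborel_pair.integrable_snd[OF dir_conv_integrable_pair[OF assms, where a = a]]
  by (simp add: dir_conv_def[abs_def])

lemma integrable_pair_mult_bounded:
  fixes F :: "'a::euclidean_space \<times> 'b::euclidean_space \<Rightarrow> complex"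
  assumes F: "integrable (lborel \<Otimes>\<^sub>M lborel) F" and "G \<in> borel_measurable (lborel \<Otimes>\<^sub>M lborel)"
    and "\<And>x. norm (G x) \<le> B"
  shows "integrable (lborel \<Otimes>\<^sub>M lborel) (\<lambda>x. F x * G x)"
proof (rule Bochner_Integration.integrable_bound)
  show "integrable (lborel \<Otimes>\<^sub>M lborel) (\<lambda>x. norm (F x) * B)" using F by simp
  show "(\<lambda>x. F x * G x) \<in> borel_measurable (lborel \<Otimes>\<^sub>M lborel)" using F assms(2) by measurable
  have "0 \<le> B" using assms(3) norm_ge_zero order_trans by blast
  then show "AE x in lborel \<Otimes>\<^sub>M lborel. norm (F x * G x) \<le> norm (norm (F x) * B)"
    using assms(3) by (auto simp: norm_mult mult_left_mono)
qed

lemma dir_conv_adjoint: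
  fixes p :: "complex ^ 'n::finite \<Rightarrow> complex"
  assumes p: "integrable lborel p" and \<kappa>: "integrable lborel \<kappa>" and \<phi>: "test_on U \<phi>"
  shows "(LINT z|lborel. dir_conv \<kappa> a p z * \<phi> z) = (LINT z|lborel. p z * dir_avg \<kappa> a \<phi> z)"
proof -
  obtain B where B: "B > 0" "\<And>x. norm (\<phi> x) \<le> B"
    using \<phi> by (rule test_on_bounded) (rule that)
  have [measurable]: "p \<in> borel_measurable borel" "\<kappa> \<in> borel_measurable borel" "\<phi> \<in> borel_measurable borel"
    using p \<kappa> smooth_measurable[OF test_on_smooth[OF \<phi>]] by auto
  have 1: "integrable (lborel \<Otimes>\<^sub>M lborel) (\<lambda>(\<zeta>, z). \<kappa> \<zeta> * p (z - axis a \<zeta>) * \<phi> z)"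
    using integrable_pair_mult_bounded[OF dir_conv_integrable_pair[OF p \<kappa>, where a = a], of "\<lambda>x. \<phi> (snd x)" B] B(2)
    by (simp add: split_beta')
  have "integrable (lborel \<Otimes>\<^sub>M lborel) (\<lambda>(\<zeta>, z). \<kappa> \<zeta> * p z)"
    by (rule lborel_pair.Fubini_integrable) (use p \<kappa> in \<open>auto simp: norm_mult\<close>)
  from integrable_pair_mult_bounded[OF this, of "\<lambda>x. \<phi> (snd x + axis a (fst x))" B]
  have 2: "integrable (lborel \<Otimes>\<^sub>M lborel) (\<lambda>(\<zeta>, z). \<kappa> \<zeta> * p z * \<phi> (z + axis a \<zeta>))"
    using B(2) by (simp add: split_beta')
  have "(LINT z|lborel. dir_conv \<kappa> a p z * \<phi> z) = (LINT z|lborel. LINT \<zeta>|lborel. \<kappa> \<zeta> * p (z - axis a \<zeta>) * \<phi> z)"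
    unfolding dir_conv_def by (simp only: integral_mult_left_zero)
  also have "\<dots> = (LINT \<zeta>|lborel. LINT z|lborel. \<kappa> \<zeta> * p (z - axis a \<zeta>) * \<phi> z)"
    by (rule lborel_pair.Fubini_integral[OF 1])
  also have "\<dots> = (LINT \<zeta>|lborel. LINT z|lborel. \<kappa> \<zeta> * p z * \<phi> (z + axis a \<zeta>))"
  proof (rule Bochner_Integration.integral_cong)
    fix \<zeta>
    show "(LINT z|lborel. \<kappa> \<zeta> * p (z - axis a \<zeta>) * \<phi> z) = (LINT z|lborel. \<kappa> \<zeta> * p z * \<phi> (z + axis a \<zeta>))"
      using lborel_integral_translate[of "\<lambda>z. \<kappa> \<zeta> * p (z - axis a \<zeta>) * \<phi> z" "axis a \<zeta>"]
      by (simp add: add.commute)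
  qed simp
  also have "\<dots> = (LINT z|lborel. LINT \<zeta>|lborel. \<kappa> \<zeta> * p z * \<phi> (z + axis a \<zeta>))"
    by (rule lborel_pair.Fubini_integral[OF 2, symmetric])
  also have "\<dots> = (LINT z|lborel. p z * dir_avg \<kappa> a \<phi> z)"
  proof (rule Bochner_Integration.integral_cong)
    fix z
    have "(LINT \<zeta>|lborel. \<kappa> \<zeta> * p z * \<phi> (z + axis a \<zeta>)) = (LINT \<zeta>|lborel. p z * (\<kappa> \<zeta> * \<phi> (z + axis a \<zeta>)))"
      by (simp only: mult_ac)
    then show "(LINT \<zeta>|lborel. \<kappa> \<zeta> * p z * \<phi> (z + axis a \<zeta>)) = p z * dir_avg \<kappa> a \<phi> z"
      by (simp only: integral_mult_right_zero dir_avg_def)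
  qed simp
  finally show ?thesis .
qed

text \<open>Young's inequality: by Cauchy--Schwarz with respect to the weight \<open>|\<kappa>|\<close>, the square of the
  convolution is at most \<open>\<parallel>\<kappa>\<parallel>\<^sub>1\<close> times the convolution of \<open>|\<kappa>|\<close> with \<open>|p|\<^sup>2\<close>.\<close>

lemma dir_conv_L2:
  fixes p :: "complex ^ 'n::finite \<Rightarrow> complex"
  assumes p: "integrable lborel p" and p2: "integrable lborel (\<lambda>z. (norm (p z))\<^sup>2)"
    and \<kappa>: "integrable lborel \<kappa>"
  shows "integrable lborel (\<lambda>z. (norm (dir_conv \<kappa> a p z))\<^sup>2)"
proof (rule integrableI_bounded)
  have [measurable]: "p \<in> borel_measurable borel" "\<kappa> \<in> borel_measurable borel" "dir_conv \<kappa> a p \<in> borel_measurable borel"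
    using p \<kappa> dir_conv_integrable[OF p \<kappa>, of a] by auto
  show "(\<lambda>z. (norm (dir_conv \<kappa> a p z))\<^sup>2) \<in> borel_measurable lborel" by simp
  define k where "k \<zeta> = ennreal (norm (\<kappa> \<zeta>))" for \<zeta>
  define A where "A = (\<integral>\<^sup>+\<zeta>. k \<zeta> \<partial>lborel)"
  have A: "A < \<infinity>" unfolding A_def k_def using \<kappa> by (simp add: integrable_iff_bounded)
  have [measurable]: "k \<in> borel_measurable borel" unfolding k_def by measurable
  let ?P = "\<lambda>z. ennreal ((norm (p z))\<^sup>2)"
  have pt: "ennreal ((norm (dir_conv \<kappa> a p z))\<^sup>2) \<le> A * (\<integral>\<^sup>+\<zeta>. k \<zeta> * ?P (z - axis a \<zeta>) \<partial>lborel)" for z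
  proof -
    let ?s = "\<lambda>\<zeta>. ennreal (sqrt (norm (\<kappa> \<zeta>)))"
    have s2: "(?s \<zeta>)\<^sup>2 = k \<zeta>" for \<zeta> by (simp add: k_def ennreal_power)
    have "ennreal (norm (dir_conv \<kappa> a p z)) \<le> (\<integral>\<^sup>+\<zeta>. norm (\<kappa> \<zeta> * p (z - axis a \<zeta>)) \<partial>lborel)"
    proof (cases "integrable lborel (\<lambda>\<zeta>. \<kappa> \<zeta> * p (z - axis a \<zeta>))")
      case True
      then show ?thesis unfolding dir_conv_def by (rule integral_norm_bound_ennreal)
    next
      case False
      then show ?thesis by (simp add: dir_conv_def not_integrable_integral_eq)
    qed
    also have "\<dots> = (\<integral>\<^sup>+\<zeta>. ?s \<zeta> * (?s \<zeta> * norm (p (z - axis a \<zeta>))) \<partial>lborel)"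
      by (intro nn_integral_cong) (simp add: norm_mult ennreal_mult'[symmetric] mult.assoc[symmetric])
    finally have "(ennreal (norm (dir_conv \<kappa> a p z)))\<^sup>2
        \<le> (\<integral>\<^sup>+\<zeta>. ?s \<zeta> * (?s \<zeta> * norm (p (z - axis a \<zeta>))) \<partial>lborel)\<^sup>2"
      by (rule power_mono) simp
    also have "\<dots> \<le> (\<integral>\<^sup>+\<zeta>. (?s \<zeta>)\<^sup>2 \<partial>lborel) * (\<integral>\<^sup>+\<zeta>. (?s \<zeta> * norm (p (z - axis a \<zeta>)))\<^sup>2 \<partial>lborel)"
      by (rule Cauchy_Schwarz_nn_integral) measurable
    also have "\<dots> = A * (\<integral>\<^sup>+\<zeta>. k \<zeta> * ?P (z - axis a \<zeta>) \<partial>lborel)"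
      by (simp add: s2 A_def power_mult_distrib ennreal_power)
    finally show ?thesis by (simp add: ennreal_power)
  qed
  have "(\<integral>\<^sup>+z. ennreal (norm ((norm (dir_conv \<kappa> a p z))\<^sup>2)) \<partial>lborel)
      \<le> (\<integral>\<^sup>+z. A * (\<integral>\<^sup>+\<zeta>. k \<zeta> * ?P (z - axis a \<zeta>) \<partial>lborel) \<partial>lborel)"
    by (intro nn_integral_mono) (use pt in simp)
  also have "\<dots> = A * (\<integral>\<^sup>+z. \<integral>\<^sup>+\<zeta>. k \<zeta> * ?P (z - axis a \<zeta>) \<partial>lborel \<partial>lborel)"
    by (rule nn_integral_cmult) measurable
  also have "(\<integral>\<^sup>+z. \<integral>\<^sup>+\<zeta>. k \<zeta> * ?P (z - axis a \<zeta>) \<partial>lborel \<partial>lborel)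
      = (\<integral>\<^sup>+\<zeta>. \<integral>\<^sup>+z. k \<zeta> * ?P (z - axis a \<zeta>) \<partial>lborel \<partial>lborel)"
    by (rule lborel_pair.Fubini'[where f = "\<lambda>\<zeta> z. k \<zeta> * ?P (z - axis a \<zeta>)"]) measurable
  also have "\<dots> = (\<integral>\<^sup>+\<zeta>. k \<zeta> * (\<integral>\<^sup>+z. ?P z \<partial>lborel) \<partial>lborel)"
    by (intro nn_integral_cong) (simp add: nn_integral_cmult nn_integral_lborel_translate[of ?P])
  also have "\<dots> = A * (\<integral>\<^sup>+z. ?P z \<partial>lborel)"
    by (simp add: nn_integral_multc A_def)
  finally have "(\<integral>\<^sup>+z. ennreal (norm ((norm (dir_conv \<kappa> a p z))\<^sup>2)) \<partial>lborel) \<le> A * (A * (\<integral>\<^sup>+z. ?P z \<partial>lborel))" .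
  also have "\<dots> < \<infinity>"
    using A p2 by (simp add: integrable_iff_bounded ennreal_mult_less_top)
  finally show "(\<integral>\<^sup>+z. ennreal (norm ((norm (dir_conv \<kappa> a p z))\<^sup>2)) \<partial>lborel) < \<infinity>" .
qed

section \<open>Functions orthogonal to all test functions\<close>

text \<open>The indicator function of \<open>C\<close> is a bounded pointwise limit of cutoff functions supported in
  shrinking neighbourhoods of \<open>C\<close>.\<close>

lemma integral_compact_zero:
  fixes w :: "'a::euclidean_space \<Rightarrow> complex"
  assumes w: "integrable lborel w" and D: "open D"
    and zero: "\<And>\<phi>. test_on D \<phi> \<Longrightarrow> (LINT x|lborel. w x * \<phi> x) = 0"
    and C: "compact C" "C \<subseteq> D"
  shows "(LINT x:C|lborel. w x) = 0"
proof (cases "C = {}")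
  case False
  define V where "V n = D \<inter> {x. infdist x C < inverse (real (Suc n))}" for n
  have "open (V n)" for n unfolding V_def
    by (intro open_Int D open_Collect_less continuous_intros)
  moreover have "C \<subseteq> V n" for n using C(2) by (auto simp: V_def)
  ultimately have "\<exists>h :: 'a \<Rightarrow> real. smooth h \<and> (\<forall>x. 0 \<le> h x \<and> h x \<le> 1) \<and> (\<forall>x\<in>C. h x = 1)
      \<and> compact (closure {x. h x \<noteq> 0}) \<and> closure {x. h x \<noteq> 0} \<subseteq> V n" for n
    by (rule smooth_cutoff[OF C(1)]) blast
  then obtain h :: "nat \<Rightarrow> 'a \<Rightarrow> real" where h: "\<And>n. smooth (h n)" "\<And>n x. 0 \<le> h n x \<and> h n x \<le> 1"
    "\<And>n x. x \<in> C \<Longrightarrow> h n x = 1" "\<And>n. compact (closure {x. h n x \<noteq> 0})" "\<And>n. closure {x. h n x \<noteq> 0} \<subseteq> V n"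
    by metis
  have t: "test_on D (\<lambda>x. complex_of_real (h n x))" for n
    using h(1,4,5)[of n] by (auto simp: test_on_def V_def intro: smooth_of_real)
  have [measurable]: "C \<in> sets borel" using C(1) by (rule borel_compact)
  have [measurable]: "w \<in> borel_measurable borel" using w by simp
  have [measurable]: "(\<lambda>x. complex_of_real (h n x)) \<in> borel_measurable borel" for n
    by (rule smooth_measurable[OF test_on_smooth[OF t]])
  have "(\<lambda>n. LINT x|lborel. w x * complex_of_real (h n x)) \<longlonglongrightarrow> (LINT x|lborel. indicator C x *\<^sub>R w x)"
  proof (rule integral_dominated_convergence)
    show "integrable lborel (\<lambda>x. norm (w x))" using w by simp
    show "AE x in lborel. (\<lambda>n. w x * complex_of_real (h n x)) \<longlonglongrightarrow> indicator C x *\<^sub>R w x"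
    proof (rule AE_I2)
      fix x
      show "(\<lambda>n. w x * complex_of_real (h n x)) \<longlonglongrightarrow> indicator C x *\<^sub>R w x"
      proof (cases "x \<in> C")
        case True
        then show ?thesis by (simp add: h(3))
      next
        case nC: False
        then have "infdist x C > 0"
          using infdist_pos_not_in_closed[OF compact_imp_closed[OF C(1)] False] by simp
        then obtain N where N: "inverse (real (Suc N)) < infdist x C"
          using reals_Archimedean by blast
        have "w x * complex_of_real (h n x) = 0" if "n \<ge> N" for n
        proof -
          have "inverse (real (Suc n)) \<le> inverse (real (Suc N))" using that by (simp add: field_simps)
          then have "\<not> infdist x C < inverse (real (Suc n))" using N by linarith
          then have "x \<notin> V n" by (simp add: V_def del: of_nat_Suc)
          then have "h n x = 0" using h(5)[of n] closure_subset[of "{x. h n x \<noteq> 0}"] by auto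
          then show ?thesis by simp
        qed
        then have "eventually (\<lambda>n. w x * complex_of_real (h n x) = 0) sequentially"
          by (auto simp: eventually_sequentially)
        then show ?thesis using nC by (simp add: tendsto_eventually)
      qed
    qed
    show "AE x in lborel. norm (w x * complex_of_real (h n x)) \<le> norm (w x)" for n
      using h(2) by (auto simp: norm_mult mult_left_le)
  qed simp_all
  then show ?thesis by (simp add: zero[OF t] set_lebesgue_integral_def LIMSEQ_const_iff)
qed (simp add: set_lebesgue_integral_def)

text \<open>The du Bois-Reymond lemma. Integrals over compact subsets of \<open>D\<close> vanish; the closed sets being an
  intersection-stable generator, so do the integrals over all Borel subsets of a compact subset.\<close>

lemma AE_zero_if_orthogonal_to_test:
  fixes w :: "'a::euclidean_space \<Rightarrow> complex"
  assumes w: "integrable lborel w" and D: "open D"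
    and zero: "\<And>\<phi>. test_on D \<phi> \<Longrightarrow> (LINT x|lborel. w x * \<phi> x) = 0"
  shows "AE x in lborel. x \<in> D \<longrightarrow> w x = 0"
proof -
  have C: "AE x in lborel. indicator C x *\<^sub>R w x = 0" if C: "compact C" "C \<subseteq> D" for C
  proof (rule sigma_finite_measure.density_zero[OF sigma_finite_lborel])
    have [measurable]: "C \<in> sets borel" using C(1) by (rule borel_compact)
    let ?w = "\<lambda>x. indicator C x *\<^sub>R w x"
    show int: "integrable lborel ?w"
      using w by (intro integrable_mult_indicator) auto
    have cl: "set_lebesgue_integral lborel A ?w = 0" if "closed A" for A
    proof -
      have "set_lebesgue_integral lborel A ?w = set_lebesgue_integral lborel (A \<inter> C) w"
        unfolding set_lebesgue_integral_def
        by (rule Bochner_Integration.integral_cong) (auto simp: indicator_def)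
      also have "\<dots> = 0"
        by (rule integral_compact_zero[OF w D zero]) (use C that in \<open>auto intro: closed_Int_compact\<close>)
      finally show ?thesis .
    qed
    have si: "set_integrable lborel A ?w" if "A \<in> sets borel" for A
      unfolding set_integrable_def using w C(1) that by (intro integrable_mult_indicator) (auto intro: borel_compact)
    fix A assume "A \<in> sets (lborel :: 'a measure)"
    then have A: "A \<in> sigma_sets UNIV (Collect closed)" using borel_eq_closed by (metis sets_lborel sets_measure_of Pow_UNIV subset_UNIV)
    have "Int_stable (Collect closed :: 'a set set)" by (auto simp: Int_stable_def)
    moreover have "(Collect closed :: 'a set set) \<subseteq> Pow UNIV" by simp
    ultimately show "set_lebesgue_integral lborel A ?w = 0" using A
    proof (induction rule: sigma_sets_induct_disjoint)
      case (basic A)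
      then show ?case using cl by simp
    next
      case empty
      then show ?case by (simp add: set_lebesgue_integral_def)
    next
      case (compl A)
      then have A: "A \<in> sets borel" using borel_eq_closed by (metis sets_measure_of Pow_UNIV subset_UNIV)
      have "set_lebesgue_integral lborel (A \<union> (UNIV - A)) ?w
          = set_lebesgue_integral lborel A ?w + set_lebesgue_integral lborel (UNIV - A) ?w"
        by (rule set_integral_Un) (use A in \<open>auto intro!: si\<close>)
      moreover have "set_lebesgue_integral lborel (A \<union> (UNIV - A)) ?w = 0"
        using cl[of UNIV] by simp
      ultimately show ?case using compl by simp
    next
      case (union A)
      then have A: "A i \<in> sets borel" for i using borel_eq_closed by (metis range_subsetD sets_measure_of Pow_UNIV subset_UNIV)
      have "set_lebesgue_integral lborel (\<Union>i. A i) ?w = (\<Sum>i. set_lebesgue_integral lborel (A i) ?w)"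
        by (rule lebesgue_integral_countable_add)
          (use A union in \<open>auto intro!: si simp: disjoint_family_on_def\<close>)
      then show ?case using union by simp
    qed
  qed
  obtain C where C': "\<And>n::nat. compact (C n)" "\<And>n. C n \<subseteq> D" "\<Union> (range C) = D"
    using open_Union_compact_subsets[OF D] by metis
  have "AE x in lborel. \<forall>n. indicator (C n) x *\<^sub>R w x = 0"
    unfolding AE_all_countable using C[OF C'(1,2)] by blast
  then show ?thesis
  proof eventually_elim
    case (elim x)
    show ?case
    proof
      assume "x \<in> D"
      then obtain n where "x \<in> C n" using C'(3) by blast
      with elim show "w x = 0" by (auto simp: indicator_def split: if_splits dest: spec[of _ n])
    qed
  qed
qed

section \<open>Cauchy transforms on lines missing the compact set\<close>

lemma test_on_mult_Int:
  fixes \<phi> \<psi> :: "'a::euclidean_space \<Rightarrow> complex"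
  assumes "test_on U \<phi>" "test_on V \<psi>"
  shows "test_on (U \<inter> V) (\<lambda>x. \<phi> x * \<psi> x)"
proof -
  obtain S where S: "compact S" "S \<subseteq> U" "\<And>x. \<phi> x \<noteq> 0 \<Longrightarrow> x \<in> S"
    using assms(1) by (rule test_on_support) (rule that)
  obtain R where R: "compact R" "R \<subseteq> V" "\<And>x. \<psi> x \<noteq> 0 \<Longrightarrow> x \<in> R"
    using assms(2) by (rule test_on_support) (rule that)
  show ?thesis
    by (rule test_onI[OF smooth_mult[OF test_on_smooth[OF assms(1)] test_on_smooth[OF assms(2)]], of "S \<inter> R"])
      (use S R in \<open>auto intro!: compact_Int\<close>)
qed

lemma test_on_Diff:
  fixes \<phi> :: "'a::euclidean_space \<Rightarrow> complex"
  assumes "test_on U \<phi>" "open W" "K \<subseteq> W" "\<And>x. x \<in> W \<Longrightarrow> \<phi> x = 0"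
  shows "test_on (U - K) \<phi>"
proof -
  obtain S where S: "compact S" "S \<subseteq> U" "\<And>x. \<phi> x \<noteq> 0 \<Longrightarrow> x \<in> S"
    using assms(1) by (rule test_on_support) (rule that)
  show ?thesis
    by (rule test_onI[OF test_on_smooth[OF assms(1)], of "S - W"])
      (use assms S in \<open>auto intro!: compact_diff\<close>)
qed

definition polydisc :: "real \<Rightarrow> (complex ^ 'n::finite) set" where
  "polydisc M = {z. \<forall>k. norm (z $ k) < M}"

lemma polydisc_mono: "r \<le> s \<Longrightarrow> polydisc r \<subseteq> polydisc s"
  unfolding polydisc_def by (auto intro: less_le_trans)

lemma open_polydisc: "open (polydisc M :: (complex ^ 'n::finite) set)"
proof -
  have "polydisc M = (\<Inter>k. {z :: complex ^ 'n. norm (z $ k) < M})" by (auto simp: polydisc_def)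
  also have "open \<dots>" by (intro open_INT ballI open_Collect_less continuous_intros) simp
  finally show ?thesis .
qed

text \<open>\<open>Va\<close> and \<open>Vb\<close> cover the complement of \<open>KK\<close> and are unions of lines in direction \<open>a\<close> and \<open>b\<close>
  respectively, which is how the product structure enters the construction of the two local
  solutions. The radius \<open>R\<close> is at least the diameter \<open>2 * M\<close> of every coordinate projection of the
  polydisc carrying all supports, so that inside the polydisc the truncated kernel acts like the full
  Cauchy kernel.\<close>

locale hartogs_setup =
  fixes Om KK Va Vb W :: "(complex ^ 'n::finite) set" and a b :: 'n
    and \<rho> :: "complex \<Rightarrow> complex" and cut :: "complex ^ 'n \<Rightarrow> complex" and M R :: real
  assumes Va: "open Va" "Va \<inter> KK = {}" "\<And>z \<zeta>. z \<in> Va \<Longrightarrow> z + axis a \<zeta> \<in> Va"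
    and Vb: "open Vb" "Vb \<inter> KK = {}" "\<And>z \<zeta>. z \<in> Vb \<Longrightarrow> z + axis b \<zeta> \<in> Vb"
    and Vab: "Va \<union> Vb = - KK" and ab: "a \<noteq> b"
    and cut: "test_on Om cut" "open W" "KK \<subseteq> W" "\<And>z. z \<in> W \<Longrightarrow> cut z = 1"
    and M: "M > 0" "Om \<subseteq> polydisc M"
    and \<rho>: "test_on (ball 0 (2 * R)) \<rho>" "\<And>\<zeta>. norm \<zeta> < R \<Longrightarrow> \<rho> \<zeta> = 1" and R: "2 * M \<le> R"
begin

abbreviation "\<kappa> \<equiv> cauchy_kernel \<rho>"
abbreviation "T \<equiv> dir_avg \<kappa>"
abbreviation "dcut k \<equiv> dzbar k cut"

lemma kernel: "integrable lborel \<kappa>" "\<And>\<zeta>. \<kappa> \<zeta> \<noteq> 0 \<Longrightarrow> \<zeta> \<in> cball 0 (2 * R)"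
proof -
  show "integrable lborel \<kappa>" by (rule cauchy_kernel_integrable[OF \<rho>(1)])
  show "\<zeta> \<in> cball 0 (2 * R)" if "\<kappa> \<zeta> \<noteq> 0" for \<zeta>
    using that test_on_zero_outside[OF \<rho>(1), of \<zeta>] by (cases "\<zeta> \<in> ball 0 (2 * R)") (auto simp: cauchy_kernel_def)
qed

lemma T_test: 
  assumes "test_on U \<phi>" "\<And>z \<zeta>. z \<in> U \<Longrightarrow> norm \<zeta> \<le> 2 * R \<Longrightarrow> z - axis j \<zeta> \<in> V"
  shows "test_on V (T j \<phi>)"
  by (rule dir_avg_test[OF assms(1) kernel(1) compact_cball kernel(2)]) (use assms(2) in auto)

lemma T_test_UNIV: "test_on U \<phi> \<Longrightarrow> test_on UNIV (T j \<phi>)"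
  by (erule T_test) simp

lemma axis_diff: "z - axis j \<zeta> = z + axis j (- \<zeta>)" for z :: "complex ^ 'n"
  by (simp add: vec_eq_iff axis_def)

text \<open>The averages in direction \<open>a\<close> of a test function on \<open>Va\<close> are test functions on \<open>Va\<close>: this is where
  it matters that the lines in direction \<open>a\<close> through points of \<open>Va\<close> stay away from \<open>KK\<close>.\<close>

lemma T_test_Va: "test_on Va \<phi> \<Longrightarrow> test_on Va (T a \<phi>)"
  by (erule T_test) (simp add: axis_diff Va(3))

lemma T_test_Vb: "test_on Vb \<phi> \<Longrightarrow> test_on Vb (T b \<phi>)"
  by (erule T_test) (simp add: axis_diff Vb(3))

lemma dzbar_T: "test_on U \<phi> \<Longrightarrow> T j (dzbar k \<phi>) = dzbar k (T j \<phi>)"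
  by (rule ext) (simp add: dir_avg_dzbar[OF _ kernel(1)])

lemma dzbar_T_same:
  assumes "test_on U \<phi>" "\<And>z. \<phi> z \<noteq> 0 \<Longrightarrow> norm (z $ j) < M" "norm (z $ j) < M"
  shows "dzbar j (T j \<phi>) z = \<phi> z"
proof (rule dir_avg_cauchy_kernel[OF assms(1) \<rho>])
  show "R > 0" using M R by simp
  fix \<zeta> :: complex assume \<zeta>: "R \<le> norm \<zeta>"
  have "norm \<zeta> \<le> norm (z $ j + \<zeta>) + norm (z $ j)"
    using norm_triangle_ineq4[of "z $ j + \<zeta>" "z $ j"] by simp
  then have "\<not> norm ((z + axis j \<zeta>) $ j) < M"
    using \<zeta> R assms(3) by (simp add: axis_def)
  then show "\<phi> (z + axis j \<zeta>) = 0" using assms(2) by blast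
qed

lemma cut_polydisc: "cut z \<noteq> 0 \<Longrightarrow> z \<in> polydisc M" "dcut k z \<noteq> 0 \<Longrightarrow> z \<in> polydisc M"
  using test_on_zero_outside[OF cut(1), of z] test_on_zero_outside[OF test_on_dzbar[OF cut(1)], of z] M(2) by blast+

text \<open>The cutoff is constant near \<open>KK\<close>, so its derivatives are supported in \<open>Om - KK\<close>; multiplied by
  any smooth function they are admissible in the closedness condition of a form on \<open>Om - KK\<close>.\<close>

lemma dcut_test: "test_on (Om - KK) (dcut k)"
  by (rule test_on_Diff[OF test_on_dzbar[OF cut(1)] cut(2,3)])
    (use cut(2,4) in \<open>simp add: dzbar_cong_open[of W _ cut "\<lambda>_. 1"] dzbar_const\<close>)

lemma cut_smooth: "smooth cut" "smooth (dcut k)"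
  using cut(1) by (auto intro: test_on_smooth smooth_dzbar)

lemma cut_mult_Va: "test_on Va \<psi> \<Longrightarrow> test_on (Om - KK) (\<lambda>z. cut z * \<psi> z)"
  by (rule test_on_mono[OF test_on_mult_Int[OF cut(1)]]) (use Va(2) in auto)

lemma cut_mult_Vb: "test_on Vb \<psi> \<Longrightarrow> test_on (Om - KK) (\<lambda>z. cut z * \<psi> z)"
  by (rule test_on_mono[OF test_on_mult_Int[OF cut(1)]]) (use Vb(2) in auto)

lemma dcut_mult: "smooth \<psi> \<Longrightarrow> test_on (Om - KK) (\<lambda>z. dcut k z * \<psi> z)"
  using test_on_mult[OF dcut_test] by (simp add: mult.commute)

lemma nz_polydisc: "test_on (polydisc M) \<phi> \<Longrightarrow> \<phi> z \<noteq> 0 \<Longrightarrow> norm (z $ k) < M"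
  using test_on_zero_outside[of "polydisc M" \<phi> z] by (auto simp: polydisc_def)

lemma T_a_identity:
  assumes "test_on (polydisc M) \<phi>" "z \<in> polydisc M"
  shows "dzbar a (T a \<phi>) z = \<phi> z"
  by (rule dzbar_T_same[OF assms(1) nz_polydisc[OF assms(1)]]) (use assms(2) in \<open>auto simp: polydisc_def\<close>)

lemma T_b_identity:
  assumes "test_on (polydisc M) \<phi>" "norm (z $ b) < M"
  shows "dzbar b (T b \<phi>) z = \<phi> z"
  by (rule dzbar_T_same[OF assms(1) nz_polydisc[OF assms(1)] assms(2)])

text \<open>Averaging in direction \<open>b\<close> leaves the range of \<open>z\<^sub>a\<close> unchanged, so \<open>T b \<phi>\<close> can be treated like a
  function supported in the polydisc as far as the variable \<open>z\<^sub>a\<close> is concerned.\<close>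

lemma TaTb_identity_a:
  assumes \<phi>: "test_on (polydisc M) \<phi>" and z: "z \<in> polydisc M"
  shows "dzbar a (T a (T b \<phi>)) z = T b \<phi> z"
proof (rule dzbar_T_same[OF T_test_UNIV[OF \<phi>]])
  show "norm (z $ a) < M" using z by (simp add: polydisc_def)
  fix w assume nz: "T b \<phi> w \<noteq> 0"
  have "\<exists>\<zeta>. \<phi> (w + axis b \<zeta>) \<noteq> 0"
  proof (rule ccontr)
    assume "\<nexists>\<zeta>. \<phi> (w + axis b \<zeta>) \<noteq> 0"
    then have "T b \<phi> w = 0" unfolding dir_avg_def by simp
    with nz show False by simp
  qed
  then obtain \<zeta> where "\<phi> (w + axis b \<zeta>) \<noteq> 0" by blast
  from nz_polydisc[OF \<phi> this, of a] show "norm (w $ a) < M" using ab by (simp add: axis_def)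
qed

text \<open>The derivative in \<open>z\<^sub>b\<close> commutes with the average in direction \<open>a\<close>, which only sees values of
  \<open>T b \<phi>\<close> at points with the same coordinate \<open>z\<^sub>b\<close>.\<close>

lemma TaTb_identity_b:
  assumes \<phi>: "test_on (polydisc M) \<phi>" and z: "z \<in> polydisc M"
  shows "dzbar b (T a (T b \<phi>)) z = T a \<phi> z"
proof -
  have "dzbar b (T b \<phi>) (z + axis a \<zeta>) = \<phi> (z + axis a \<zeta>)" for \<zeta>
    by (rule T_b_identity[OF \<phi>]) (use z ab in \<open>simp add: polydisc_def axis_def\<close>)
  then show ?thesis
    unfolding dzbar_T[OF T_test_UNIV[OF \<phi>], symmetric] by (simp add: dir_avg_def)
qed

lemma cut_identities:
  assumes \<phi>: "test_on (polydisc M) \<phi>"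
  shows "cut z * dzbar a (T a \<phi>) z = cut z * \<phi> z"
    and "cut z * dzbar b (T b \<phi>) z = cut z * \<phi> z"
    and "dcut k z * dzbar a (T a \<phi>) z = dcut k z * \<phi> z"
    and "dcut k z * dzbar a (T a (T b \<phi>)) z = dcut k z * T b \<phi> z"
    and "dcut k z * dzbar b (T a (T b \<phi>)) z = dcut k z * T a \<phi> z"
proof -
  show "cut z * dzbar a (T a \<phi>) z = cut z * \<phi> z"
    using T_a_identity[OF \<phi>, of z] cut_polydisc(1)[of z] by (cases "cut z = 0") auto
  show "cut z * dzbar b (T b \<phi>) z = cut z * \<phi> z"
    using T_b_identity[OF \<phi>, of z] cut_polydisc(1)[of z]
    by (cases "cut z = 0") (auto simp: polydisc_def)
  show "dcut k z * dzbar a (T a \<phi>) z = dcut k z * \<phi> z"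
    "dcut k z * dzbar a (T a (T b \<phi>)) z = dcut k z * T b \<phi> z"
    "dcut k z * dzbar b (T a (T b \<phi>)) z = dcut k z * T a \<phi> z"
    using T_a_identity[OF \<phi>] TaTb_identity_a[OF \<phi>] TaTb_identity_b[OF \<phi>] cut_polydisc(2)[of k z]
    by (cases "dcut k z = 0"; simp)+
qed

end

text \<open>\<open>f\<close> is a closed form on \<open>Om - KK\<close>, extended to the whole space. Under the convention \<open>C\<^sub>a p =
  - dir_conv \<kappa> a p\<close>, the weak derivative of \<open>C\<^sub>a p\<close> in \<open>zbar\<^sub>a\<close> is \<open>p\<close> inside the polydisc if \<open>p\<close> is supported there, which explains the minus signs in
  the definitions below.\<close>

locale hartogs_form = hartogs_setup Om KK Va Vb W a b \<rho> cut M R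
  for Om KK Va Vb W :: "(complex ^ 'n::finite) set" and a b \<rho> cut M R +
  fixes f :: "complex ^ 'n \<Rightarrow> complex ^ 'n"
  assumes f_int: "\<And>h. integrable lborel (\<lambda>z. f z $ h)"
    and f_closed: "\<And>j k \<phi>. test_on (Om - KK) \<phi> \<Longrightarrow>
      (LINT z|lborel. f z $ k * dzbar j \<phi> z) = (LINT z|lborel. f z $ j * dzbar k \<phi> z)"
begin

definition I :: "'n \<Rightarrow> (complex ^ 'n \<Rightarrow> complex) \<Rightarrow> complex" where
  "I h \<phi> = (LINT z|lborel. f z $ h * \<phi> z)"

lemma I_add: "test_on U \<phi> \<Longrightarrow> test_on V \<psi> \<Longrightarrow> I h (\<lambda>z. \<phi> z + \<psi> z) = I h \<phi> + I h \<psi>"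
  by (simp add: I_def distrib_left integrable_mult_test[OF _ f_int])

lemma I_diff: "test_on U \<phi> \<Longrightarrow> test_on V \<psi> \<Longrightarrow> I h (\<lambda>z. \<phi> z - \<psi> z) = I h \<phi> - I h \<psi>"
  by (simp add: I_def right_diff_distrib integrable_mult_test[OF _ f_int])

lemma I_closed: "test_on (Om - KK) \<phi> \<Longrightarrow> I k (dzbar j \<phi>) = I j (dzbar k \<phi>)"
  unfolding I_def by (rule f_closed)

definition u_a :: "complex ^ 'n \<Rightarrow> complex" where
  "u_a z = - dir_conv \<kappa> a (\<lambda>z. f z $ a * cut z) z"

text \<open>The coefficients of \<open>dbar cut \<and> f\<close>, the failure of \<open>cut * f\<close> to be closed, at
  \<open>d(zbar\<^sub>a) \<and> d(zbar\<^sub>k)\<close>.\<close>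

definition g :: "'n \<Rightarrow> complex ^ 'n \<Rightarrow> complex" where
  "g k z = f z $ k * dcut a z - f z $ a * dcut k z"

text \<open>Integrating these coefficients in \<open>z\<^sub>a\<close> gives a primitive of \<open>dbar cut \<and> f\<close> on a large polydisc,
  including \<open>KK\<close>. Its coefficient at \<open>d(zbar\<^sub>a)\<close> is zero, since \<open>g a = 0\<close>.\<close>

definition G :: "'n \<Rightarrow> complex ^ 'n \<Rightarrow> complex" where
  "G k z = - dir_conv \<kappa> a (g k) z"

definition u_b :: "complex ^ 'n \<Rightarrow> complex" where
  "u_b z = - dir_conv \<kappa> b (\<lambda>z. f z $ b * cut z) z + dir_conv \<kappa> b (G b) z"

lemma int_fcut: "integrable lborel (\<lambda>z. f z $ h * cut z)"
  by (rule integrable_mult_test[OF cut(1) f_int])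

lemma int_g: "integrable lborel (g k)"
  unfolding g_def[abs_def]
  by (intro Bochner_Integration.integrable_diff integrable_mult_test[OF dcut_test f_int])

lemma int_G: "integrable lborel (G k)"
  unfolding G_def[abs_def] by (intro integrable_minus dir_conv_integrable int_g kernel(1))

lemma int_u_a: "integrable lborel u_a"
  unfolding u_a_def[abs_def] by (intro integrable_minus dir_conv_integrable int_fcut kernel(1))

lemma int_u_b: "integrable lborel u_b"
  unfolding u_b_def[abs_def]
  by (intro Bochner_Integration.integrable_add integrable_minus dir_conv_integrable int_fcut int_G kernel(1))

lemma g_pairing:
  assumes "test_on U \<psi>"
  shows "(LINT z|lborel. g k z * \<psi> z) = I k (\<lambda>z. dcut a z * \<psi> z) - I a (\<lambda>z. dcut k z * \<psi> z)"
proof -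
  have sm: "smooth \<psi>" by (rule test_on_smooth[OF assms])
  have "(LINT z|lborel. g k z * \<psi> z)
      = (LINT z|lborel. f z $ k * (dcut a z * \<psi> z) - f z $ a * (dcut k z * \<psi> z))"
    by (rule Bochner_Integration.integral_cong) (simp_all add: g_def algebra_simps)
  then show ?thesis
    by (simp add: I_def integrable_mult_test[OF dcut_mult[OF sm] f_int])
qed

lemma G_pairing:
  assumes "test_on U \<phi>"
  shows "(LINT z|lborel. G k z * \<phi> z)
    = - (I k (\<lambda>z. dcut a z * T a \<phi> z) - I a (\<lambda>z. dcut k z * T a \<phi> z))"
  using dir_conv_adjoint[OF int_g[of k] kernel(1) assms, of a] g_pairing[OF T_test_UNIV[OF assms], of k a]
  by (simp add: G_def)

lemma u_a_pairing:
  assumes "test_on U \<phi>"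
  shows "(LINT z|lborel. u_a z * \<phi> z) = - I a (\<lambda>z. cut z * T a \<phi> z)"
  using dir_conv_adjoint[OF int_fcut kernel(1) assms, of a a]
  by (simp add: u_a_def I_def mult.assoc)

lemma u_b_pairing:
  assumes "test_on U \<phi>"
  shows "(LINT z|lborel. u_b z * \<phi> z) = - I b (\<lambda>z. cut z * T b \<phi> z)
    - I b (\<lambda>z. dcut a z * T a (T b \<phi>) z) + I a (\<lambda>z. dcut b z * T a (T b \<phi>) z)"
proof -
  have "(LINT z|lborel. u_b z * \<phi> z) = (LINT z|lborel. - (dir_conv \<kappa> b (\<lambda>z. f z $ b * cut z) z * \<phi> z) + dir_conv \<kappa> b (G b) z * \<phi> z)"
    by (simp add: u_b_def algebra_simps)
  also have "\<dots> = - (LINT z|lborel. dir_conv \<kappa> b (\<lambda>z. f z $ b * cut z) z * \<phi> z)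
      + (LINT z|lborel. dir_conv \<kappa> b (G b) z * \<phi> z)"
    by (subst Bochner_Integration.integral_add)
      (auto intro!: integrable_mult_test[OF assms] dir_conv_integrable int_fcut int_G kernel(1))
  also have "\<dots> = - (LINT z|lborel. f z $ b * cut z * T b \<phi> z) + (LINT z|lborel. G b z * T b \<phi> z)"
    by (simp only: dir_conv_adjoint[OF int_fcut kernel(1) assms] dir_conv_adjoint[OF int_G kernel(1) assms])
  finally show ?thesis
    unfolding G_pairing[OF T_test_UNIV[OF assms]] by (simp add: I_def mult.assoc)
qed

text \<open>After transposition the claim concerns \<open>cut * T a \<phi>\<close>, which is a test function on \<open>Om - KK\<close>; one
  application of closedness of \<open>f\<close> exchanges \<open>f\<^sub>a\<close> and \<open>f\<^sub>k\<close>.\<close>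

lemma dbar_u_a:
  assumes Va\<phi>: "test_on Va \<phi>" and \<phi>: "test_on (polydisc M) \<phi>"
  shows "- (LINT z|lborel. u_a z * dzbar k \<phi> z) = I k (\<lambda>z. cut z * \<phi> z) - (LINT z|lborel. G k z * \<phi> z)"
proof -
  let ?A = "T a \<phi>"
  have A: "test_on Va ?A" by (rule T_test_Va[OF Va\<phi>])
  have sA: "smooth ?A" by (rule test_on_smooth[OF A])
  have t: "test_on (Om - KK) (\<lambda>z. cut z * ?A z)" by (rule cut_mult_Va[OF A])
  have "- (LINT z|lborel. u_a z * dzbar k \<phi> z) = I a (\<lambda>z. cut z * dzbar k ?A z)"
    by (simp add: u_a_pairing[OF test_on_dzbar[OF \<phi>]] dzbar_T[OF \<phi>])
  also have "(\<lambda>z. cut z * dzbar k ?A z) = (\<lambda>z. dzbar k (\<lambda>z. cut z * ?A z) z - dcut k z * ?A z)"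
    by (simp add: dzbar_mult cut_smooth sA)
  also have "I a \<dots> = I k (dzbar a (\<lambda>z. cut z * ?A z)) - I a (\<lambda>z. dcut k z * ?A z)"
    by (simp add: I_diff[OF test_on_dzbar[OF t] dcut_mult[OF sA]] I_closed[OF t])
  also have "dzbar a (\<lambda>z. cut z * ?A z) = (\<lambda>z. dcut a z * ?A z + cut z * \<phi> z)"
    using T_a_identity[OF \<phi>] cut_polydisc(1) by (fastforce simp: dzbar_mult cut_smooth sA)
  also have "I k \<dots> = I k (\<lambda>z. dcut a z * ?A z) + I k (\<lambda>z. cut z * \<phi> z)"
    by (rule I_add[OF dcut_mult[OF sA] cut_mult_Va[OF Va\<phi>]])
  finally show ?thesis by (simp add: G_pairing[OF \<phi>])
qed

text \<open>Since \<open>u_b\<close> involves two successive Cauchy transforms, closedness of \<open>f\<close> has to be applied to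
  test functions built from \<open>E = T a (T b \<phi>)\<close>. The product \<open>cut * E\<close> itself may live on \<open>KK\<close>. Its
  derivative in \<open>zbar\<^sub>a\<close> does not: it equals \<open>\<tau>\<close>, since on the support of \<open>cut\<close> the derivative of \<open>E\<close>
  is \<open>T b \<phi>\<close>, a test function on \<open>Vb\<close>. The products \<open>\<sigma> k = dcut k * E\<close> are supported off \<open>KK\<close>
  because \<open>cut\<close> is constant near \<open>KK\<close>.\<close>

lemma dbar_u_b:
  assumes Vb\<phi>: "test_on Vb \<phi>" and \<phi>: "test_on (polydisc M) \<phi>"
  shows "- (LINT z|lborel. u_b z * dzbar k \<phi> z) = I k (\<lambda>z. cut z * \<phi> z) - (LINT z|lborel. G k z * \<phi> z)"
proof -
  let ?A = "T a \<phi>" and ?B = "T b \<phi>" and ?E = "T a (T b \<phi>)"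
  have B: "test_on Vb ?B" by (rule T_test_Vb[OF Vb\<phi>])
  have tests: "test_on UNIV ?A" "test_on UNIV ?B" "test_on UNIV ?E"
    using \<phi> by (auto intro!: T_test_UNIV)
  note sm = tests[THEN test_on_smooth]
  define \<tau> where "\<tau> z = cut z * ?B z + dcut a z * ?E z" for z
  define \<sigma> where "\<sigma> k z = dcut k z * ?E z" for k z
  have \<tau>: "test_on (Om - KK) \<tau>"
    unfolding \<tau>_def[abs_def] by (rule test_on_add[OF cut_mult_Vb[OF B] dcut_mult[OF sm(3)]])
  have \<sigma>: "test_on (Om - KK) (\<sigma> k)" for k
    unfolding \<sigma>_def[abs_def] by (rule dcut_mult[OF sm(3)])
  have d\<tau>: "dzbar k \<tau> z = dcut k z * ?B z + cut z * dzbar k ?B z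
      + (dzbar k (dcut a) z * ?E z + dcut a z * dzbar k ?E z)" for k z
    unfolding \<tau>_def[abs_def] by (simp add: dzbar_add dzbar_mult smooth_mult cut_smooth sm)
  have d\<sigma>: "dzbar j (\<sigma> k) z = dzbar j (dcut k) z * ?E z + dcut k z * dzbar j ?E z" for j k z
    unfolding \<sigma>_def[abs_def] by (simp add: dzbar_mult cut_smooth sm)
  have cutcomm: "dzbar j (dcut k) z = dzbar k (dcut j) z" for j k z
    by (rule dzbar_commute[OF cut_smooth(1)])
  have e1: "cut z * dzbar k ?B z + dcut a z * dzbar k ?E z = dzbar k \<tau> z - dzbar a (\<sigma> k) z" for z
    unfolding d\<tau> d\<sigma> cut_identities[OF \<phi>] by (simp add: cutcomm[of a k])
  have e2: "cut z * \<phi> z + dcut a z * ?A z = dzbar b \<tau> z - dzbar a (\<sigma> b) z" for z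
    unfolding d\<tau> d\<sigma> cut_identities[OF \<phi>] by (simp add: cutcomm[of a b])
  have e3: "dzbar b (\<sigma> k) z + dcut b z * dzbar k ?E z = dzbar k (\<sigma> b) z + dcut k z * ?A z" for z
    unfolding d\<sigma> cut_identities[OF \<phi>] by (simp add: cutcomm[of b k])
  have "- (LINT z|lborel. u_b z * dzbar k \<phi> z) = I b (\<lambda>z. cut z * dzbar k ?B z)
      + I b (\<lambda>z. dcut a z * dzbar k ?E z) - I a (\<lambda>z. dcut b z * dzbar k ?E z)"
    by (simp add: u_b_pairing[OF test_on_dzbar[OF \<phi>]] dzbar_T[OF \<phi>] dzbar_T[OF tests(2)])
  also have "\<dots> = I b (\<lambda>z. dzbar k \<tau> z - dzbar a (\<sigma> k) z) - I a (\<lambda>z. dcut b z * dzbar k ?E z)"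
    unfolding e1[symmetric]
    by (simp add: I_add[OF test_on_mult[OF test_on_dzbar[OF tests(2)] cut_smooth(1)]
          dcut_mult[OF smooth_dzbar[OF sm(3)]]])
  also have "\<dots> = I k (dzbar b \<tau>) - (I a (dzbar b (\<sigma> k)) + I a (\<lambda>z. dcut b z * dzbar k ?E z))"
    by (simp add: I_diff[OF test_on_dzbar[OF \<tau>] test_on_dzbar[OF \<sigma>]] I_closed[OF \<tau>, of b k] I_closed[OF \<sigma>, of b a])
  also have "I a (dzbar b (\<sigma> k)) + I a (\<lambda>z. dcut b z * dzbar k ?E z)
      = I a (dzbar k (\<sigma> b)) + I a (\<lambda>z. dcut k z * ?A z)"
    using I_add[OF test_on_dzbar[OF \<sigma>] dcut_mult[OF smooth_dzbar[OF sm(3)]], of a b k b k]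
      I_add[OF test_on_dzbar[OF \<sigma>] dcut_mult[OF sm(1)], of a k b k] e3 by simp
  also have "I a (dzbar k (\<sigma> b)) = I k (dzbar a (\<sigma> b))" by (rule I_closed[OF \<sigma>])
  finally have "- (LINT z|lborel. u_b z * dzbar k \<phi> z)
      = I k (\<lambda>z. cut z * \<phi> z + dcut a z * ?A z) - I a (\<lambda>z. dcut k z * ?A z)"
    unfolding e2 by (simp add: I_diff[OF test_on_dzbar[OF \<tau>] test_on_dzbar[OF \<sigma>]])
  then show ?thesis
    by (simp add: G_pairing[OF \<phi>] I_add[OF cut_mult_Vb[OF Vb\<phi>] dcut_mult[OF sm(1)]])
qed

text \<open>\<open>\<tau>\<close> and \<open>\<tau>'\<close> are the derivatives of \<open>cut * T a (T b \<phi>)\<close> in \<open>zbar\<^sub>a\<close> and \<open>zbar\<^sub>b\<close>, which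
  explains the relation between them. If \<open>f = dbar v\<close>, then \<open>I b \<tau>\<close> and \<open>I a \<tau>'\<close> are the pairings of \<open>- v\<close>
  with the two sides of that relation, and the obstruction vanishes.\<close>

lemma u_diff_pairing:
  assumes Va\<phi>: "test_on Va \<phi>" and Vb\<phi>: "test_on Vb \<phi>" and \<phi>: "test_on (polydisc M) \<phi>"
  obtains \<tau> \<tau>' where "test_on (Om - KK) \<tau>" "test_on (Om - KK) \<tau>'" "\<And>z. dzbar b \<tau> z = dzbar a \<tau>' z"
    "(LINT z|lborel. (u_a z - u_b z) * \<phi> z) = I b \<tau> - I a \<tau>'"
proof -
  let ?A = "T a \<phi>" and ?B = "T b \<phi>" and ?E = "T a (T b \<phi>)"
  have A: "test_on Va ?A" by (rule T_test_Va[OF Va\<phi>])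
  have B: "test_on Vb ?B" by (rule T_test_Vb[OF Vb\<phi>])
  have E: "test_on UNIV ?E" using \<phi> by (auto intro!: T_test_UNIV)
  note sm = A[THEN test_on_smooth] B[THEN test_on_smooth] E[THEN test_on_smooth]
  show thesis
  proof (rule that)
    show "test_on (Om - KK) (\<lambda>z. cut z * ?B z + dcut a z * ?E z)"
      by (rule test_on_add[OF cut_mult_Vb[OF B] dcut_mult[OF sm(3)]])
    show "test_on (Om - KK) (\<lambda>z. cut z * ?A z + dcut b z * ?E z)"
      by (rule test_on_add[OF cut_mult_Va[OF A] dcut_mult[OF sm(3)]])
    show "dzbar b (\<lambda>z. cut z * ?B z + dcut a z * ?E z) z = dzbar a (\<lambda>z. cut z * ?A z + dcut b z * ?E z) z" for z
      by (simp add: dzbar_add dzbar_mult smooth_mult cut_smooth sm cut_identities[OF \<phi>] dzbar_commute[OF cut_smooth(1), of b a])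
    have "(LINT z|lborel. (u_a z - u_b z) * \<phi> z) = (LINT z|lborel. u_a z * \<phi> z) - (LINT z|lborel. u_b z * \<phi> z)"
      by (simp add: left_diff_distrib integrable_mult_test[OF \<phi>] int_u_a int_u_b)
    then show "(LINT z|lborel. (u_a z - u_b z) * \<phi> z)
      = I b (\<lambda>z. cut z * ?B z + dcut a z * ?E z) - I a (\<lambda>z. cut z * ?A z + dcut b z * ?E z)"
      by (simp add: u_a_pairing[OF \<phi>] u_b_pairing[OF \<phi>] I_add[OF cut_mult_Vb[OF B] dcut_mult[OF sm(3)]]
          I_add[OF cut_mult_Va[OF A] dcut_mult[OF sm(3)]])
  qed
qed

text \<open>What remains of \<open>f\<close> after subtracting \<open>cut * f - G\<close>. Near \<open>KK\<close> it equals \<open>G\<close>, so it makes sense on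
  all of \<open>Om\<close>.\<close>

definition H :: "'n \<Rightarrow> complex ^ 'n \<Rightarrow> complex" where
  "H k z = f z $ k - f z $ k * cut z + G k z"

lemma H_pairing:
  assumes "test_on U \<phi>"
  shows "(LINT z|lborel. H k z * \<phi> z) = I k \<phi> - I k (\<lambda>z. cut z * \<phi> z) + (LINT z|lborel. G k z * \<phi> z)"
proof -
  have "(LINT z|lborel. H k z * \<phi> z)
      = (LINT z|lborel. f z $ k * \<phi> z - f z $ k * (cut z * \<phi> z) + G k z * \<phi> z)"
    by (rule Bochner_Integration.integral_cong) (simp_all add: H_def algebra_simps)
  then show ?thesis
    by (simp add: I_def integrable_mult_test[OF assms f_int] integrable_mult_test[OF assms int_G]
      integrable_mult_test[OF test_on_mult[OF assms cut_smooth(1)] f_int])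
qed

text \<open>A test function \<open>\<phi>\<close> on \<open>Om\<close> may live on \<open>KK\<close>, so closedness of \<open>f\<close> is applied to \<open>(1 - cut) * \<phi>\<close> and
  to the products \<open>dcut l * T a \<phi>\<close> instead. The pairing then becomes a sum of terms that are visibly
  symmetric in \<open>j\<close> and \<open>k\<close>.\<close>

lemma H_closed:
  assumes \<phi>: "test_on Om \<phi>"
  shows "(LINT z|lborel. H k z * dzbar j \<phi> z) = (LINT z|lborel. H j z * dzbar k \<phi> z)"
proof -
  let ?A = "T a \<phi>"
  have \<phi>': "test_on (polydisc M) \<phi>" by (rule test_on_mono[OF \<phi> M(2)])
  have A: "test_on UNIV ?A" by (rule T_test_UNIV[OF \<phi>])
  note sm = \<phi>[THEN test_on_smooth] A[THEN test_on_smooth]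
  define \<sigma> where "\<sigma> z = (1 - cut z) * \<phi> z" for z
  define \<theta> where "\<theta> l z = dcut l z * ?A z" for l z
  have \<sigma>: "test_on (Om - KK) \<sigma>"
    by (rule test_on_Diff[OF _ cut(2,3)])
      (use cut(4) in \<open>auto simp: \<sigma>_def[abs_def] intro!: test_on_mult[OF \<phi>] smooth_diff smooth_const cut_smooth\<close>)
  have \<theta>: "test_on (Om - KK) (\<theta> l)" for l
    unfolding \<theta>_def[abs_def] by (rule dcut_mult[OF sm(2)])
  have d\<sigma>: "dzbar j \<phi> z - cut z * dzbar j \<phi> z = dzbar j \<sigma> z + dcut j z * \<phi> z" for j z
  proof -
    have "dzbar j \<sigma> z = - dcut j z * \<phi> z + (1 - cut z) * dzbar j \<phi> z"
      unfolding \<sigma>_def[abs_def]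
      by (simp add: dzbar_mult dzbar_diff dzbar_const smooth_diff smooth_const cut_smooth sm)
    then show ?thesis by (simp add: algebra_simps)
  qed
  have d\<theta>: "dzbar j (\<theta> l) z = dzbar j (dcut l) z * ?A z + dcut l z * dzbar j ?A z" for j l z
    unfolding \<theta>_def[abs_def] by (simp add: dzbar_mult cut_smooth sm)
  have ddA: "test_on UNIV (\<lambda>z. dzbar j (dcut l) z * ?A z)" for j l
    by (rule test_on_mult[OF A smooth_dzbar[OF cut_smooth(2)]])
  have d\<phi>: "test_on UNIV (\<lambda>z. dcut l z * \<phi> z)" for l
    by (rule test_on_mult[OF test_on_UNIV[OF \<phi>] cut_smooth(2)])
  define N where "N j k = (LINT z|lborel. H k z * dzbar j \<phi> z)" for j k
  define Q where "Q j k = I k (dzbar j \<sigma>) - I k (dzbar j (\<theta> a))" for j k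
  define P where "P j k = I k (\<lambda>z. dcut j z * \<phi> z) + I k (\<lambda>z. dzbar j (dcut a) z * ?A z)" for j k
  define Z where "Z j k = I a (\<lambda>z. dzbar j (dcut k) z * ?A z)" for j k
  have N: "N j k = Q j k + P j k + P k j - Z j k" for j k
  proof -
    have "I k (dzbar j \<phi>) - I k (\<lambda>z. cut z * dzbar j \<phi> z) = I k (\<lambda>z. dzbar j \<phi> z - cut z * dzbar j \<phi> z)"
      by (rule I_diff[symmetric, OF test_on_dzbar[OF \<phi>] test_on_mult[OF test_on_dzbar[OF \<phi>] cut_smooth(1)]])
    also have "\<dots> = I k (dzbar j \<sigma>) + I k (\<lambda>z. dcut j z * \<phi> z)"
      unfolding d\<sigma> by (rule I_add[OF test_on_dzbar[OF \<sigma>] d\<phi>])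
    finally have 1: "I k (dzbar j \<phi>) - I k (\<lambda>z. cut z * dzbar j \<phi> z) = I k (dzbar j \<sigma>) + I k (\<lambda>z. dcut j z * \<phi> z)" .
    have 2: "I h (\<lambda>z. dcut l z * dzbar j ?A z) = I h (dzbar j (\<theta> l)) - I h (\<lambda>z. dzbar j (dcut l) z * ?A z)" for h l
    proof -
      have "(\<lambda>z. dcut l z * dzbar j ?A z) = (\<lambda>z. dzbar j (\<theta> l) z - dzbar j (dcut l) z * ?A z)"
        by (simp add: d\<theta>)
      then show ?thesis using I_diff[OF test_on_dzbar[OF \<theta>] ddA] by simp
    qed
    have "I a (dzbar j (\<theta> k)) = I j (dzbar a (\<theta> k))" by (rule I_closed[OF \<theta>])
    also have "dzbar a (\<theta> k) = (\<lambda>z. dzbar k (dcut a) z * ?A z + dcut k z * \<phi> z)"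
      by (simp add: fun_eq_iff d\<theta> cut_identities[OF \<phi>'] dzbar_commute[OF cut_smooth(1), of a k])
    also have "I j \<dots> = I j (\<lambda>z. dzbar k (dcut a) z * ?A z) + I j (\<lambda>z. dcut k z * \<phi> z)"
      by (rule I_add[OF ddA d\<phi>])
    finally have 3: "I a (dzbar j (\<theta> k)) = I j (\<lambda>z. dzbar k (dcut a) z * ?A z) + I j (\<lambda>z. dcut k z * \<phi> z)" .
    have "N j k = I k (dzbar j \<phi>) - I k (\<lambda>z. cut z * dzbar j \<phi> z)
        - (I k (\<lambda>z. dcut a z * dzbar j ?A z) - I a (\<lambda>z. dcut k z * dzbar j ?A z))"
      unfolding N_def H_pairing[OF test_on_dzbar[OF \<phi>]] G_pairing[OF test_on_dzbar[OF \<phi>]] dzbar_T[OF \<phi>]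
      by simp
    then show ?thesis unfolding 1 2 3 Q_def P_def Z_def by simp
  qed
  have "Q j k = Q k j" unfolding Q_def I_closed[OF \<sigma>, of k j] I_closed[OF \<theta>, of k j] ..
  moreover have "Z j k = Z k j" unfolding Z_def dzbar_commute[OF cut_smooth(1), of j k] ..
  ultimately have "N j k = N k j" unfolding N by simp
  then show ?thesis by (simp add: N_def)
qed

end

section \<open>Square-integrable functions\<close>

text \<open>Integrable and square-integrable. The first property follows from the second on bounded sets, but
  the convolutions are not supported in \<open>Om\<close> and both are preserved by them.\<close>

definition L12 :: "('a::euclidean_space \<Rightarrow> complex) \<Rightarrow> bool" where
  "L12 p \<longleftrightarrow> integrable lborel p \<and> integrable lborel (\<lambda>z. (norm (p z))\<^sup>2)"

lemma L12_measurable: "L12 p \<Longrightarrow> p \<in> borel_measurable borel"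
  unfolding L12_def using borel_measurable_integrable[of lborel p] by simp

lemma norm_add_power2_le:
  fixes x y :: "'a::real_normed_vector"
  shows "(norm (x + y))\<^sup>2 \<le> 2 * (norm x)\<^sup>2 + 2 * (norm y)\<^sup>2"
proof -
  have "(norm (x + y))\<^sup>2 \<le> (norm x + norm y)\<^sup>2"
    by (rule power_mono[OF norm_triangle_ineq norm_ge_zero])
  also have "\<dots> \<le> (norm x + norm y)\<^sup>2 + (norm x - norm y)\<^sup>2" by simp
  also have "\<dots> = 2 * (norm x)\<^sup>2 + 2 * (norm y)\<^sup>2" by (simp add: power2_eq_square algebra_simps)
  finally show ?thesis .
qed

lemma L12_add:
  assumes "L12 p" "L12 q"
  shows "L12 (\<lambda>z. p z + q z)"
proof -
  have [measurable]: "p \<in> borel_measurable borel" "q \<in> borel_measurable borel"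
    using assms by (simp_all add: L12_measurable)
  have "integrable lborel (\<lambda>z. (norm (p z + q z))\<^sup>2)"
  proof (rule Bochner_Integration.integrable_bound)
    show "integrable lborel (\<lambda>z. 2 * (norm (p z))\<^sup>2 + 2 * (norm (q z))\<^sup>2)"
      using assms by (simp add: L12_def)
    show "AE z in lborel. norm ((norm (p z + q z))\<^sup>2) \<le> norm (2 * (norm (p z))\<^sup>2 + 2 * (norm (q z))\<^sup>2)"
      using norm_add_power2_le by auto
  qed simp
  then show ?thesis using assms by (simp add: L12_def)
qed

lemma L12_minus: "L12 p \<Longrightarrow> L12 (\<lambda>z. - p z)"
  by (simp add: L12_def)

lemma L12_diff: "L12 p \<Longrightarrow> L12 q \<Longrightarrow> L12 (\<lambda>z. p z - q z)"
  using L12_add[OF _ L12_minus[of q], of p] by simp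

lemma L12_mult_test:
  assumes p: "L12 p" and \<phi>: "test_on U \<phi>"
  shows "L12 (\<lambda>z. p z * \<phi> z)"
proof -
  obtain B where B: "B > 0" "\<And>x. norm (\<phi> x) \<le> B"
    using \<phi> by (rule test_on_bounded) (rule that)
  have [measurable]: "p \<in> borel_measurable borel" "\<phi> \<in> borel_measurable borel"
    using L12_measurable[OF p] smooth_measurable[OF test_on_smooth[OF \<phi>]] by simp_all
  have "integrable lborel (\<lambda>z. (norm (p z * \<phi> z))\<^sup>2)"
  proof (rule Bochner_Integration.integrable_bound)
    show "integrable lborel (\<lambda>z. (norm (p z))\<^sup>2 * B\<^sup>2)" using p by (simp add: L12_def)
    show "AE z in lborel. norm ((norm (p z * \<phi> z))\<^sup>2) \<le> norm ((norm (p z))\<^sup>2 * B\<^sup>2)"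
      using B by (auto simp: norm_mult power_mult_distrib intro!: mult_left_mono power_mono)
  qed simp
  then show ?thesis using p integrable_mult_test[OF \<phi>, of p] by (simp add: L12_def)
qed

lemma L12_dir_conv:
  fixes p :: "complex ^ 'n::finite \<Rightarrow> complex"
  shows "L12 p \<Longrightarrow> integrable lborel \<kappa> \<Longrightarrow> L12 (dir_conv \<kappa> a p)"
  by (simp add: L12_def dir_conv_L2 dir_conv_integrable)

lemma L12_if:
  assumes "L12 p" "L12 q" "V \<in> sets borel"
  shows "L12 (\<lambda>z. if z \<in> V then p z else q z)"
proof -
  have "integrable lborel (\<lambda>z. indicator V z *\<^sub>R p z + indicator (- V) z *\<^sub>R q z)"
    using assms by (intro Bochner_Integration.integrable_add integrable_mult_indicator) (auto simp: L12_def)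
  moreover have "integrable lborel (\<lambda>z. indicator V z *\<^sub>R (norm (p z))\<^sup>2 + indicator (- V) z *\<^sub>R (norm (q z))\<^sup>2)"
    using assms by (intro Bochner_Integration.integrable_add integrable_mult_indicator) (auto simp: L12_def)
  moreover have "(\<lambda>z. indicator V z *\<^sub>R p z + indicator (- V) z *\<^sub>R q z) = (\<lambda>z. if z \<in> V then p z else q z)"
    "(\<lambda>z. indicator V z *\<^sub>R (norm (p z))\<^sup>2 + indicator (- V) z *\<^sub>R (norm (q z))\<^sup>2) = (\<lambda>z. (norm (if z \<in> V then p z else q z))\<^sup>2)"
    by (auto simp: indicator_def)
  ultimately show ?thesis by (simp add: L12_def)
qed

text \<open>Functions in \<open>L2_space U\<close> are arbitrary off \<open>U\<close>; after extension by zero all integrals run over the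
  whole space.\<close>

definition zero_ext :: "'a set \<Rightarrow> ('a \<Rightarrow> 'b::real_vector) \<Rightarrow> 'a \<Rightarrow> 'b" where
  "zero_ext U f z = (if z \<in> U then f z else 0)"

lemma zero_ext_indicator: "zero_ext U f z = indicator U z *\<^sub>R f z"
  by (simp add: zero_ext_def indicator_def)

lemma L2_space_iff:
  "f \<in> L2_space U \<longleftrightarrow> zero_ext U f \<in> borel_measurable borel \<and> integrable lborel (\<lambda>z. (norm (zero_ext U f z))\<^sup>2)"
proof -
  have "(\<lambda>z. indicator U z *\<^sub>R (norm (f z))\<^sup>2) = (\<lambda>z. (norm (zero_ext U f z))\<^sup>2)"
    by (auto simp: zero_ext_def indicator_def)
  moreover have "(\<lambda>z. indicator U z *\<^sub>R f z) = zero_ext U f"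
    by (simp add: fun_eq_iff zero_ext_indicator)
  ultimately show ?thesis
    by (simp add: L2_space_def set_borel_measurable_def set_integrable_def)
qed

lemma distr_of_zero_ext: "distr_of U p \<phi> = (LINT z|lborel. zero_ext U p z * \<phi> z)"
  unfolding distr_of_def set_lebesgue_integral_def
  by (rule Bochner_Integration.integral_cong) (simp_all add: zero_ext_indicator)

lemma square_integrable_bounded_L12:
  fixes p :: "'a::euclidean_space \<Rightarrow> complex"
  assumes [measurable]: "p \<in> borel_measurable borel" and p2: "integrable lborel (\<lambda>z. (norm (p z))\<^sup>2)"
    and U: "bounded U" "\<And>z. z \<notin> U \<Longrightarrow> p z = 0"
  shows "L12 p"
proof -
  obtain r where "\<And>z. z \<in> U \<Longrightarrow> norm z \<le> r" using U(1) unfolding bounded_iff by blast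
  then have r: "U \<subseteq> cball 0 r" by auto
  have "integrable lborel p"
  proof (rule Bochner_Integration.integrable_bound)
    show "integrable lborel (\<lambda>z. indicator (cball 0 r) z + (norm (p z))\<^sup>2)"
      using p2 emeasure_bounded_finite[OF bounded_cball, of "0::'a" r]
      by (intro Bochner_Integration.integrable_add integrable_real_indicator) auto
    show "AE z in lborel. norm (p z) \<le> norm (indicator (cball 0 r) z + (norm (p z))\<^sup>2 :: real)"
    proof (rule AE_I2)
      fix z
      have "2 * norm (p z) \<le> 1 + (norm (p z))\<^sup>2"
        using zero_le_power2[of "norm (p z) - 1"] by (simp add: power2_eq_square algebra_simps)
      then have "norm (p z) \<le> 1 + (norm (p z))\<^sup>2" using norm_ge_zero[of "p z"] by linarith
      then show "norm (p z) \<le> norm (indicator (cball 0 r) z + (norm (p z))\<^sup>2 :: real)"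
        using U(2)[of z] r by (cases "z \<in> U") (auto simp: indicator_def)
    qed
  qed simp
  then show ?thesis using p2 by (simp add: L12_def)
qed

lemma L12_imp_L2_space:
  assumes "L12 p" "U \<in> sets borel"
  shows "p \<in> L2_space U"
proof -
  have "L12 (\<lambda>z. if z \<in> U then p z else 0)"
    by (rule L12_if[OF assms(1) _ assms(2)]) (simp add: L12_def)
  then have "L12 (zero_ext U p)" by (simp add: zero_ext_def[abs_def])
  then show ?thesis unfolding L2_space_iff using L12_measurable by (simp add: L12_def)
qed

lemma zero_ext_L12:
  assumes "p \<in> L2_space U" "bounded U"
  shows "L12 (zero_ext U p)"
proof (rule square_integrable_bounded_L12[OF _ _ assms(2)])
  show "zero_ext U p z = 0" if "z \<notin> U" for z using that by (simp add: zero_ext_def)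
qed (use assms(1) in \<open>simp_all add: L2_space_iff\<close>)

lemma norm_vec_power2: "(norm (x :: complex ^ 'n::finite))\<^sup>2 = (\<Sum>k\<in>UNIV. (norm (x $ k))\<^sup>2)"
  by (simp add: norm_vec_def L2_set_def sum_nonneg)

lemma L2_space_vec_iff:
  fixes f :: "complex ^ 'n::finite \<Rightarrow> complex ^ 'n"
  assumes "bounded U"
  shows "f \<in> L2_space U \<longleftrightarrow> (\<forall>k. L12 (zero_ext U (\<lambda>z. f z $ k)))"
proof
  have e: "zero_ext U (\<lambda>z. f z $ k) = (\<lambda>z. zero_ext U f z $ k)" for k
    by (auto simp: zero_ext_def)
  {
    assume f: "f \<in> L2_space U"
    then have [measurable]: "zero_ext U f \<in> borel_measurable borel" by (simp add: L2_space_iff)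
    have [measurable]: "(\<lambda>z. zero_ext U f z $ k) \<in> borel_measurable borel" for k
      by (rule measurable_compose[OF _ borel_measurable_continuous_onI]) (auto intro!: continuous_intros)
    show "\<forall>k. L12 (zero_ext U (\<lambda>z. f z $ k))"
      unfolding e
    proof
      fix k
      have "integrable lborel (\<lambda>z. (norm (zero_ext U f z $ k))\<^sup>2)"
      proof (rule Bochner_Integration.integrable_bound)
        show "integrable lborel (\<lambda>z. (norm (zero_ext U f z))\<^sup>2)" using f by (simp add: L2_space_iff)
        show "AE z in lborel. norm ((norm (zero_ext U f z $ k))\<^sup>2) \<le> norm ((norm (zero_ext U f z))\<^sup>2)"
          by (rule AE_I2) (simp add: power_mono Finite_Cartesian_Product.norm_nth_le)
      qed simp
      moreover have "(\<lambda>z. zero_ext U f z $ k) \<in> borel_measurable borel" by measurable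
      moreover have "zero_ext U f z $ k = 0" if "z \<notin> U" for z using that by (simp add: zero_ext_def)
      ultimately show "L12 (\<lambda>z. zero_ext U f z $ k)"
        by (intro square_integrable_bounded_L12[OF _ _ assms])
    qed
  next
    assume L: "\<forall>k. L12 (zero_ext U (\<lambda>z. f z $ k))"
    have "zero_ext U f \<in> borel_measurable borel"
    proof (subst borel_measurable_euclidean_space, intro ballI)
      fix i :: "complex ^ 'n" assume "i \<in> Basis"
      then obtain k c where i: "i = axis k c" by (auto simp: Basis_vec_def)
      have "(\<lambda>z. zero_ext U (\<lambda>z. f z $ k) z) \<in> borel_measurable borel"
        using L L12_measurable by blast
      then have "(\<lambda>z. zero_ext U (\<lambda>z. f z $ k) z \<bullet> c) \<in> borel_measurable borel" by measurable
      then show "(\<lambda>z. zero_ext U f z \<bullet> i) \<in> borel_measurable borel"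
        by (simp add: i inner_axis e)
    qed
    moreover have "integrable lborel (\<lambda>z. (norm (zero_ext U f z))\<^sup>2)"
      unfolding norm_vec_power2 using L unfolding e
      by (intro Bochner_Integration.integrable_sum) (auto simp: L12_def)
    ultimately show "f \<in> L2_space U" by (simp add: L2_space_iff)
  }
qed

lemma is_dbar_iff:
  "is_dbar U g f \<longleftrightarrow> (\<forall>j \<phi>. test_on U \<phi> \<longrightarrow>
     - (LINT z|lborel. zero_ext U g z * dzbar j \<phi> z) = (LINT z|lborel. zero_ext U (\<lambda>z. f z $ j) z * \<phi> z))"
  by (auto simp: is_dbar_def distr_dzbar_def distr_of_zero_ext test_functions_iff)

lemma dbar_closed_iff:
  "dbar_closed U f \<longleftrightarrow> (\<forall>j k \<phi>. test_on U \<phi> \<longrightarrow>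
     (LINT z|lborel. zero_ext U (\<lambda>z. f z $ k) z * dzbar j \<phi> z)
     = (LINT z|lborel. zero_ext U (\<lambda>z. f z $ j) z * dzbar k \<phi> z))"
proof -
  have eq: "- x - - y = 0 \<longleftrightarrow> x = y" for x y :: complex by auto
  show ?thesis
    unfolding dbar_closed_def distr_dzbar_def distr_of_zero_ext test_functions_iff Ball_def eq ..
qed

lemma integral_zero_ext_test:
  assumes "test_on U \<phi>"
  shows "(LINT z|lborel. zero_ext U p z * \<phi> z) = (LINT z|lborel. p z * \<phi> z)"
  by (rule Bochner_Integration.integral_cong) (use test_on_zero_outside[OF assms] in \<open>auto simp: zero_ext_def\<close>)

lemma zero_ext_zero: "zero_ext U (\<lambda>_. 0) = (\<lambda>_. 0)"
  by (simp add: zero_ext_def fun_eq_iff)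

lemma zero_coboundary: "(\<lambda>z. 0) \<in> coboundaries01 U"
proof -
  have "(\<lambda>_. 0) \<in> L2_space U" for U :: "(complex ^ 'n::finite) set"
    by (simp add: L2_space_iff zero_ext_zero)
  moreover have "is_dbar U (\<lambda>_. 0) (\<lambda>_. 0)"
    by (simp add: is_dbar_iff zero_ext_zero)
  ultimately show ?thesis unfolding coboundaries01_def 
    by (intro CollectI conjI bexI[of _ "\<lambda>_. 0"]) (simp_all add: L2_space_iff zero_ext_zero)
qed

section \<open>Gluing the two local solutions\<close>

context hartogs_form
begin

definition u :: "complex ^ 'n \<Rightarrow> complex" where
  "u z = (if z \<in> Va then u_a z else u_b z)"

text \<open>A test function off \<open>KK\<close> is a sum of test functions on \<open>Va\<close> and on \<open>Vb\<close>. Against the second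
  summand \<open>u\<close> may be replaced by \<open>u_b\<close>, because \<open>u_a = u_b\<close> almost everywhere on the overlap.\<close>

lemma dbar_u:
  assumes Om: "Om \<subseteq> polydisc M1" "M1 \<le> M"
    and zero: "\<And>\<phi>. test_on (Va \<inter> Vb \<inter> polydisc M1) \<phi> \<Longrightarrow> (LINT z|lborel. (u_a z - u_b z) * \<phi> z) = 0"
    and \<phi>: "test_on (Om - KK) \<phi>"
  shows "- (LINT z|lborel. u z * dzbar k \<phi> z) = I k (\<lambda>z. cut z * \<phi> z) - (LINT z|lborel. G k z * \<phi> z)"
proof -
  have ae: "AE z in lborel. z \<in> Va \<inter> Vb \<inter> polydisc M1 \<longrightarrow> u_a z - u_b z = 0"
    by (rule AE_zero_if_orthogonal_to_test)
      (auto intro!: Bochner_Integration.integrable_diff int_u_a int_u_b open_Int Va(1) Vb(1) open_polydisc zero)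
  obtain S where S: "compact S" "S \<subseteq> Om - KK" "\<And>x. \<phi> x \<noteq> 0 \<Longrightarrow> x \<in> S"
    using \<phi> by (rule test_on_support) (rule that)
  \<comment> \<open>\<open>h\<close> is 1 near the part of the support of \<open>\<phi>\<close> that \<open>Vb\<close> misses, and is supported in \<open>Va\<close>.\<close>
  have "compact (S - Vb)" "S - Vb \<subseteq> Va" using S Vab Vb(1) by (auto intro: compact_diff)
  then obtain h :: "complex ^ 'n \<Rightarrow> real" and W' where h: "smooth h" "open W'" "S - Vb \<subseteq> W'"
    "\<And>x. x \<in> W' \<Longrightarrow> h x = 1" "compact (closure {x. h x \<noteq> 0})" "closure {x. h x \<noteq> 0} \<subseteq> Va"
    using smooth_cutoff[OF _ Va(1)] by metis
  define \<phi>1 where "\<phi>1 z = complex_of_real (h z) * \<phi> z" for z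
  define \<phi>2 where "\<phi>2 z = (1 - complex_of_real (h z)) * \<phi> z" for z
  have sm: "smooth (\<lambda>z. complex_of_real (h z))" by (rule smooth_of_real[OF h(1)])
  have "test_on Va (\<lambda>z. complex_of_real (h z))" using h sm by (simp add: test_on_def)
  then have 1: "test_on (Va \<inter> (Om - KK)) \<phi>1"
    unfolding \<phi>1_def[abs_def] by (rule test_on_mult_Int[OF _ \<phi>])
  have 2: "test_on (Vb \<inter> (Om - KK)) \<phi>2"
  proof (rule test_onI[of _ "S - W'"])
    show "smooth \<phi>2" unfolding \<phi>2_def[abs_def]
      by (intro smooth_mult smooth_diff smooth_const sm test_on_smooth[OF \<phi>])
    show "compact (S - W')" using S(1) h(2) by (rule compact_diff)
    show "S - W' \<subseteq> Vb \<inter> (Om - KK)" using S(2) h(3) by blast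
    show "x \<in> S - W'" if "\<phi>2 x \<noteq> 0" for x using that S(3)[of x] h(4)[of x] by (auto simp: \<phi>2_def)
  qed
  have t1: "test_on Va \<phi>1" "test_on (polydisc M) \<phi>1" and t2: "test_on Vb \<phi>2" "test_on (polydisc M) \<phi>2"
    using test_on_mono[OF 1] test_on_mono[OF 2] M(2) by blast+
  have e: "\<phi> = (\<lambda>z. \<phi>1 z + \<phi>2 z)" by (simp add: \<phi>1_def \<phi>2_def fun_eq_iff algebra_simps)
  have d: "dzbar k \<phi> z = dzbar k \<phi>1 z + dzbar k \<phi>2 z" for z
    unfolding e by (rule dzbar_add[OF test_on_smooth[OF 1] test_on_smooth[OF 2]])
  have [measurable]: "Va \<in> sets borel" "u_a \<in> borel_measurable borel" "u_b \<in> borel_measurable borel"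
    using Va(1) int_u_a int_u_b by auto
  have "integrable lborel u"
  proof (rule Bochner_Integration.integrable_bound)
    show "integrable lborel (\<lambda>z. norm (u_a z) + norm (u_b z))" using int_u_a int_u_b by simp
    show "u \<in> borel_measurable lborel" unfolding u_def[abs_def] by measurable
    show "AE z in lborel. norm (u z) \<le> norm (norm (u_a z) + norm (u_b z))" by (simp add: u_def)
  qed
  then have "(LINT z|lborel. u z * dzbar k \<phi> z) = (LINT z|lborel. u z * dzbar k \<phi>1 z) + (LINT z|lborel. u z * dzbar k \<phi>2 z)"
    unfolding d distrib_left
    by (intro Bochner_Integration.integral_add integrable_mult_test[OF test_on_dzbar[OF 1]]
        integrable_mult_test[OF test_on_dzbar[OF 2]])
  also have "(LINT z|lborel. u z * dzbar k \<phi>1 z) = (LINT z|lborel. u_a z * dzbar k \<phi>1 z)"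
    by (rule Bochner_Integration.integral_cong)
      (use test_on_zero_outside[OF test_on_dzbar[OF t1(1)]] in \<open>auto simp: u_def\<close>)
  also have "(LINT z|lborel. u z * dzbar k \<phi>2 z) = (LINT z|lborel. u_b z * dzbar k \<phi>2 z)"
  proof (rule integral_cong_AE)
    have [measurable]: "dzbar k \<phi>2 \<in> borel_measurable borel"
      by (rule smooth_measurable[OF test_on_smooth[OF test_on_dzbar[OF 2]]])
    show "(\<lambda>z. u z * dzbar k \<phi>2 z) \<in> borel_measurable lborel"
      unfolding u_def[abs_def] by measurable
    show "(\<lambda>z. u_b z * dzbar k \<phi>2 z) \<in> borel_measurable lborel" by measurable
    show "AE z in lborel. u z * dzbar k \<phi>2 z = u_b z * dzbar k \<phi>2 z"
      using ae
    proof eventually_elim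
      case (elim z)
      show ?case
      proof (cases "z \<in> Vb \<inter> (Om - KK)")
        case True
        then show ?thesis using elim Om(1) by (auto simp: u_def)
      next
        case False
        then show ?thesis using test_on_zero_outside[OF test_on_dzbar[OF 2]] by simp
      qed
    qed
  qed
  finally have "- (LINT z|lborel. u z * dzbar k \<phi> z)
      = (I k (\<lambda>z. cut z * \<phi>1 z) - (LINT z|lborel. G k z * \<phi>1 z)) + (I k (\<lambda>z. cut z * \<phi>2 z) - (LINT z|lborel. G k z * \<phi>2 z))"
    using dbar_u_a[OF t1, of k] dbar_u_b[OF t2, of k] by simp
  also have "\<dots> = I k (\<lambda>z. cut z * \<phi>1 z + cut z * \<phi>2 z) - (LINT z|lborel. G k z * \<phi>1 z + G k z * \<phi>2 z)"
    by (simp add: I_add[OF test_on_mult[OF 1 cut_smooth(1)] test_on_mult[OF 2 cut_smooth(1)]]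
      integrable_mult_test[OF 1 int_G] integrable_mult_test[OF 2 int_G])
  also have "\<dots> = I k (\<lambda>z. cut z * \<phi> z) - (LINT z|lborel. G k z * \<phi> z)"
    by (simp add: e distrib_left)
  finally show ?thesis .
qed

text \<open>\<open>H\<close> is a cocycle on \<open>Om\<close>, hence \<open>H = dbar v\<close>, and \<open>f = (cut * f - G) + H = dbar (u + v)\<close>.\<close>

lemma coboundary_if_pairing_zero:
  assumes fL: "\<And>k. L12 (\<lambda>z. f z $ k)" and f0: "\<And>z. z \<notin> Om - KK \<Longrightarrow> f z = 0"
    and opn: "open Om" "closed KK" and ex: "H01_zero Om"
    and Om: "Om \<subseteq> polydisc M1" "M1 \<le> M"
    and zero: "\<And>\<phi>. test_on (Va \<inter> Vb \<inter> polydisc M1) \<phi> \<Longrightarrow> (LINT z|lborel. (u_a z - u_b z) * \<phi> z) = 0"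
  shows "\<exists>g\<in>L2_space (Om - KK). is_dbar (Om - KK) g f"
proof -
  have bd: "bounded Om"
  proof (rule bounded_subset[OF _ Om(1)])
    have "norm z \<le> (\<Sum>k\<in>(UNIV::'n set). M1)" if "z \<in> polydisc M1" for z :: "complex ^ 'n"
    proof -
      have "norm z \<le> (\<Sum>k\<in>UNIV. norm (z $ k))" unfolding norm_vec_def by (rule L2_set_le_sum) simp
      also have "\<dots> \<le> (\<Sum>k\<in>(UNIV::'n set). M1)"
        by (rule sum_mono) (use that in \<open>simp add: polydisc_def less_imp_le\<close>)
      finally show ?thesis .
    qed
    then show "bounded (polydisc M1 :: (complex ^ 'n) set)" by (rule boundedI)
  qed
  have Lcut: "L12 (\<lambda>z. f z $ k * cut z)" for k by (rule L12_mult_test[OF fL cut(1)])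
  have Lg: "L12 (g k)" for k unfolding g_def[abs_def]
    by (intro L12_diff L12_mult_test[OF fL dcut_test])
  have LG: "L12 (G k)" for k unfolding G_def[abs_def]
    by (intro L12_minus L12_dir_conv Lg kernel(1))
  have Lua: "L12 u_a" unfolding u_a_def[abs_def] by (intro L12_minus L12_dir_conv Lcut kernel(1))
  have Lub: "L12 u_b" unfolding u_b_def[abs_def] by (intro L12_add L12_minus L12_dir_conv Lcut LG kernel(1))
  have Lu: "L12 u" unfolding u_def[abs_def] by (rule L12_if[OF Lua Lub]) (use Va(1) in simp)
  have LH: "L12 (H k)" for k unfolding H_def[abs_def] by (intro L12_add L12_diff fL Lcut LG)
  define h where "h z = (\<chi> k. H k z)" for z
  have hk: "(\<lambda>z. h z $ k) = H k" for k by (simp add: h_def fun_eq_iff)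
  have Bo: "Om \<in> sets borel" "Om - KK \<in> sets borel" using opn by auto
  have zL: "L12 (zero_ext Om p)" if "L12 p" for p :: "complex ^ 'n \<Rightarrow> complex"
    by (rule zero_ext_L12[OF L12_imp_L2_space[OF that Bo(1)] bd])
  have hL: "h \<in> L2_space Om" unfolding L2_space_vec_iff[OF bd] hk using zL LH by blast
  have hC: "dbar_closed Om h"
    unfolding dbar_closed_iff hk using H_closed by (simp add: integral_zero_ext_test test_on_dzbar)
  have "h \<in> cohomology_class Om h"
    using hL hC zero_coboundary by (simp add: cohomology_class_def cocycles01_def)
  moreover have "cohomology_class Om h \<in> H01 Om" 
    unfolding H01_def by (rule imageI) (use hL hC in \<open>simp add: cocycles01_def\<close>)
  ultimately have "h \<in> cohomology_class Om (\<lambda>_. 0)" using ex unfolding H01_zero_def by (metis singletonD)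
  then have "h \<in> coboundaries01 Om" by (simp add: cohomology_class_def)
  then obtain v where v: "v \<in> L2_space Om" "is_dbar Om v h"
    unfolding coboundaries01_def by blast
  have Lv: "L12 (zero_ext Om v)" by (rule zero_ext_L12[OF v(1) bd])
  let ?w = "\<lambda>z. u z + zero_ext Om v z"
  show ?thesis
  proof
    show "?w \<in> L2_space (Om - KK)" by (rule L12_imp_L2_space[OF L12_add[OF Lu Lv] Bo(2)])
    show "is_dbar (Om - KK) ?w f"
      unfolding is_dbar_iff
    proof (intro allI impI)
      fix k \<phi> assume \<phi>: "test_on (Om - KK) \<phi>"
      then have \<phi>': "test_on Om \<phi>" by (rule test_on_mono) simp
      have "- (LINT z|lborel. zero_ext (Om - KK) ?w z * dzbar k \<phi> z) = - (LINT z|lborel. ?w z * dzbar k \<phi> z)"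
        by (simp add: integral_zero_ext_test[OF test_on_dzbar[OF \<phi>]])
      also have "\<dots> = - (LINT z|lborel. u z * dzbar k \<phi> z) - (LINT z|lborel. zero_ext Om v z * dzbar k \<phi> z)"
        using Lu Lv by (simp add: distrib_right L12_def integrable_mult_test[OF test_on_dzbar[OF \<phi>]])
      also have "- (LINT z|lborel. u z * dzbar k \<phi> z) = I k (\<lambda>z. cut z * \<phi> z) - (LINT z|lborel. G k z * \<phi> z)"
        by (rule dbar_u[OF Om zero \<phi>])
      also have "\<dots> - (LINT z|lborel. zero_ext Om v z * dzbar k \<phi> z) = I k (\<lambda>z. cut z * \<phi> z) - (LINT z|lborel. G k z * \<phi> z) + (LINT z|lborel. H k z * \<phi> z)"
        using v(2) \<phi>' unfolding is_dbar_iff hk by (simp add: integral_zero_ext_test)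
      also have "\<dots> = I k \<phi>" unfolding H_pairing[OF \<phi>] by simp
      also have "\<dots> = (LINT z|lborel. zero_ext (Om - KK) (\<lambda>z. f z $ k) z * \<phi> z)"
        by (simp add: I_def integral_zero_ext_test[OF \<phi>])
      finally show "- (LINT z|lborel. zero_ext (Om - KK) ?w z * dzbar k \<phi> z)
        = (LINT z|lborel. zero_ext (Om - KK) (\<lambda>z. f z $ k) z * \<phi> z)" .
    qed
  qed
qed

end

section \<open>Vanishing of the obstruction in three or more variables\<close>

text \<open>\<open>J\<close> collects the directions in which a Cauchy transform has enlarged the support.\<close>

definition mixed_polydisc :: "real \<Rightarrow> real \<Rightarrow> 'n set \<Rightarrow> (complex ^ 'n::finite) set" where
  "mixed_polydisc M1 M2 J = {z. \<forall>k. norm (z $ k) < (if k \<in> J then M2 else M1)}"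

text \<open>The dual form of the identity theorem on lines in direction \<open>j\<close>: up to a derivative, which a weakly
  holomorphic function on \<open>D\<close> does not see, every test function can be moved to the region
  \<open>|z\<^sub>j| \<ge> M1\<close> without leaving \<open>D\<close>. Here \<open>\<alpha>\<close> is the truncated Cauchy transform of \<open>\<phi>\<close>, and \<open>\<psi>\<close> is the
  error caused by the truncation.\<close>

lemma cauchy_decomposition:
  fixes \<phi> :: "complex ^ 'n::finite \<Rightarrow> complex" and M1 R1 :: real
  defines "cyl \<equiv> mixed_polydisc M1 (M1 + 2 * R1)"
  assumes \<phi>: "test_on (D \<inter> cyl J) \<phi>" and D: "\<And>z \<zeta>. z \<in> D \<Longrightarrow> z + axis j \<zeta> \<in> D" and j: "j \<notin> J"
    and M1: "M1 > 0" "2 * M1 \<le> R1"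
  obtains \<alpha> \<psi> where "test_on (D \<inter> cyl (insert j J)) \<alpha>"
    "test_on (D \<inter> {z. norm (z $ j) \<ge> M1} \<inter> cyl (insert j J)) \<psi>"
    "\<And>z. \<phi> z = dzbar j \<alpha> z + \<psi> z"
proof -
  have R1: "R1 > 0" using M1 by simp
  obtain \<rho> :: "complex \<Rightarrow> complex" where \<rho>: "test_on (ball 0 (2 * R1)) \<rho>" "\<And>\<zeta>. norm \<zeta> < R1 \<Longrightarrow> \<rho> \<zeta> = 1"
    using R1 by (rule truncation_function) (rule that)
  let ?T = "dir_avg (cauchy_kernel \<rho>) j \<phi>"
  obtain Q where Q: "compact Q" "Q \<subseteq> ball 0 (2 * R1)" "\<And>x. \<rho> x \<noteq> 0 \<Longrightarrow> x \<in> Q"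
    using \<rho>(1) by (rule test_on_support) (rule that)
  have T: "test_on (D \<inter> cyl (insert j J)) ?T"
  proof (rule dir_avg_test[OF \<phi> cauchy_kernel_integrable[OF \<rho>(1)] Q(1)])
    show "\<zeta> \<in> Q" if "cauchy_kernel \<rho> \<zeta> \<noteq> 0" for \<zeta>
      using that Q(3)[of \<zeta>] by (cases "\<rho> \<zeta> = 0") (auto simp: cauchy_kernel_def)
    fix z \<zeta> assume z: "z \<in> D \<inter> cyl J" and "\<zeta> \<in> Q"
    then have \<zeta>: "norm \<zeta> < 2 * R1" using Q(2) by auto
    have "z - axis j \<zeta> = z + axis j (- \<zeta>)" by (simp add: vec_eq_iff axis_def)
    then have "z - axis j \<zeta> \<in> D" using z D[of z "- \<zeta>"] by (metis IntD1)
    moreover have "norm ((z - axis j \<zeta>) $ k) < (if k \<in> insert j J then M1 + 2 * R1 else M1)" for k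
    proof (cases "k = j")
      case True
      have "norm (z $ j) < M1" using z j by (auto simp: cyl_def mixed_polydisc_def dest!: spec[of _ j])
      then show ?thesis using True \<zeta> norm_triangle_ineq4[of "z $ j" \<zeta>] by (simp add: axis_def)
    next
      case False
      then show ?thesis using z by (auto simp: cyl_def mixed_polydisc_def axis_def)
    qed
    ultimately show "z - axis j \<zeta> \<in> D \<inter> cyl (insert j J)" by (simp add: cyl_def mixed_polydisc_def)
  qed
  let ?\<psi> = "\<lambda>z. \<phi> z - dzbar j ?T z"
  have cyl: "cyl J \<subseteq> cyl (insert j J)"
    unfolding cyl_def mixed_polydisc_def using R1 by (auto split: if_splits) (smt (verit))
  have \<phi>': "test_on (D \<inter> cyl (insert j J)) \<phi>" by (rule test_on_mono[OF \<phi>]) (use cyl in blast)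
  have psi: "test_on (D \<inter> cyl (insert j J)) ?\<psi>"
    by (rule test_on_diff[OF \<phi>' test_on_dzbar[OF T]])
  have zero: "?\<psi> z = 0" if "norm (z $ j) < M1" for z
  proof -
    have "dzbar j ?T z = \<phi> z"
    proof (rule dir_avg_cauchy_kernel[OF \<phi> \<rho> R1])
      fix \<zeta> :: complex assume \<zeta>: "R1 \<le> norm \<zeta>"
      have "norm \<zeta> \<le> norm (z $ j + \<zeta>) + norm (z $ j)"
        using norm_triangle_ineq4[of "z $ j + \<zeta>" "z $ j"] by simp
      then have "\<not> norm ((z + axis j \<zeta>) $ j) < M1"
        using \<zeta> M1 that by (simp add: axis_def)
      then have "z + axis j \<zeta> \<notin> cyl J" using j by (auto simp: cyl_def mixed_polydisc_def intro!: exI[of _ j])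
      then show "\<phi> (z + axis j \<zeta>) = 0" using test_on_zero_outside[OF \<phi>] by blast
    qed
    then show ?thesis by simp
  qed
  obtain S where S: "compact S" "S \<subseteq> D \<inter> cyl (insert j J)" "\<And>x. ?\<psi> x \<noteq> 0 \<Longrightarrow> x \<in> S"
    using psi by (rule test_on_support) (rule that)
  have cl: "closed {z :: complex ^ 'n. norm (z $ j) \<ge> M1}"
    by (intro closed_Collect_le continuous_intros)
  show thesis
  proof (rule that[OF T, of ?\<psi>])
    show "test_on (D \<inter> {z. norm (z $ j) \<ge> M1} \<inter> cyl (insert j J)) ?\<psi>"
    proof (rule test_onI[OF test_on_smooth[OF psi]])
      show "compact (S \<inter> {z. norm (z $ j) \<ge> M1})" using S(1) cl by (rule compact_Int_closed)
      show "S \<inter> {z. norm (z $ j) \<ge> M1} \<subseteq> D \<inter> {z. norm (z $ j) \<ge> M1} \<inter> cyl (insert j J)" using S(2) by blast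
      show "x \<in> S \<inter> {z. norm (z $ j) \<ge> M1}" if "?\<psi> x \<noteq> 0" for x
        using S(3)[OF that] zero[of x] that by (cases "norm (x $ j) < M1") auto
    qed
  qed simp
qed

context hartogs_form
begin

definition pairing :: "(complex ^ 'n \<Rightarrow> complex) \<Rightarrow> complex" where
  "pairing \<phi> = (LINT z|lborel. (u_a z - u_b z) * \<phi> z)"

lemma pairing_add:
  assumes "test_on U \<phi>" "test_on V \<psi>"
  shows "pairing (\<lambda>z. \<phi> z + \<psi> z) = pairing \<phi> + pairing \<psi>"
proof -
  have w: "integrable lborel (\<lambda>z. u_a z - u_b z)"
    using int_u_a int_u_b by (rule Bochner_Integration.integrable_diff)
  show ?thesis
    unfolding pairing_def
    using integrable_mult_test[OF assms(1) w] integrable_mult_test[OF assms(2) w] by (simp add: distrib_left)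
qed

lemma pairing_split:
  assumes "test_on U \<phi>"
  shows "pairing \<phi> = (LINT z|lborel. u_a z * \<phi> z) - (LINT z|lborel. u_b z * \<phi> z)"
  using integrable_mult_test[OF assms int_u_a] integrable_mult_test[OF assms int_u_b]
  by (simp add: pairing_def left_diff_distrib)

lemma pairing_dzbar:
  assumes "test_on Va \<phi>" "test_on Vb \<phi>" "test_on (polydisc M) \<phi>"
  shows "pairing (dzbar k \<phi>) = 0"
proof -
  have "- (LINT z|lborel. u_a z * dzbar k \<phi> z) = - (LINT z|lborel. u_b z * dzbar k \<phi> z)"
    unfolding dbar_u_a[OF assms(1,3)] dbar_u_b[OF assms(2,3)] ..
  then show ?thesis by (simp only: pairing_split[OF test_on_dzbar[OF assms(3)]] neg_equal_iff_equal diff_self)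
qed

text \<open>The Cauchy transforms in directions \<open>a\<close> and \<open>b\<close> do not change \<open>z\<^sub>c\<close>, and the data \<open>cut * f\<close> and \<open>g\<close> are
  supported in \<open>|z\<^sub>c| < M1\<close>.\<close>

lemma pairing_far:
  assumes \<phi>: "test_on {z. norm (z $ c) \<ge> M1} \<phi>" and c: "c \<noteq> a" "c \<noteq> b" and Om: "Om \<subseteq> polydisc M1"
  shows "pairing \<phi> = 0"
proof -
  have T: "test_on {z. norm (z $ c) \<ge> M1} (T j \<psi>)"
    if "test_on {z. norm (z $ c) \<ge> M1} \<psi>" "j \<noteq> c" for j \<psi>
    by (rule T_test[OF that(1)]) (use that(2) in \<open>simp add: axis_def\<close>)
  have 0: "cut z * \<psi> z = 0" "dcut k z * \<psi> z = 0" if "test_on {z. norm (z $ c) \<ge> M1} \<psi>" for \<psi> k z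
  proof -
    have "cut z = 0 \<and> dcut k z = 0" if "norm (z $ c) \<ge> M1"
    proof -
      have "z \<notin> polydisc M1" using that by (auto simp: polydisc_def not_less intro: exI[of _ c])
      then have "z \<notin> Om" using Om by blast
      then show ?thesis using test_on_zero_outside[OF cut(1)] test_on_zero_outside[OF test_on_dzbar[OF cut(1)]] by blast
    qed
    then show "cut z * \<psi> z = 0" "dcut k z * \<psi> z = 0"
      using test_on_zero_outside[OF that, of z] by auto
  qed
  have I0: "I h (\<lambda>z. 0) = 0" for h by (simp add: I_def)
  have Ta: "test_on {z. norm (z $ c) \<ge> M1} (T a \<phi>)" and Tb: "test_on {z. norm (z $ c) \<ge> M1} (T b \<phi>)"
    using T[OF \<phi>] c by auto
  have Tab: "test_on {z. norm (z $ c) \<ge> M1} (T a (T b \<phi>))" using T[OF Tb] c by auto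
  show ?thesis
    unfolding pairing_split[OF \<phi>] u_a_pairing[OF \<phi>] u_b_pairing[OF \<phi>] 0(1)[OF Ta] 0(1)[OF Tb] 0(2)[OF Tab] I0
    by simp
qed

text \<open>\<open>Va \<inter> Vb\<close> is covered by the set where \<open>z\<^sub>a \<notin> K\<^sub>a\<close> and \<open>z\<^sub>b \<notin> K\<^sub>b\<close>, and by the sets where \<open>z\<^sub>i \<notin> K\<^sub>i\<close> for
  some other index \<open>i\<close>. On the first set any \<open>z\<^sub>c\<close> is allowed, and a test function can be moved to large
  \<open>z\<^sub>c\<close>, where the pairing vanishes. On a set of the second kind \<open>z\<^sub>a\<close> and \<open>z\<^sub>b\<close> are arbitrary, and test
  functions are first moved to large \<open>z\<^sub>a\<close> and \<open>z\<^sub>b\<close>, that is, into the first set.\<close>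

lemma pairing_zero_three_variables:
  assumes KK: "KK = {z. \<forall>j. z $ j \<in> K j}" and K: "\<And>j. closed (K j)" "\<And>j w. w \<in> K j \<Longrightarrow> norm w < M1"
    and VV: "Va = {z. \<exists>j. j \<noteq> a \<and> z $ j \<notin> K j}" "Vb = {z. \<exists>j. j \<noteq> b \<and> z $ j \<notin> K j}"
    and c: "c \<noteq> a" "c \<noteq> b"
    and M1: "M1 > 0" "2 * M1 \<le> R1" "M1 + 2 * R1 \<le> M" and Om: "Om \<subseteq> polydisc M1"
    and \<phi>: "test_on (Va \<inter> Vb \<inter> polydisc M1) \<phi>"
  shows "pairing \<phi> = 0"
proof -
  define cyl :: "'n set \<Rightarrow> (complex ^ 'n) set" where "cyl = mixed_polydisc M1 (M1 + 2 * R1)"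
  have cyl0: "cyl {} = polydisc M1" by (simp add: cyl_def mixed_polydisc_def polydisc_def)
  have cylM: "cyl J \<subseteq> polydisc M" for J
  proof
    fix z assume z: "z \<in> cyl J"
    have "norm (z $ k) < M" for k
    proof -
      have "norm (z $ k) < (if k \<in> J then M1 + 2 * R1 else M1)" using z by (simp add: cyl_def mixed_polydisc_def)
      then show ?thesis using M1 by (auto split: if_splits)
    qed
    then show "z \<in> polydisc M" by (simp add: polydisc_def)
  qed
  define far where "far j = {z :: complex ^ 'n. norm (z $ j) \<ge> M1}" for j
  have far_inv: "z + axis j \<zeta> \<in> far k" if "z \<in> far k" "j \<noteq> k" for z j k \<zeta>
    using that by (simp add: far_def axis_def)
  have dec: "\<exists>\<alpha> \<beta>. test_on (D \<inter> cyl (insert j J)) \<alpha> \<and> test_on (D \<inter> far j \<inter> cyl (insert j J)) \<beta>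
      \<and> \<psi> = (\<lambda>z. dzbar j \<alpha> z + \<beta> z)"
    if "test_on (D \<inter> cyl J) \<psi>" "\<And>z \<zeta>. z \<in> D \<Longrightarrow> z + axis j \<zeta> \<in> D" "j \<notin> J" for D J j \<psi>
    using that(1) unfolding cyl_def far_def
    by (rule cauchy_decomposition[OF _ that(2,3) M1(1,2)]) blast+
  have killed: "pairing (dzbar k \<alpha>) = 0" if "test_on (D \<inter> cyl J) \<alpha>" "D \<subseteq> Va \<inter> Vb" for D J k \<alpha>
    by (rule pairing_dzbar) (use test_on_mono[OF that(1)] that(2) cylM in blast)+
  have far0: "pairing \<psi> = 0" if "test_on (D \<inter> far i \<inter> cyl J) \<psi>" "i \<noteq> a" "i \<noteq> b" for D i J \<psi>
    by (rule pairing_far[OF _ that(2,3) Om]) (use test_on_mono[OF that(1)] in \<open>auto simp: far_def\<close>)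
  \<comment> \<open>Where the direction \<open>i\<close> is unrestricted, one decomposition in \<open>z\<^sub>i\<close> suffices.\<close>
  have step: "pairing \<psi> = 0" if \<psi>: "test_on (D \<inter> cyl J) \<psi>" and D: "D \<subseteq> Va \<inter> Vb"
    and inv: "\<And>z \<zeta>. z \<in> D \<Longrightarrow> z + axis i \<zeta> \<in> D" and i: "i \<noteq> a" "i \<noteq> b" "i \<notin> J" for D J i \<psi>
  proof -
    obtain \<alpha> \<beta> where ab: "test_on (D \<inter> cyl (insert i J)) \<alpha>" "test_on (D \<inter> far i \<inter> cyl (insert i J)) \<beta>"
      "\<psi> = (\<lambda>z. dzbar i \<alpha> z + \<beta> z)"
      using dec[OF \<psi> inv i(3)] by blast
    then show ?thesis
      using pairing_add[OF test_on_dzbar[OF ab(1)] ab(2), of i] killed[OF ab(1) D] far0[OF ab(2) i(1,2)] by simp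
  qed
  define P where "P i = {z :: complex ^ 'n. z $ i \<notin> K i}" for i
  have P_inv: "z + axis j \<zeta> \<in> P k" if "z \<in> P k" "j \<noteq> k" for z j k \<zeta>
    using that by (simp add: P_def axis_def)
  have P_open: "open (P i)" for i
  proof -
    have "P i = (\<lambda>z. z $ i) -` (- K i)" by (auto simp: P_def)
    then show ?thesis using K(1)[of i] by (auto intro!: open_vimage continuous_intros)
  qed
  have far_P: "far i \<subseteq> P i" for i using K(2)[of _ i] by (force simp: far_def P_def)
  have PV: "P a \<inter> P b \<subseteq> Va \<inter> Vb" using ab by (auto simp: P_def VV)
  have Pi: "P i \<subseteq> Va \<inter> Vb" if "i \<noteq> a" "i \<noteq> b" for i using that by (auto simp: P_def VV)
  have w: "integrable lborel (\<lambda>z. u_a z - u_b z)"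
    using int_u_a int_u_b by (rule Bochner_Integration.integrable_diff)
  have ae0: "AE z in lborel. z \<in> P a \<inter> P b \<inter> polydisc M1 \<longrightarrow> u_a z - u_b z = 0"
  proof (rule AE_zero_if_orthogonal_to_test[OF w])
    show "open (P a \<inter> P b \<inter> polydisc M1)" by (intro open_Int P_open open_polydisc)
    fix \<psi> assume "test_on (P a \<inter> P b \<inter> polydisc M1) \<psi>"
    then have "pairing \<psi> = 0"
      by (intro step[of "P a \<inter> P b" "{}" \<psi> c, OF _ PV _ c]) (use P_inv c cyl0 in auto)
    then show "(LINT z|lborel. (u_a z - u_b z) * \<psi> z) = 0" by (simp add: pairing_def)
  qed
  have aei: "AE z in lborel. z \<in> P i \<inter> polydisc M1 \<longrightarrow> u_a z - u_b z = 0" if i: "i \<noteq> a" "i \<noteq> b" for i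
  proof (rule AE_zero_if_orthogonal_to_test[OF w])
    show "open (P i \<inter> polydisc M1)" by (intro open_Int P_open open_polydisc)
    fix \<psi> assume \<psi>: "test_on (P i \<inter> polydisc M1) \<psi>"
    obtain \<alpha>1 \<psi>1 where 1: "test_on (P i \<inter> cyl {a}) \<alpha>1" "test_on (P i \<inter> far a \<inter> cyl {a}) \<psi>1"
      "\<psi> = (\<lambda>z. dzbar a \<alpha>1 z + \<psi>1 z)"
      using dec[of "P i" "{}" \<psi> a] \<psi> cyl0 P_inv[of _ i a] i by auto
    obtain \<alpha>2 \<psi>2 where 2: "test_on (P i \<inter> far a \<inter> cyl {b, a}) \<alpha>2" "test_on (P i \<inter> far a \<inter> far b \<inter> cyl {b, a}) \<psi>2"
      "\<psi>1 = (\<lambda>z. dzbar b \<alpha>2 z + \<psi>2 z)"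
      using dec[of "P i \<inter> far a" "{a}" \<psi>1 b] 1(2) P_inv[of _ i b] far_inv[of _ a b] i ab by auto
    have "test_on (far a \<inter> far b \<inter> cyl {b, a}) \<psi>2" by (rule test_on_mono[OF 2(2)]) blast
    then have "pairing \<psi>2 = 0"
      by (rule step[of "far a \<inter> far b" "{b, a}" \<psi>2 i]) (use far_P[of a] far_P[of b] PV far_inv i in auto)
    moreover have "pairing (dzbar b \<alpha>2) = 0" by (rule killed[OF 2(1)]) (use Pi[OF i] in blast)
    ultimately have "pairing \<psi>1 = 0" unfolding 2(3) using pairing_add[OF test_on_dzbar[OF 2(1)] 2(2), of b] by simp
    moreover have "pairing (dzbar a \<alpha>1) = 0" by (rule killed[OF 1(1) Pi[OF i]])
    ultimately have "pairing \<psi> = 0" unfolding 1(3) using pairing_add[OF test_on_dzbar[OF 1(1)] 1(2), of a] by simp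
    then show "(LINT z|lborel. (u_a z - u_b z) * \<psi> z) = 0" by (simp add: pairing_def)
  qed
  have "AE z in lborel. \<forall>i\<in>UNIV - {a, b}. z \<in> P i \<inter> polydisc M1 \<longrightarrow> u_a z - u_b z = 0"
    by (rule AE_finite_allI) (use aei in auto)
  then have "AE z in lborel. (u_a z - u_b z) * \<phi> z = 0"
    using ae0
  proof eventually_elim
    case (elim z)
    show ?case
    proof (cases "z \<in> Va \<inter> Vb \<inter> polydisc M1")
      case True
      then have "(\<exists>i. i \<noteq> a \<and> i \<noteq> b \<and> z \<in> P i) \<or> z \<in> P a \<inter> P b" by (auto simp: VV P_def)
      then show ?thesis using elim True by auto
    next
      case False
      then show ?thesis using test_on_zero_outside[OF \<phi>] by simp
    qed
  qed
  then show ?thesis unfolding pairing_def by (rule integral_eq_zero_AE)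
qed

end

section \<open>The square-integral seminorm\<close>

text \<open>The quadratic polynomial \<open>s \<mapsto> \<integral> (p - s q)\<^sup>2\<close> is nonnegative; its value at the minimum gives the
  inequality.\<close>

lemma integral_Cauchy_Schwarz:
  fixes p q :: "'a \<Rightarrow> real"
  assumes p: "integrable M (\<lambda>x. (p x)\<^sup>2)" and q: "integrable M (\<lambda>x. (q x)\<^sup>2)" and pq: "integrable M (\<lambda>x. p x * q x)"
  shows "(LINT x|M. p x * q x) \<le> sqrt (LINT x|M. (p x)\<^sup>2) * sqrt (LINT x|M. (q x)\<^sup>2)"
proof -
  define P X Q where "P = (LINT x|M. (p x)\<^sup>2)" and "X = (LINT x|M. p x * q x)" and "Q = (LINT x|M. (q x)\<^sup>2)"
  have nn: "P \<ge> 0" "Q \<ge> 0" by (simp_all add: P_def Q_def)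
  have quad: "0 \<le> P - 2 * s * X + s\<^sup>2 * Q" for s
  proof -
    have "0 \<le> (LINT x|M. (p x - s * q x)\<^sup>2)" by simp
    also have "(\<lambda>x. (p x - s * q x)\<^sup>2) = (\<lambda>x. (p x)\<^sup>2 - (2 * s) * (p x * q x) + s\<^sup>2 * (q x)\<^sup>2)"
      by (auto simp: power2_eq_square algebra_simps)
    also have "(LINT x|M. (p x)\<^sup>2 - (2 * s) * (p x * q x) + s\<^sup>2 * (q x)\<^sup>2) = P - 2 * s * X + s\<^sup>2 * Q"
      using assms by (simp add: P_def X_def Q_def)
    finally show ?thesis .
  qed
  have "X\<^sup>2 \<le> P * Q"
  proof (cases "Q = 0")
    case True
    have "X = 0"
    proof (rule ccontr)
      assume "X \<noteq> 0"
      \<comment> \<open>For \<open>Q = 0\<close> the polynomial is affine in \<open>s\<close>; this choice makes it equal to \<open>- P - 2\<close>.\<close>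
      then show False using quad[of "(P + 1) / X"] nn True by simp
    qed
    then show ?thesis using nn by simp
  next
    case False
    then have "0 \<le> (P - 2 * (X / Q) * X + (X / Q)\<^sup>2 * Q) * Q"
      using quad[of "X / Q"] nn by (intro mult_nonneg_nonneg)
    also have "\<dots> = P * Q - X\<^sup>2" using False by (simp add: field_simps power2_eq_square)
    finally show ?thesis by simp
  qed
  then have "\<bar>X\<bar> \<le> sqrt (P * Q)" by (simp add: real_le_rsqrt)
  then show ?thesis by (simp add: P_def[symmetric] X_def[symmetric] Q_def[symmetric] real_sqrt_mult)
qed

lemma integrable_mult_of_squares:
  fixes p q :: "'a \<Rightarrow> real"
  assumes "integrable M (\<lambda>x. (p x)\<^sup>2)" "integrable M (\<lambda>x. (q x)\<^sup>2)"
    "p \<in> borel_measurable M" "q \<in> borel_measurable M"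
  shows "integrable M (\<lambda>x. p x * q x)"
proof (rule Bochner_Integration.integrable_bound)
  show "integrable M (\<lambda>x. (p x)\<^sup>2 + (q x)\<^sup>2)" using assms by simp
  show "(\<lambda>x. p x * q x) \<in> borel_measurable M" using assms(3,4) by measurable
  show "AE x in M. norm (p x * q x) \<le> norm ((p x)\<^sup>2 + (q x)\<^sup>2)"
  proof (rule AE_I2)
    fix x
    have "2 * (\<bar>p x\<bar> * \<bar>q x\<bar>) \<le> (p x)\<^sup>2 + (q x)\<^sup>2"
      using zero_le_power2[of "\<bar>p x\<bar> - \<bar>q x\<bar>"] by (simp add: power2_diff)
    moreover have "0 \<le> \<bar>p x\<bar> * \<bar>q x\<bar>" by simp
    ultimately have "\<bar>p x\<bar> * \<bar>q x\<bar> \<le> (p x)\<^sup>2 + (q x)\<^sup>2" by linarith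
    then show "norm (p x * q x) \<le> norm ((p x)\<^sup>2 + (q x)\<^sup>2)" by (simp add: abs_mult)
  qed
qed

lemma L2_seminorm_zero_ext: "L2_seminorm U f = sqrt (LINT z|lborel. (norm (zero_ext U f z))\<^sup>2)"
proof -
  have "(\<lambda>z. indicator U z *\<^sub>R (norm (f z))\<^sup>2) = (\<lambda>z. (norm (zero_ext U f z))\<^sup>2)"
    by (auto simp: zero_ext_def indicator_def)
  then show ?thesis by (simp add: L2_seminorm_def set_lebesgue_integral_def)
qed

lemma zero_ext_add: "zero_ext U (\<lambda>z. f z + g z) = (\<lambda>z. zero_ext U f z + zero_ext U g z)"
  and zero_ext_diff: "zero_ext U (\<lambda>z. f z - g z) = (\<lambda>z. zero_ext U f z - zero_ext U g z)"
  by (auto simp: zero_ext_def)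

lemma zero_ext_component: "zero_ext U (\<lambda>z. f z $ k) = (\<lambda>z. zero_ext U f z $ k)"
  by (auto simp: zero_ext_def)

lemma L2_space_add:
  fixes f g :: "complex ^ 'n::finite \<Rightarrow> 'b::euclidean_space"
  assumes "f \<in> L2_space U" "g \<in> L2_space U"
  shows "(\<lambda>z. f z + g z) \<in> L2_space U"
    and "L2_seminorm U (\<lambda>z. f z + g z) \<le> L2_seminorm U f + L2_seminorm U g"
proof -
  let ?f = "zero_ext U f" and ?g = "zero_ext U g"
  have [measurable]: "?f \<in> borel_measurable borel" "?g \<in> borel_measurable borel"
    and int: "integrable lborel (\<lambda>z. (norm (?f z))\<^sup>2)" "integrable lborel (\<lambda>z. (norm (?g z))\<^sup>2)"
    using assms by (simp_all add: L2_space_iff)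
  have fg: "integrable lborel (\<lambda>z. norm (?f z) * norm (?g z))"
    by (rule integrable_mult_of_squares[OF int]) simp_all
  have int3: "integrable lborel (\<lambda>z. (norm (?f z))\<^sup>2 + 2 * (norm (?f z) * norm (?g z)) + (norm (?g z))\<^sup>2)"
    using int fg by simp
  have le: "(norm (?f z + ?g z))\<^sup>2 \<le> (norm (?f z))\<^sup>2 + 2 * (norm (?f z) * norm (?g z)) + (norm (?g z))\<^sup>2" for z
    using power_mono[OF norm_triangle_ineq[of "?f z" "?g z"] norm_ge_zero, of 2]
    by (simp add: power2_sum algebra_simps)
  have int4: "integrable lborel (\<lambda>z. (norm (?f z + ?g z))\<^sup>2)"
  proof (rule Bochner_Integration.integrable_bound[OF int3])
    show "AE z in lborel. norm ((norm (?f z + ?g z))\<^sup>2) \<le> norm ((norm (?f z))\<^sup>2 + 2 * (norm (?f z) * norm (?g z)) + (norm (?g z))\<^sup>2)"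
      using le by (auto intro: order_trans[OF _ abs_ge_self])
  qed simp
  then show "(\<lambda>z. f z + g z) \<in> L2_space U"
    by (simp add: L2_space_iff zero_ext_add)
  let ?F = "LINT z|lborel. (norm (?f z))\<^sup>2" and ?G = "LINT z|lborel. (norm (?g z))\<^sup>2"
  have "(LINT z|lborel. (norm (?f z + ?g z))\<^sup>2) \<le> (LINT z|lborel. (norm (?f z))\<^sup>2 + 2 * (norm (?f z) * norm (?g z)) + (norm (?g z))\<^sup>2)"
    by (rule integral_mono[OF int4 int3 le])
  also have "\<dots> = ?F + 2 * (LINT z|lborel. norm (?f z) * norm (?g z)) + ?G"
    using int fg by simp
  also have "\<dots> \<le> ?F + 2 * (sqrt ?F * sqrt ?G) + ?G"
    using integral_Cauchy_Schwarz[OF int fg] by simp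
  also have "\<dots> = (sqrt ?F + sqrt ?G)\<^sup>2" by (simp add: power2_sum)
  finally have "sqrt (LINT z|lborel. (norm (?f z + ?g z))\<^sup>2) \<le> sqrt ?F + sqrt ?G"
    by (intro real_le_lsqrt) auto
  then show "L2_seminorm U (\<lambda>z. f z + g z) \<le> L2_seminorm U f + L2_seminorm U g"
    by (simp add: L2_seminorm_zero_ext zero_ext_add)
qed

lemma L2_space_minus:
  fixes f :: "complex ^ 'n::finite \<Rightarrow> 'b::euclidean_space"
  assumes "f \<in> L2_space U"
  shows "(\<lambda>z. - f z) \<in> L2_space U" and "L2_seminorm U (\<lambda>z. - f z) = L2_seminorm U f"
proof -
  have "zero_ext U (\<lambda>z. - f z) = (\<lambda>z. - zero_ext U f z)" by (auto simp: zero_ext_def)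
  then show "(\<lambda>z. - f z) \<in> L2_space U" "L2_seminorm U (\<lambda>z. - f z) = L2_seminorm U f"
    using assms by (simp_all add: L2_space_iff L2_seminorm_zero_ext)
qed

lemma L2_space_diff:
  fixes f g :: "complex ^ 'n::finite \<Rightarrow> 'b::euclidean_space"
  assumes "f \<in> L2_space U" "g \<in> L2_space U"
  shows "(\<lambda>z. f z - g z) \<in> L2_space U"
    and "L2_seminorm U (\<lambda>z. f z - g z) \<le> L2_seminorm U f + L2_seminorm U g"
  using L2_space_add[OF assms(1) L2_space_minus(1)[OF assms(2)]] L2_space_minus(2)[OF assms(2)] by simp_all

lemma pairing_le_L2_seminorm:
  fixes f :: "complex ^ 'n::finite \<Rightarrow> complex ^ 'n"
  assumes f: "f \<in> L2_space U" and \<tau>: "test_on V \<tau>"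
  shows "norm (LINT z|lborel. zero_ext U (\<lambda>z. f z $ k) z * \<tau> z)
    \<le> L2_seminorm U f * sqrt (LINT z|lborel. (norm (\<tau> z))\<^sup>2)"
proof -
  let ?f = "zero_ext U f"
  have [measurable]: "?f \<in> borel_measurable borel"
    and int: "integrable lborel (\<lambda>z. (norm (?f z))\<^sup>2)"
    using f by (simp_all add: L2_space_iff)
  have [measurable]: "\<tau> \<in> borel_measurable borel" by (rule smooth_measurable[OF test_on_smooth[OF \<tau>]])
  have int\<tau>: "integrable lborel (\<lambda>z. (norm (\<tau> z))\<^sup>2)"
    using L12_mult_test[OF _ \<tau>, of \<tau>] integrable_norm[OF integrable_mult_test[OF \<tau> integrable_test[OF \<tau>]]]
    by (simp add: norm_mult power2_eq_square)
  have ft: "integrable lborel (\<lambda>z. norm (?f z) * norm (\<tau> z))"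
    by (rule integrable_mult_of_squares[OF int int\<tau>]) simp_all
  have "norm (LINT z|lborel. zero_ext U (\<lambda>z. f z $ k) z * \<tau> z) \<le> (LINT z|lborel. norm (?f z $ k * \<tau> z))"
    unfolding zero_ext_component by (rule integral_norm_bound)
  also have "\<dots> \<le> (LINT z|lborel. norm (?f z) * norm (\<tau> z))"
  proof (rule integral_mono_AE'[OF ft])
    show "AE z in lborel. norm (?f z $ k * \<tau> z) \<le> norm (?f z) * norm (\<tau> z)"
      by (rule AE_I2) (simp add: norm_mult mult_right_mono Finite_Cartesian_Product.norm_nth_le)
  qed simp
  also have "\<dots> \<le> L2_seminorm U f * sqrt (LINT z|lborel. (norm (\<tau> z))\<^sup>2)"
    unfolding L2_seminorm_zero_ext by (rule integral_Cauchy_Schwarz[OF int int\<tau> ft])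
  finally show ?thesis .
qed

section \<open>Coboundaries and their limits\<close>

lemma coboundary_iff:
  fixes f :: "complex ^ 'n::finite \<Rightarrow> complex ^ 'n"
  shows "f \<in> coboundaries01 U \<longleftrightarrow> f \<in> L2_space U \<and> (\<exists>g\<in>L2_space U. is_dbar U g f)"
  by (simp add: coboundaries01_def)

lemma zero_ext_pairing_diff:
  fixes p q :: "complex ^ 'n::finite \<Rightarrow> complex"
  assumes "p \<in> L2_space U" "q \<in> L2_space U" "bounded U" "test_on V \<tau>"
  shows "(LINT z|lborel. zero_ext U (\<lambda>z. p z - q z) z * \<tau> z)
    = (LINT z|lborel. zero_ext U p z * \<tau> z) - (LINT z|lborel. zero_ext U q z * \<tau> z)"
proof -
  have "integrable lborel (zero_ext U p)" "integrable lborel (zero_ext U q)"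
    using zero_ext_L12[OF assms(1,3)] zero_ext_L12[OF assms(2,3)] by (simp_all add: L12_def)
  from this[THEN integrable_mult_test[OF assms(4)]]
  show ?thesis by (simp add: zero_ext_diff left_diff_distrib)
qed

lemma L2_space_component:
  fixes f :: "complex ^ 'n::finite \<Rightarrow> complex ^ 'n"
  assumes "f \<in> L2_space U" "bounded U"
  shows "(\<lambda>z. f z $ k) \<in> L2_space U"
proof -
  have "L12 (zero_ext U (\<lambda>z. f z $ k))" using assms L2_space_vec_iff by blast
  then show ?thesis by (simp add: L2_space_iff L12_measurable L12_def)
qed

lemma coboundaries01_diff:
  fixes f g :: "complex ^ 'n::finite \<Rightarrow> complex ^ 'n"
  assumes f: "f \<in> coboundaries01 U" and g: "g \<in> coboundaries01 U" and U: "bounded U"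
  shows "(\<lambda>z. f z - g z) \<in> coboundaries01 U"
proof -
  obtain p q where p: "p \<in> L2_space U" "is_dbar U p f" and q: "q \<in> L2_space U" "is_dbar U q g"
    using f g by (auto simp: coboundary_iff)
  have L: "f \<in> L2_space U" "g \<in> L2_space U" using f g by (auto simp: coboundary_iff)
  have "is_dbar U (\<lambda>z. p z - q z) (\<lambda>z. f z - g z)"
    unfolding is_dbar_iff
  proof (intro allI impI)
    fix j \<phi> assume \<phi>: "test_on U \<phi>"
    have alg: "- A = P \<Longrightarrow> - B = Q \<Longrightarrow> - (A - B) = P - Q" for A B P Q :: complex by auto
    show "- (LINT z|lborel. zero_ext U (\<lambda>z. p z - q z) z * dzbar j \<phi> z)
        = (LINT z|lborel. zero_ext U (\<lambda>z. (f z - g z) $ j) z * \<phi> z)"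
      unfolding vector_minus_component
        zero_ext_pairing_diff[OF p(1) q(1) U test_on_dzbar[OF \<phi>]]
        zero_ext_pairing_diff[OF L2_space_component[OF L(1) U] L2_space_component[OF L(2) U] U \<phi>]
      by (rule alg[OF p(2)[unfolded is_dbar_iff, rule_format, OF \<phi>, of j] q(2)[unfolded is_dbar_iff, rule_format, OF \<phi>, of j]])
  qed
  then show ?thesis
    unfolding coboundary_iff using L2_space_diff(1)[OF L] L2_space_diff(1)[OF p(1) q(1)] by blast
qed

lemma cocycles01_diff:
  fixes f g :: "complex ^ 'n::finite \<Rightarrow> complex ^ 'n"
  assumes f: "f \<in> cocycles01 U" and g: "g \<in> cocycles01 U" and U: "bounded U"
  shows "(\<lambda>z. f z - g z) \<in> cocycles01 U"
proof -
  have L: "f \<in> L2_space U" "g \<in> L2_space U" using f g by (auto simp: cocycles01_def)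
  have "dbar_closed U (\<lambda>z. f z - g z)"
    unfolding dbar_closed_iff
  proof (intro allI impI)
    fix j k \<phi> assume \<phi>: "test_on U \<phi>"
    have eq: "(LINT z|lborel. zero_ext U (\<lambda>z. h z $ k) z * dzbar j \<phi> z)
        = (LINT z|lborel. zero_ext U (\<lambda>z. h z $ j) z * dzbar k \<phi> z)" if "h \<in> cocycles01 U" for h
    proof -
      have "dbar_closed U h" using that by (simp add: cocycles01_def)
      then show ?thesis using \<phi> unfolding dbar_closed_iff by blast
    qed
    show "(LINT z|lborel. zero_ext U (\<lambda>z. (f z - g z) $ k) z * dzbar j \<phi> z)
        = (LINT z|lborel. zero_ext U (\<lambda>z. (f z - g z) $ j) z * dzbar k \<phi> z)"
      unfolding vector_minus_component
        zero_ext_pairing_diff[OF L2_space_component[OF L(1) U] L2_space_component[OF L(2) U] U test_on_dzbar[OF \<phi>]]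
        eq[OF f] eq[OF g] ..
  qed
  then show ?thesis using L2_space_diff(1)[OF L] by (simp add: cocycles01_def)
qed

lemma coboundaries01_add:
  fixes f g :: "complex ^ 'n::finite \<Rightarrow> complex ^ 'n"
  assumes f: "f \<in> coboundaries01 U" and g: "g \<in> coboundaries01 U" and U: "bounded U"
  shows "(\<lambda>z. f z + g z) \<in> coboundaries01 U"
  using coboundaries01_diff[OF f coboundaries01_diff[OF zero_coboundary g U] U] by simp

lemma coboundary_pairing_orthogonal:
  fixes h :: "complex ^ 'n::finite \<Rightarrow> complex ^ 'n"
  assumes h: "h \<in> coboundaries01 U" and \<tau>: "test_on U \<tau>" "test_on U \<tau>'" "\<And>z. dzbar b \<tau> z = dzbar a \<tau>' z"
  shows "(LINT z|lborel. zero_ext U (\<lambda>z. h z $ b) z * \<tau> z) = (LINT z|lborel. zero_ext U (\<lambda>z. h z $ a) z * \<tau>' z)"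
proof -
  obtain g where g: "is_dbar U g h" using h by (auto simp: coboundary_iff)
  have "(LINT z|lborel. zero_ext U (\<lambda>z. h z $ b) z * \<tau> z) = - (LINT z|lborel. zero_ext U g z * dzbar b \<tau> z)"
    using g \<tau>(1) by (simp add: is_dbar_iff)
  also have "\<dots> = - (LINT z|lborel. zero_ext U g z * dzbar a \<tau>' z)" by (simp add: \<tau>(3))
  also have "\<dots> = (LINT z|lborel. zero_ext U (\<lambda>z. h z $ a) z * \<tau>' z)"
    using g \<tau>(2) by (simp add: is_dbar_iff)
  finally show ?thesis .
qed

text \<open>Both sides are continuous in the seminorm, since \<open>\<tau>\<close> and \<open>\<tau>'\<close> are square-integrable.\<close>

lemma closure_pairing_orthogonal:
  fixes f :: "complex ^ 'n::finite \<Rightarrow> complex ^ 'n"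
  assumes f: "f \<in> L2_space U" and U: "bounded U"
    and cl: "\<And>e. e > 0 \<Longrightarrow> \<exists>h\<in>coboundaries01 U. L2_seminorm U (\<lambda>z. f z - h z) < e"
    and \<tau>: "test_on U \<tau>" "test_on U \<tau>'" "\<And>z. dzbar b \<tau> z = dzbar a \<tau>' z"
  shows "(LINT z|lborel. zero_ext U (\<lambda>z. f z $ b) z * \<tau> z) = (LINT z|lborel. zero_ext U (\<lambda>z. f z $ a) z * \<tau>' z)"
proof -
  let ?J = "\<lambda>f. (LINT z|lborel. zero_ext U (\<lambda>z. f z $ b) z * \<tau> z) - (LINT z|lborel. zero_ext U (\<lambda>z. f z $ a) z * \<tau>' z)"
  define C where "C = sqrt (LINT z|lborel. (norm (\<tau> z))\<^sup>2) + sqrt (LINT z|lborel. (norm (\<tau>' z))\<^sup>2) + 1"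
  have C: "C > 0" unfolding C_def by (simp add: add_nonneg_pos)
  have "norm (?J f) \<le> e" if e: "e > 0" for e
  proof -
    obtain h where h: "h \<in> coboundaries01 U" "L2_seminorm U (\<lambda>z. f z - h z) < e / C"
      using cl[of "e / C"] e C by auto
    have hL: "h \<in> L2_space U" using h(1) by (simp add: coboundary_iff)
    have dL: "(\<lambda>z. f z - h z) \<in> L2_space U" by (rule L2_space_diff(1)[OF f hL])
    have "?J f = ?J (\<lambda>z. f z - h z)"
      using coboundary_pairing_orthogonal[OF h(1) \<tau>]
      unfolding vector_minus_component
        zero_ext_pairing_diff[OF L2_space_component[OF f U] L2_space_component[OF hL U] U \<tau>(1)]
        zero_ext_pairing_diff[OF L2_space_component[OF f U] L2_space_component[OF hL U] U \<tau>(2)]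
      by simp
    also have "norm \<dots> \<le> L2_seminorm U (\<lambda>z. f z - h z) * sqrt (LINT z|lborel. (norm (\<tau> z))\<^sup>2)
        + L2_seminorm U (\<lambda>z. f z - h z) * sqrt (LINT z|lborel. (norm (\<tau>' z))\<^sup>2)"
      by (rule order_trans[OF norm_triangle_ineq4 add_mono[OF pairing_le_L2_seminorm[OF dL \<tau>(1)] pairing_le_L2_seminorm[OF dL \<tau>(2)]]])
    also have "\<dots> \<le> L2_seminorm U (\<lambda>z. f z - h z) * C"
    proof -
      have "L2_seminorm U (\<lambda>z. f z - h z) \<ge> 0" by (simp add: L2_seminorm_zero_ext)
      then show ?thesis by (simp add: C_def distrib_left)
    qed
    also have "\<dots> \<le> e" using h(2) C by (simp add: pos_less_divide_eq less_imp_le)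
    finally show ?thesis .
  qed
  then have "norm (?J f) \<le> 0" by (rule field_le_epsilon[of _ 0, simplified])
  then show ?thesis by simp
qed

section \<open>The Hausdorff criterion\<close>

lemma cohomology_class_eq_iff:
  fixes f g :: "complex ^ 'n::finite \<Rightarrow> complex ^ 'n"
  assumes f: "f \<in> cocycles01 U" and g: "g \<in> cocycles01 U" and U: "bounded U"
  shows "cohomology_class U f = cohomology_class U g \<longleftrightarrow> (\<lambda>z. f z - g z) \<in> coboundaries01 U"
proof
  assume "cohomology_class U f = cohomology_class U g"
  moreover have "f \<in> cohomology_class U f"
    using f zero_coboundary by (simp add: cohomology_class_def)
  ultimately show "(\<lambda>z. f z - g z) \<in> coboundaries01 U"
    by (simp add: cohomology_class_def)
next
  assume d: "(\<lambda>z. f z - g z) \<in> coboundaries01 U"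
  have "(\<lambda>z. h z - f z) \<in> coboundaries01 U \<longleftrightarrow> (\<lambda>z. h z - g z) \<in> coboundaries01 U" for h
  proof
    assume "(\<lambda>z. h z - f z) \<in> coboundaries01 U"
    from coboundaries01_add[OF this d U] show "(\<lambda>z. h z - g z) \<in> coboundaries01 U" by simp
  next
    assume "(\<lambda>z. h z - g z) \<in> coboundaries01 U"
    from coboundaries01_diff[OF this d U] show "(\<lambda>z. h z - f z) \<in> coboundaries01 U" by simp
  qed
  then show "cohomology_class U f = cohomology_class U g" by (simp add: cohomology_class_def)
qed

text \<open>If two classes differ, the difference of their representatives has positive distance \<open>e\<close> from the
  coboundaries; the classes at distance less than \<open>e/2\<close> from each of them form disjoint neighbourhoods.\<close>

lemma Hausdorff_if_coboundaries_closed: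
  fixes U :: "(complex ^ 'n::finite) set"
  assumes U: "bounded U"
    and cl: "\<And>f. f \<in> cocycles01 U \<Longrightarrow> (\<And>e. e > 0 \<Longrightarrow> \<exists>h\<in>coboundaries01 U. L2_seminorm U (\<lambda>z. f z - h z) < e)
      \<Longrightarrow> f \<in> coboundaries01 U"
  shows "Hausdorff_space (H01_topology U)"
  unfolding Hausdorff_space_def topspace_H01_topology
proof (intro allI impI, elim conjE)
  fix x y assume x: "x \<in> H01 U" and y: "y \<in> H01 U" and "x \<noteq> y"
  obtain f g where f: "f \<in> cocycles01 U" "x = cohomology_class U f" and g: "g \<in> cocycles01 U" "y = cohomology_class U g"
    using x y by (auto simp: H01_def)
  have L: "q \<in> L2_space U" if "q \<in> cocycles01 U \<or> q \<in> coboundaries01 U" for q :: "complex ^ 'n \<Rightarrow> complex ^ 'n"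
    using that by (auto simp: cocycles01_def coboundaries01_def)
  have "(\<lambda>z. f z - g z) \<notin> coboundaries01 U"
    using \<open>x \<noteq> y\<close> cohomology_class_eq_iff[OF f(1) g(1) U] f(2) g(2) by simp
  then obtain e where e: "e > 0" "\<And>h. h \<in> coboundaries01 U \<Longrightarrow> \<not> L2_seminorm U (\<lambda>z. (f z - g z) - h z) < e"
    using cl[OF cocycles01_diff[OF f(1) g(1) U]] by blast
  define W where "W p = {q \<in> cocycles01 U. \<exists>h\<in>coboundaries01 U. L2_seminorm U (\<lambda>z. q z - p z - h z) < e / 2}" for p
  define V where "V p = cohomology_class U ` W p" for p
  have pre: "{q \<in> cocycles01 U. cohomology_class U q \<in> V p} = W p" if p: "p \<in> cocycles01 U" for p
  proof
    show "W p \<subseteq> {q \<in> cocycles01 U. cohomology_class U q \<in> V p}" by (auto simp: W_def V_def)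
    show "{q \<in> cocycles01 U. cohomology_class U q \<in> V p} \<subseteq> W p"
    proof clarify
      fix q assume q: "q \<in> cocycles01 U" and "cohomology_class U q \<in> V p"
      then obtain r h where r: "r \<in> cocycles01 U" "cohomology_class U q = cohomology_class U r"
        and h: "h \<in> coboundaries01 U" "L2_seminorm U (\<lambda>z. r z - p z - h z) < e / 2"
        by (auto simp: V_def W_def)
      have "(\<lambda>z. q z - r z) \<in> coboundaries01 U" using cohomology_class_eq_iff[OF q r(1) U] r(2) by simp
      from coboundaries01_add[OF this h(1) U] h(2) show "q \<in> W p"
        unfolding W_def using q by (intro CollectI conjI bexI[of _ "\<lambda>z. q z - r z + h z"]) (simp_all add: algebra_simps)
    qed
  qed
  have "openin (H01_topology U) (V p)" if p: "p \<in> cocycles01 U" for p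
    unfolding openin_H01_topology pre[OF p] openin_cocycle_topology
  proof (intro conjI ballI)
    show "V p \<subseteq> H01 U" by (auto simp: V_def W_def H01_def)
    show "W p \<subseteq> cocycles01 U" by (auto simp: W_def)
    fix q assume "q \<in> W p"
    then obtain h where q: "q \<in> cocycles01 U" and h: "h \<in> coboundaries01 U" "L2_seminorm U (\<lambda>z. q z - p z - h z) < e / 2"
      by (auto simp: W_def)
    let ?d = "e / 2 - L2_seminorm U (\<lambda>z. q z - p z - h z)"
    show "\<exists>e>0. \<forall>r\<in>cocycles01 U. L2_seminorm U (\<lambda>z. r z - q z) < e \<longrightarrow> r \<in> W p"
    proof (intro exI[of _ ?d] conjI ballI impI)
      show "?d > 0" using h(2) by simp
      fix r assume r: "r \<in> cocycles01 U" "L2_seminorm U (\<lambda>z. r z - q z) < ?d"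
      have "L2_seminorm U (\<lambda>z. (r z - q z) + (q z - p z - h z)) \<le> L2_seminorm U (\<lambda>z. r z - q z) + L2_seminorm U (\<lambda>z. q z - p z - h z)"
        using r(1) q p h(1) by (intro L2_space_add(2) L2_space_diff(1)) (auto intro: L)
      moreover have "(\<lambda>z. (r z - q z) + (q z - p z - h z)) = (\<lambda>z. r z - p z - h z)" by (simp add: fun_eq_iff)
      ultimately have "L2_seminorm U (\<lambda>z. r z - p z - h z) < e / 2" using r(2) by simp
      then show "r \<in> W p" using r(1) h(1) by (auto simp: W_def)
    qed
  qed
  moreover have "x \<in> V f" "y \<in> V g"
  proof -
    have "L2_seminorm U (\<lambda>z. 0 :: complex ^ 'n) = 0" by (simp add: L2_seminorm_zero_ext zero_ext_zero)
    then have "p \<in> W p" if "p \<in> cocycles01 U" for p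
      unfolding W_def using that e(1) zero_coboundary by (intro CollectI conjI bexI[of _ "\<lambda>_. 0"]) simp_all
    then show "x \<in> V f" "y \<in> V g" using f g by (auto simp: V_def)
  qed
  moreover have "disjnt (V f) (V g)"
  proof (rule ccontr)
    assume "\<not> disjnt (V f) (V g)"
    then obtain q where "q \<in> W f" "cohomology_class U q \<in> V g" by (auto simp: disjnt_def V_def)
    then have "q \<in> W f" "q \<in> W g" using pre[OF g(1)] by (auto simp: W_def)
    then obtain h k where q: "q \<in> cocycles01 U" and h: "h \<in> coboundaries01 U" "L2_seminorm U (\<lambda>z. q z - f z - h z) < e / 2"
      and k: "k \<in> coboundaries01 U" "L2_seminorm U (\<lambda>z. q z - g z - k z) < e / 2"
      by (auto simp: W_def)
    have "L2_seminorm U (\<lambda>z. (q z - g z - k z) - (q z - f z - h z)) \<le> L2_seminorm U (\<lambda>z. q z - g z - k z) + L2_seminorm U (\<lambda>z. q z - f z - h z)"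
      using q f(1) g(1) h(1) k(1) by (intro L2_space_diff) (auto intro: L)
    also have "\<dots> < e" using h(2) k(2) by simp
    also have "(\<lambda>z. (q z - g z - k z) - (q z - f z - h z)) = (\<lambda>z. (f z - g z) - (k z - h z))" by (simp add: fun_eq_iff)
    finally have "L2_seminorm U (\<lambda>z. (f z - g z) - (k z - h z)) < e" .
    then show False using e(2)[OF coboundaries01_diff[OF k(1) h(1) U]] by simp
  qed
  ultimately show "\<exists>V W. openin (H01_topology U) V \<and> openin (H01_topology U) W \<and> x \<in> V \<and> y \<in> W \<and> disjnt V W"
    using f(1) g(1) by blast
qed

section \<open>Solving the equation off a compact product set\<close>

text \<open>The alternative in the last hypothesis gives two ways in which the obstruction \<open>u\<^sub>a - u\<^sub>b\<close> can vanish: a third variable,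
  or the orthogonality relations that coboundaries satisfy. If \<open>r\<close> bounds \<open>Om\<close>, the first one moves test
  functions with a kernel equal to the Cauchy kernel up to radius \<open>2 * r\<close> and zero beyond \<open>4 * r\<close>,
  which enlarges their supports to radius \<open>r + 4 * r = 5 * r\<close>; the kernel that defines \<open>u\<^sub>a\<close> and \<open>u\<^sub>b\<close> is therefore truncated at \<open>10 * r\<close>.\<close>

lemma coboundary_off_product:
  fixes K :: "'n::finite \<Rightarrow> complex set" and Om :: "(complex ^ 'n) set" and a b :: 'n
  defines "KK \<equiv> {z :: complex ^ 'n. \<forall>j. z $ j \<in> K j}"
  assumes ab: "a \<noteq> b" and K: "\<And>j. compact (K j)" "\<And>j. K j \<noteq> {}"
    and Om: "open Om" "bounded Om" "H01_zero Om" "KK \<subseteq> Om"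
    and f: "f \<in> cocycles01 (Om - KK)"
    and solvable: "(\<exists>c. c \<noteq> a \<and> c \<noteq> b) \<or>
      (\<forall>\<tau> \<tau>'. test_on (Om - KK) \<tau> \<longrightarrow> test_on (Om - KK) \<tau>' \<longrightarrow> (\<forall>z. dzbar b \<tau> z = dzbar a \<tau>' z) \<longrightarrow>
        (LINT z|lborel. zero_ext (Om - KK) (\<lambda>z. f z $ b) z * \<tau> z)
        = (LINT z|lborel. zero_ext (Om - KK) (\<lambda>z. f z $ a) z * \<tau>' z))"
  shows "f \<in> coboundaries01 (Om - KK)"
proof -
  let ?f = "zero_ext (Om - KK) f"
  have fL: "f \<in> L2_space (Om - KK)" and fC: "dbar_closed (Om - KK) f"
    using f by (auto simp: cocycles01_def)
  have bd: "bounded (Om - KK)" using Om(2) by (rule bounded_subset) blast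
  obtain r where r: "r > 0" "\<And>z. z \<in> Om \<Longrightarrow> norm z < r"
    using Om(2) unfolding bounded_pos_less by blast
  have OmP: "Om \<subseteq> polydisc r"
    unfolding polydisc_def using r(2) Finite_Cartesian_Product.norm_nth_le le_less_trans by blast
  have coord: "(\<lambda>z. z $ j) -` S = {z :: complex ^ 'n. z $ j \<in> S}" for j S by auto
  have clK: "closed {z :: complex ^ 'n. z $ j \<in> K j}" for j
    unfolding coord[symmetric] by (intro closed_vimage compact_imp_closed K(1) continuous_intros)
  have "KK = (\<Inter>j. {z. z $ j \<in> K j})" by (auto simp: KK_def)
  then have KKcl: "closed KK" using clK by auto
  then have KKc: "compact KK"
    using bounded_subset[OF Om(2) Om(4)] by (simp add: compact_eq_bounded_closed)
  define V where "V i = {z :: complex ^ 'n. \<exists>j. j \<noteq> i \<and> z $ j \<notin> K j}" for i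
  have Vo: "open (V i)" for i
  proof -
    have "V i = (\<Union>j\<in>UNIV - {i}. - {z. z $ j \<in> K j})" by (auto simp: V_def)
    then show ?thesis using clK by (simp add: open_UN open_Compl)
  qed
  have Vd: "V i \<inter> KK = {}" for i by (auto simp: V_def KK_def)
  have Vi: "z + axis i \<zeta> \<in> V i" if "z \<in> V i" for z i \<zeta>
    using that by (auto simp: V_def axis_def)
  have Vu: "V a \<union> V b = - KK" using ab by (auto simp: V_def KK_def)
  obtain h :: "complex ^ 'n \<Rightarrow> real" and W where h: "smooth h" "open W" "KK \<subseteq> W" "\<And>x. x \<in> W \<Longrightarrow> h x = 1"
    "compact (closure {x. h x \<noteq> 0})" "closure {x. h x \<noteq> 0} \<subseteq> Om"
    by (rule smooth_cutoff[OF KKc Om(1,4)]) (rule that)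
  define cut where "cut z = complex_of_real (h z)" for z
  have cut: "test_on Om cut" using h by (simp add: test_on_def cut_def[abs_def] smooth_of_real)
  obtain \<rho> :: "complex \<Rightarrow> complex" where \<rho>: "test_on (ball 0 (2 * (10 * r))) \<rho>" "\<And>\<zeta>. norm \<zeta> < 10 * r \<Longrightarrow> \<rho> \<zeta> = 1"
    using truncation_function[of "10 * r"] r(1) by auto
  have comp: "zero_ext (Om - KK) (\<lambda>z. f z $ k) = (\<lambda>z. ?f z $ k)" for k by (rule zero_ext_component)
  have L: "L12 (\<lambda>z. ?f z $ k)" for k
    using L2_space_vec_iff[OF bd, of f] fL unfolding comp by blast
  interpret hartogs_form Om KK "V a" "V b" W a b \<rho> cut "5 * r" "10 * r" ?f
  proof unfold_locales
    show "open (V a)" "open (V b)" by (rule Vo)+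
    show "V a \<inter> KK = {}" "V b \<inter> KK = {}" by (rule Vd)+
    show "Om \<subseteq> polydisc (5 * r)" by (rule order_trans[OF OmP polydisc_mono]) (use r(1) in simp)
    show "integrable lborel (\<lambda>z. ?f z $ k)" for k using L by (simp add: L12_def)
    show "(LINT z|lborel. ?f z $ k * dzbar j \<phi> z) = (LINT z|lborel. ?f z $ j * dzbar k \<phi> z)"
      if "test_on (Om - KK) \<phi>" for j k \<phi>
      using fC that unfolding dbar_closed_iff comp by blast
  qed (use Vi Vu ab cut h \<rho> r(1) in \<open>auto simp: cut_def\<close>)
  have zero: "(LINT z|lborel. (u_a z - u_b z) * \<phi> z) = 0" if \<phi>: "test_on (V a \<inter> V b \<inter> polydisc r) \<phi>" for \<phi>
    using solvable
  proof
    assume "\<exists>c. c \<noteq> a \<and> c \<noteq> b"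
    then obtain c where c: "c \<noteq> a" "c \<noteq> b" by blast
    have "norm w < r" if w: "w \<in> K j" for j w
    proof -
      \<comment> \<open>As all factors are nonempty, some point of \<open>KK\<close> has \<open>w\<close> as its \<open>j\<close>-th coordinate.\<close>
      have "(\<chi> i. if i = j then w else (SOME v. v \<in> K i)) \<in> KK"
        using w K(2) by (auto simp: KK_def some_in_eq)
      then have "(\<chi> i. if i = j then w else (SOME v. v \<in> K i)) \<in> polydisc r" using Om(4) OmP by blast
      then have "norm ((\<chi> i. if i = j then w else (SOME v. v \<in> K i)) $ j) < r" unfolding polydisc_def by blast
      then show ?thesis by simp
    qed
    then have "pairing \<phi> = 0"
      by (intro pairing_zero_three_variables[of K r c "2 * r"])
        (use K(1) c r(1) OmP \<phi> in \<open>auto simp: KK_def V_def intro: compact_imp_closed\<close>)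
    then show ?thesis by (simp add: pairing_def)
  next
    assume orth: "\<forall>\<tau> \<tau>'. test_on (Om - KK) \<tau> \<longrightarrow> test_on (Om - KK) \<tau>' \<longrightarrow> (\<forall>z. dzbar b \<tau> z = dzbar a \<tau>' z) \<longrightarrow>
        (LINT z|lborel. zero_ext (Om - KK) (\<lambda>z. f z $ b) z * \<tau> z)
        = (LINT z|lborel. zero_ext (Om - KK) (\<lambda>z. f z $ a) z * \<tau>' z)"
    have "test_on (V a) \<phi>" "test_on (V b) \<phi>" "test_on (polydisc (5 * r)) \<phi>"
      using polydisc_mono[of r "5 * r"] r(1) by (auto intro!: test_on_mono[OF \<phi>])
    then obtain \<tau> \<tau>' where \<tau>: "test_on (Om - KK) \<tau>" "test_on (Om - KK) \<tau>'" "\<And>z. dzbar b \<tau> z = dzbar a \<tau>' z"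
      and eq: "(LINT z|lborel. (u_a z - u_b z) * \<phi> z) = I b \<tau> - I a \<tau>'"
      by (rule u_diff_pairing) (rule that)
    have "I b \<tau> = I a \<tau>'"
      using orth \<tau> unfolding comp I_def by blast
    then show ?thesis using eq by simp
  qed
  have "\<exists>g\<in>L2_space (Om - KK). is_dbar (Om - KK) g ?f"
  proof (rule coboundary_if_pairing_zero[OF L _ Om(1) KKcl Om(3) OmP _ zero])
    show "?f z = 0" if "z \<notin> Om - KK" for z unfolding zero_ext_def by (rule if_not_P[OF that])
    show "r \<le> 5 * r" using r(1) by simp
  qed
  moreover have "zero_ext (Om - KK) (\<lambda>z. ?f z $ k) = zero_ext (Om - KK) (\<lambda>z. f z $ k)" for k
    by (auto simp: zero_ext_def)
  ultimately show ?thesis using fL by (simp add: coboundary_iff is_dbar_iff)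
qed

theorem corollary1p4:
  fixes K :: "'n::finite \<Rightarrow> complex set"
    and \<Omega>' :: "(complex ^ 'n) set"
  defines "KK \<equiv> {z :: complex ^ 'n. \<forall>j. z $ j \<in> K j}"
  assumes "CARD('n) \<ge> 2"
    and "\<And>j. compact (K j)"
    and "\<And>j. K j \<noteq> {}"
    and "open \<Omega>'" and "connected \<Omega>'" and "bounded \<Omega>'"
    and "H01_zero \<Omega>'"
    and "KK \<subseteq> \<Omega>'"
    and "\<Omega>' - KK \<noteq> {}"
    and "connected (\<Omega>' - KK)"
  shows "Hausdorff_space (H01_topology (\<Omega>' - KK)) \<and>
         (CARD('n) \<ge> 3 \<longrightarrow> H01_zero (\<Omega>' - KK))"
proof -
  have "\<not> (\<exists>a. (UNIV :: 'n set) = {a})"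
  proof
    assume "\<exists>a. (UNIV :: 'n set) = {a}"
    then obtain a where "(UNIV :: 'n set) = {a}" ..
    then have "CARD('n) = card {a}" by (rule arg_cong)
    then show False using assms(2) by simp
  qed
  then obtain a b :: 'n where ab: "a \<noteq> b" by (metis UNIV_eq_I insertI1 singletonI)
  note solve = coboundary_off_product[OF ab, of K \<Omega>', folded KK_def, OF assms(3,4,5,7,8,9)]
  have bd: "bounded (\<Omega>' - KK)" using assms(7) by (rule bounded_subset) blast
  show ?thesis
  proof (intro conjI impI)
    show "Hausdorff_space (H01_topology (\<Omega>' - KK))"
    proof (rule Hausdorff_if_coboundaries_closed[OF bd])
      fix f assume f: "f \<in> cocycles01 (\<Omega>' - KK)"
        and cl: "\<And>e. e > 0 \<Longrightarrow> \<exists>h\<in>coboundaries01 (\<Omega>' - KK). L2_seminorm (\<Omega>' - KK) (\<lambda>z. f z - h z) < e"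
      have "f \<in> L2_space (\<Omega>' - KK)" using f by (simp add: cocycles01_def)
      from closure_pairing_orthogonal[OF this bd cl] show "f \<in> coboundaries01 (\<Omega>' - KK)"
        by (intro solve[OF f] disjI2) blast
    qed
  next
    assume "3 \<le> CARD('n)"
    have "\<exists>c. c \<noteq> a \<and> c \<noteq> b"
    proof (rule ccontr)
      assume "\<nexists>c. c \<noteq> a \<and> c \<noteq> b"
      then have "(UNIV :: 'n set) \<subseteq> {a, b}" by blast
      then have "CARD('n) \<le> card {a, b}" by (rule card_mono[rotated]) simp
      also have "\<dots> \<le> 2" by (simp add: card_insert_if)
      finally show False using \<open>3 \<le> CARD('n)\<close> by simp
    qed
    then have cob: "f \<in> coboundaries01 (\<Omega>' - KK)" if "f \<in> cocycles01 (\<Omega>' - KK)" for f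
      using solve[OF that] by blast
    have 0: "(\<lambda>_. 0) \<in> cocycles01 (\<Omega>' - KK)"
      by (simp add: cocycles01_def dbar_closed_iff L2_space_iff zero_ext_zero)
    have "cohomology_class (\<Omega>' - KK) f = cohomology_class (\<Omega>' - KK) (\<lambda>_. 0)" if "f \<in> cocycles01 (\<Omega>' - KK)" for f
      using cohomology_class_eq_iff[OF that 0 bd] cob[OF that] by simp
    then show "H01_zero (\<Omega>' - KK)"
      unfolding H01_zero_def H01_def using 0 by blast
  qed
qed

end
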